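(* For every countable limit ordinal $\lambda$ there is a countable linear ordering whose Scott sentence complexity is $\Sigma^{\mathrm{in}}_{\lambda+2}$.
   Context: Infinitary formulas: $\Sigma^{\mathrm{in}}_0=\Pi^{\mathrm{in}}_0$ are the finitary quantifier-free formulas; for $\alpha\ge1$, a $\Sigma^{\mathrm{in}}_\alpha$ formula is a countable disjunction of formulas $\exists\bar x\,\varphi$ with $\varphi\in\Pi^{\mathrm{in}}_\beta$, $\beta<\alpha$, and $\Pi^{\mathrm{in}}_\alpha$ is dual; $d\text{-}\Sigma^{\mathrm{in}}_\alpha$ formulas are conjunctions of a $\Sigma^{\mathrm{in}}_\alpha$ and a $\Pi^{\mathrm{in}}_\alpha$ formula. A Scott sentence of a countable structure is an $L_{\omega_1\omega}$ sentence whose countable models are exactly its isomorphic copies. The Scott sentence complexity of a structure is the least class among $\Pi^{\mathrm{in}}_\alpha,\Sigma^{\mathrm{in}}_\alpha,d\text{-}\Sigma^{\mathrm{in}}_\alpha$ ($\alpha\ge1$) in which it has a Scott sentence, classes ordered by inclusion up to equivalence ($\Pi_\alpha,\Sigma_\alpha\subseteq d\text{-}\Sigma_\alpha\subseteq \Sigma_{\alpha+1}\cap\Pi_{\alpha+1}$). *)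

theory Defs
  imports Main "HOL-Library.Countable_Set"
begin

section \<open>Countable ordinals\<close>

text \<open>The countable ordinals are the elements of \<open>\<omega>\<^sub>1\<close>, the initial ordinal
  \<^term>\<open>cardSuc natLeq\<close>. The lemmas \<open>countable_below\<close>, \<open>no_largest\<close> and
  \<open>countable_wellorder_represented\<close> below show that this type contains a representative of every
  countable well-order type and nothing else.\<close>

lemma Well_order_omega1: "Well_order (cardSuc natLeq)"
  by (rule cardSuc_Well_order[OF natLeq_Card_order])

typedef omega1 = "Field (cardSuc natLeq)"
  using Field_cardSuc_not_empty[OF natLeq_Card_order] by blast

instantiation omega1 :: wellorder
begin

definition less_eq_omega1 :: "omega1 \<Rightarrow> omega1 \<Rightarrow> bool" where
  "a \<le> b \<longleftrightarrow> (Rep_omega1 a, Rep_omega1 b) \<in> cardSuc natLeq"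

definition less_omega1 :: "omega1 \<Rightarrow> omega1 \<Rightarrow> bool" where
  "a < b \<longleftrightarrow> a \<le> b \<and> a \<noteq> (b :: omega1)"

instance
proof
  let ?r = "cardSuc natLeq"
  have w: "refl_on (Field ?r) ?r" "trans ?r" "antisym ?r" "total_on (Field ?r) ?r" "wf (?r - Id)"
    using Well_order_omega1 by (auto simp: order_on_defs)
  fix x y z :: omega1
  show "x \<le> x"
    using w(1) Rep_omega1[of x] by (auto simp: less_eq_omega1_def refl_on_def)
  show "x \<le> y \<Longrightarrow> y \<le> z \<Longrightarrow> x \<le> z"
    unfolding less_eq_omega1_def using w(2) by (meson transD)
  show "x \<le> y \<Longrightarrow> y \<le> x \<Longrightarrow> x = y"
    unfolding less_eq_omega1_def by (metis antisymD w(3) Rep_omega1_inject)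
  show "(x < y) = (x \<le> y \<and> \<not> y \<le> x)"
    unfolding less_eq_omega1_def less_omega1_def
    by (metis antisymD refl_onD w(1,3) Rep_omega1 Rep_omega1_inject)
  show "x \<le> y \<or> y \<le> x"
    using w(1,4) Rep_omega1[of x] Rep_omega1[of y]
    by (cases "x = y") (auto simp: less_eq_omega1_def total_on_def refl_on_def Rep_omega1_inject)
  fix P :: "omega1 \<Rightarrow> bool" and a :: omega1
  assume step: "\<And>x. (\<And>y. y < x \<Longrightarrow> P y) \<Longrightarrow> P x"
  have "wf (inv_image (?r - Id) Rep_omega1)"
    using w(5) by (rule wf_inv_image)
  then show "P a"
  proof (induction a rule: wf_induct_rule)
    case (less x)
    show ?case
      by (rule step, rule less)
        (auto simp: inv_image_def less_omega1_def less_eq_omega1_def Rep_omega1_inject)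
  qed
qed

end

instantiation omega1 :: zero
begin

definition zero_omega1 :: omega1 where
  "0 = (LEAST a :: omega1. True)"

instance ..

end

definition succ_ord :: "omega1 \<Rightarrow> omega1" where
  "succ_ord a = (LEAST b. a < b)"

definition limit_ord :: "omega1 \<Rightarrow> bool" where
  "limit_ord a \<longleftrightarrow> a \<noteq> 0 \<and> (\<nexists>b. a = succ_ord b)"

lemma countable_below: "countable {..<a :: omega1}"
proof -
  include cardinal_syntax
  let ?r = "cardSuc natLeq"
  have "|underS ?r (Rep_omega1 a)| <o ?r"
    using card_of_underS[OF cardSuc_Card_order[OF natLeq_Card_order] Rep_omega1] .
  then have "|underS ?r (Rep_omega1 a)| \<le>o natLeq"
    using cardSuc_ordLeq_ordLess[OF natLeq_Card_order card_of_Card_order] by blast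
  then have "|underS ?r (Rep_omega1 a)| \<le>o |UNIV :: nat set|"
    using ordLeq_ordIso_trans card_of_nat ordIso_symmetric by blast
  then have "countable (underS ?r (Rep_omega1 a))"
    unfolding countable_def card_of_ordLeq[symmetric] by blast
  moreover have "Rep_omega1 ` {..<a} \<subseteq> underS ?r (Rep_omega1 a)"
    by (auto simp: underS_def less_omega1_def less_eq_omega1_def Rep_omega1_inject)
  ultimately have "countable (Rep_omega1 ` {..<a})"
    by (rule countable_subset[rotated])
  then show ?thesis
    by (rule countable_image_inj_on) (auto simp: inj_on_def Rep_omega1_inject)
qed

lemma no_largest: "\<exists>b. (a :: omega1) < b"
proof -
  have inf: "infinite (Field (cardSuc natLeq))"
    using cardSuc_finite[OF natLeq_Card_order] Field_natLeq infinite_UNIV_nat by simp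
  obtain b where "b \<in> Field (cardSuc natLeq)" "Rep_omega1 a \<noteq> b" "(Rep_omega1 a, b) \<in> cardSuc natLeq"
    using infinite_Card_order_limit[OF cardSuc_Card_order[OF natLeq_Card_order] inf Rep_omega1] by blast
  then have "a < Abs_omega1 b"
    by (auto simp: less_omega1_def less_eq_omega1_def Abs_omega1_inverse)
  then show ?thesis ..
qed

lemma less_succ_ord_iff: "a < succ_ord b \<longleftrightarrow> a \<le> b"
proof
  show "a < succ_ord b \<Longrightarrow> a \<le> b"
    unfolding succ_ord_def using not_less_Least by fastforce
  have "b < succ_ord b"
    unfolding succ_ord_def using no_largest by (metis LeastI_ex)
  then show "a \<le> b \<Longrightarrow> a < succ_ord b" by simp
qed

lemma countable_wellorder_represented:
  assumes "Well_order r" and "countable (Field r)"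
  shows "\<exists>(a :: omega1) f. bij_betw f (Field r) {..<a} \<and>
           (\<forall>x\<in>Field r. \<forall>y\<in>Field r. (x, y) \<in> r \<longleftrightarrow> f x \<le> f y)"
proof -
  include cardinal_syntax
  let ?r = "cardSuc natLeq"
  have "|Field r| \<le>o natLeq"
    using assms(2) card_of_ordLeq[of "Field r" "UNIV :: nat set"] card_of_nat ordLeq_ordIso_trans
    unfolding countable_def by blast
  then have lt: "|Field r| <o ?r"
    using cardSuc_ordLeq_ordLess[OF natLeq_Card_order card_of_Card_order] by blast
  have "r <o ?r"
  proof (rule ccontr)
    assume "\<not> r <o ?r"
    then have "?r \<le>o r"
      using assms(1) Well_order_omega1 not_ordLess_iff_ordLeq by blast
    then have "|Field ?r| \<le>o |Field r|"
      by (rule card_of_mono2)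
    moreover have "?r =o |Field ?r|"
      using Card_order_iff_ordIso_card_of cardSuc_Card_order natLeq_Card_order by blast
    ultimately have "?r \<le>o |Field r|"
      using ordIso_ordLeq_trans by blast
    then show False
      using lt not_ordLess_ordLeq by blast
  qed
  then obtain c where c: "c \<in> Field ?r" and "r =o Restr ?r (underS ?r c)"
    using ordLess_iff_ordIso_Restr[OF Well_order_omega1 assms(1)] by blast
  then obtain g where g: "iso r (Restr ?r (underS ?r c)) g"
    unfolding ordIso_def by blast
  let ?a = "Abs_omega1 c"
  have fR: "Field (Restr ?r (underS ?r c)) = underS ?r c"
    using Well_order_omega1 by (intro Refl_Field_Restr2) (auto simp: order_on_defs underS_def Field_def)
  have bij: "bij_betw g (Field r) (underS ?r c)"
    using g fR unfolding iso_def by simp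
  have cmp: "(x, y) \<in> r \<longleftrightarrow> (g x, g y) \<in> ?r" if "x \<in> Field r" "y \<in> Field r" for x y
  proof -
    have "(x, y) \<in> r \<longleftrightarrow> (g x, g y) \<in> Restr ?r (underS ?r c)"
      using g that unfolding iso_iff2 by blast
    moreover have "g x \<in> underS ?r c" "g y \<in> underS ?r c"
      using bij that by (auto simp: bij_betw_def)
    ultimately show ?thesis by blast
  qed
  have sub: "underS ?r c \<subseteq> Field ?r"
    by (auto simp: underS_def Field_def)
  have bij2: "bij_betw Abs_omega1 (underS ?r c) {..<?a}"
  proof (rule bij_betw_byWitness[where f' = Rep_omega1])
    show "\<forall>x\<in>underS ?r c. Rep_omega1 (Abs_omega1 x) = x"
      using sub Abs_omega1_inverse by blast
    show "\<forall>x\<in>{..<?a}. Abs_omega1 (Rep_omega1 x) = x"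
      by (simp add: Rep_omega1_inverse)
    show "Abs_omega1 ` underS ?r c \<subseteq> {..<?a}"
    proof
      fix z assume "z \<in> Abs_omega1 ` underS ?r c"
      then obtain x where x: "x \<in> underS ?r c" "z = Abs_omega1 x" by blast
      then have "x \<in> Field ?r" using sub by blast
      then show "z \<in> {..<?a}"
        using x c by (auto simp: underS_def less_omega1_def less_eq_omega1_def
            Abs_omega1_inverse Abs_omega1_inject)
    qed
    show "Rep_omega1 ` {..<?a} \<subseteq> underS ?r c"
      using c by (auto simp: underS_def less_omega1_def less_eq_omega1_def
          Abs_omega1_inverse Rep_omega1_inverse)
  qed
  have "bij_betw (Abs_omega1 \<circ> g) (Field r) {..<?a}"
    using bij bij2 by (rule bij_betw_trans)
  moreover have "(x, y) \<in> r \<longleftrightarrow> (Abs_omega1 \<circ> g) x \<le> (Abs_omega1 \<circ> g) y"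
    if "x \<in> Field r" "y \<in> Field r" for x y
  proof -
    have "g x \<in> Field ?r" "g y \<in> Field ?r"
      using bij sub that by (auto simp: bij_betw_def)
    then show ?thesis
      using cmp[OF that] by (simp add: less_eq_omega1_def Abs_omega1_inverse)
  qed
  ultimately show ?thesis by blast
qed


section \<open>Infinitary formulas in the language of one binary relation\<close>

text \<open>Variables are natural numbers. Countable connectives are indexed by \<^typ>\<open>nat\<close>; finite ones
  arise by repetition and the empty ones from \<open>Bot\<close>. The binary connectives are needed to speak
  of finitary quantifier-free formulas.\<close>

datatype form =
    Bot
  | Eq nat nat
  | Le nat nat
  | Neg form
  | And form form
  | Or form form
  | Conj "nat \<Rightarrow> form"
  | Disj "nat \<Rightarrow> form"
  | Ex nat form
  | All nat form

primrec fv :: "form \<Rightarrow> nat set" where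
  "fv Bot = {}"
| "fv (Eq x y) = {x, y}"
| "fv (Le x y) = {x, y}"
| "fv (Neg \<phi>) = fv \<phi>"
| "fv (And \<phi> \<psi>) = fv \<phi> \<union> fv \<psi>"
| "fv (Or \<phi> \<psi>) = fv \<phi> \<union> fv \<psi>"
| "fv (Conj \<Phi>) = (\<Union>i. fv (\<Phi> i))"
| "fv (Disj \<Phi>) = (\<Union>i. fv (\<Phi> i))"
| "fv (Ex x \<phi>) = fv \<phi> - {x}"
| "fv (All x \<phi>) = fv \<phi> - {x}"

definition sentence :: "form \<Rightarrow> bool" where
  "sentence \<phi> \<longleftrightarrow> fv \<phi> = {}"

text \<open>A structure is given by its domain \<open>A\<close> and a relation \<open>R\<close>, of which only the restriction to
  \<open>A\<close> matters.\<close>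

primrec sat :: "'a set \<Rightarrow> 'a rel \<Rightarrow> form \<Rightarrow> (nat \<Rightarrow> 'a) \<Rightarrow> bool" where
  "sat A R Bot e \<longleftrightarrow> False"
| "sat A R (Eq x y) e \<longleftrightarrow> e x = e y"
| "sat A R (Le x y) e \<longleftrightarrow> (e x, e y) \<in> R"
| "sat A R (Neg \<phi>) e \<longleftrightarrow> \<not> sat A R \<phi> e"
| "sat A R (And \<phi> \<psi>) e \<longleftrightarrow> sat A R \<phi> e \<and> sat A R \<psi> e"
| "sat A R (Or \<phi> \<psi>) e \<longleftrightarrow> sat A R \<phi> e \<or> sat A R \<psi> e"
| "sat A R (Conj \<Phi>) e \<longleftrightarrow> (\<forall>i. sat A R (\<Phi> i) e)"
| "sat A R (Disj \<Phi>) e \<longleftrightarrow> (\<exists>i. sat A R (\<Phi> i) e)"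
| "sat A R (Ex x \<phi>) e \<longleftrightarrow> (\<exists>a\<in>A. sat A R \<phi> (e(x := a)))"
| "sat A R (All x \<phi>) e \<longleftrightarrow> (\<forall>a\<in>A. sat A R \<phi> (e(x := a)))"

definition models :: "'a set \<Rightarrow> 'a rel \<Rightarrow> form \<Rightarrow> bool" where
  "models A R \<phi> \<longleftrightarrow> (\<forall>e. range e \<subseteq> A \<longrightarrow> sat A R \<phi> e)"

primrec finitary_qf :: "form \<Rightarrow> bool" where
  "finitary_qf Bot \<longleftrightarrow> True"
| "finitary_qf (Eq x y) \<longleftrightarrow> True"
| "finitary_qf (Le x y) \<longleftrightarrow> True"
| "finitary_qf (Neg \<phi>) \<longleftrightarrow> finitary_qf \<phi>"
| "finitary_qf (And \<phi> \<psi>) \<longleftrightarrow> finitary_qf \<phi> \<and> finitary_qf \<psi>"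
| "finitary_qf (Or \<phi> \<psi>) \<longleftrightarrow> finitary_qf \<phi> \<and> finitary_qf \<psi>"
| "finitary_qf (Conj \<Phi>) \<longleftrightarrow> False"
| "finitary_qf (Disj \<Phi>) \<longleftrightarrow> False"
| "finitary_qf (Ex x \<phi>) \<longleftrightarrow> False"
| "finitary_qf (All x \<phi>) \<longleftrightarrow> False"

definition Exs :: "nat list \<Rightarrow> form \<Rightarrow> form" where
  "Exs xs \<phi> = foldr Ex xs \<phi>"

definition Alls :: "nat list \<Rightarrow> form \<Rightarrow> form" where
  "Alls xs \<phi> = foldr All xs \<phi>"

inductive Sigma_in :: "omega1 \<Rightarrow> form \<Rightarrow> bool" and Pi_in :: "omega1 \<Rightarrow> form \<Rightarrow> bool" where
  Sigma_zero: "finitary_qf \<phi> \<Longrightarrow> Sigma_in 0 \<phi>"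
| Pi_zero: "finitary_qf \<phi> \<Longrightarrow> Pi_in 0 \<phi>"
| Sigma_pos: "(\<And>i. \<beta> i < \<alpha> \<and> Pi_in (\<beta> i) (\<Phi> i)) \<Longrightarrow> Sigma_in \<alpha> (Disj (\<lambda>i. Exs (xs i) (\<Phi> i)))"
| Pi_pos: "(\<And>i. \<beta> i < \<alpha> \<and> Sigma_in (\<beta> i) (\<Phi> i)) \<Longrightarrow> Pi_in \<alpha> (Conj (\<lambda>i. Alls (xs i) (\<Phi> i)))"

definition dSigma_in :: "omega1 \<Rightarrow> form \<Rightarrow> bool" where
  "dSigma_in \<alpha> \<chi> \<longleftrightarrow> (\<exists>\<phi> \<psi>. \<chi> = And \<phi> \<psi> \<and> Sigma_in \<alpha> \<phi> \<and> Pi_in \<alpha> \<psi>)"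


section \<open>Scott sentences and Scott sentence complexity\<close>

definition isomorphic :: "'a set \<Rightarrow> 'a rel \<Rightarrow> 'b set \<Rightarrow> 'b rel \<Rightarrow> bool" where
  "isomorphic A R B S \<longleftrightarrow>
     (\<exists>f. bij_betw f A B \<and> (\<forall>x\<in>A. \<forall>y\<in>A. (x, y) \<in> R \<longleftrightarrow> (f x, f y) \<in> S))"

text \<open>Up to isomorphism, the countable structures are the ones whose domain is a nonempty set of
  natural numbers.\<close>

definition scott_sentence :: "'a set \<Rightarrow> 'a rel \<Rightarrow> form \<Rightarrow> bool" where
  "scott_sentence A R \<phi> \<longleftrightarrow> sentence \<phi> \<and>
     (\<forall>(B :: nat set) S. B \<noteq> {} \<longrightarrow> (models B S \<phi> \<longleftrightarrow> isomorphic A R B S))"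

datatype complexity = SigmaC omega1 | PiC omega1 | dSigmaC omega1

primrec complexity_index :: "complexity \<Rightarrow> omega1" where
  "complexity_index (SigmaC \<alpha>) = \<alpha>"
| "complexity_index (PiC \<alpha>) = \<alpha>"
| "complexity_index (dSigmaC \<alpha>) = \<alpha>"

primrec in_class :: "complexity \<Rightarrow> form \<Rightarrow> bool" where
  "in_class (SigmaC \<alpha>) = Sigma_in \<alpha>"
| "in_class (PiC \<alpha>) = Pi_in \<alpha>"
| "in_class (dSigmaC \<alpha>) = dSigma_in \<alpha>"

text \<open>By the downward Loewenheim-Skolem theorem for \<open>L\<^sub>\<omega>\<^sub>1\<^sub>\<omega>\<close>, sentences that agree on all countable
  structures agree on all structures.\<close>

definition equivalent :: "form \<Rightarrow> form \<Rightarrow> bool" where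
  "equivalent \<phi> \<psi> \<longleftrightarrow> (\<forall>(B :: nat set) S. B \<noteq> {} \<longrightarrow> (models B S \<phi> \<longleftrightarrow> models B S \<psi>))"

text \<open>Inclusion up to equivalence is taken on sentences, the only formulas relevant here; this
  avoids formulas with infinitely many free variables.\<close>

definition class_le :: "complexity \<Rightarrow> complexity \<Rightarrow> bool" where
  "class_le \<Gamma> \<Delta> \<longleftrightarrow>
     (\<forall>\<phi>. sentence \<phi> \<and> in_class \<Gamma> \<phi> \<longrightarrow> (\<exists>\<psi>. sentence \<psi> \<and> in_class \<Delta> \<psi> \<and> equivalent \<phi> \<psi>))"

definition has_scott_sentence_in :: "'a set \<Rightarrow> 'a rel \<Rightarrow> complexity \<Rightarrow> bool" where
  "has_scott_sentence_in A R \<Gamma> \<longleftrightarrow> (\<exists>\<phi>. in_class \<Gamma> \<phi> \<and> scott_sentence A R \<phi>)"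

definition scott_sentence_complexity :: "'a set \<Rightarrow> 'a rel \<Rightarrow> complexity \<Rightarrow> bool" where
  "scott_sentence_complexity A R \<Gamma> \<longleftrightarrow>
     0 < complexity_index \<Gamma> \<and> has_scott_sentence_in A R \<Gamma> \<and>
     (\<forall>\<Delta>. 0 < complexity_index \<Delta> \<and> has_scott_sentence_in A R \<Delta> \<longrightarrow> class_le \<Gamma> \<Delta>)"

end

theory Submission
  imports Defs "HOL-Library.Multiset_Order" "HOL-Library.Disjoint_Sets" "HOL-Analysis.Continuum_Not_Denumerable"
begin

text \<open>Call a copy of \<open>\<omega>\<^bsup>\<gamma>\<^esup> + 1\<close> a block of label \<open>\<gamma>\<close>, and let \<open>Q\<^sub>\<beta>\<close> be the countable dense order without
  endpoints in which each element is replaced by a block of label \<open>\<gamma> \<le> \<beta>\<close>, every label occurring densely;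
  let \<open>Q\<^sub>\<lambda>\<close> be the same with all labels \<open>\<gamma> < \<lambda>\<close>. Put \<open>T = \<dots> + Q\<^sub>\<beta> + \<dots> + Q\<^sub>1 + Q\<^sub>0\<close>, summed over \<open>\<beta> < \<lambda>\<close> in
  decreasing order. The order of complexity \<open>\<Sigma>\<^bsub>\<lambda> + 2\<^esub>\<close> is \<open>A = Q\<^sub>\<lambda> + (\<omega>\<^bsup>0\<^esup> + 1) + T\<close>.

  Given the least element \<open>p\<close> of the middle block as a parameter, \<open>A\<close> is described up to isomorphism by a
  \<open>\<Pi>\<^bsub>\<lambda> + 1\<^esub>\<close> formula: blocks of label \<open>\<gamma> < \<lambda>\<close> are definable at levels below \<open>\<lambda>\<close>, and each \<open>Q\<^sub>\<beta>\<close> in \<open>T\<close>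
  consists of the blocks after \<open>p\<close> whose final segment has the labels up to \<open>\<beta>\<close>. Quantifying \<open>p\<close> gives a
  \<open>\<Sigma>\<^bsub>\<lambda> + 2\<^esub>\<close> Scott sentence.

  There is no simpler one because \<open>B = Q\<^sub>\<lambda> + T\<close>, in which no parameter \<open>p\<close> as above exists, satisfies
  every \<open>\<Pi>\<^bsub>\<lambda> + 2\<^esub>\<close> sentence true in \<open>A\<close>. Cutting \<open>Q\<^sub>\<lambda>\<close> at a block of label \<open>0\<close> embeds \<open>A\<close> into \<open>B\<close> as
  \<open>Q\<^sub>\<lambda> + (\<omega>\<^bsup>0\<^esup> + 1)\<close> followed by \<open>T\<close>, omitting the rest of \<open>Q\<^sub>\<lambda>\<close>. Up to level \<open>\<delta> < \<lambda>\<close> labels at least \<open>\<delta>\<close> are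
  indistinguishable, so the omitted piece is absorbed by any \<open>Q\<^sub>\<beta>\<close> with \<open>\<delta> \<le> \<beta> < \<lambda>\<close>, and the embedding
  preserves \<open>\<Pi>\<^sub>\<lambda>\<close> formulas. Translating the cut to the right, every finite subset of \<open>B\<close> lies in the
  image of such an embedding.\<close>


section \<open>Countable ordinals\<close>

lemma omega1_zero_le [simp]: "0 \<le> (a :: omega1)"
  unfolding zero_omega1_def by (simp add: Least_le)

lemma not_less_omega1_zero [simp]: "\<not> a < (0 :: omega1)"
  by (simp add: not_less)

lemma omega1_neq_zero_iff: "a \<noteq> 0 \<longleftrightarrow> 0 < (a :: omega1)"
  by (metis omega1_zero_le order_le_less not_less_omega1_zero)

lemma less_succ_ord [simp]: "a < succ_ord a"
  by (simp add: less_succ_ord_iff)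

lemma succ_ord_pos [simp]: "0 < succ_ord a"
  by (simp add: less_succ_ord_iff)

lemma succ_ord_le_iff: "succ_ord a \<le> b \<longleftrightarrow> a < b"
  using less_succ_ord_iff[of b a] by (simp add: linorder_not_less[symmetric])

lemma countable_atMost_omega1: "countable {..a :: omega1}"
  using countable_below[of "succ_ord a"] by (simp add: less_succ_ord_iff lessThan_def atMost_def)

lemma limit_ord_succ: "limit_ord l \<Longrightarrow> a < l \<Longrightarrow> succ_ord a < l"
  unfolding limit_ord_def by (metis order_le_less succ_ord_le_iff)

lemma limit_ord_pos: "limit_ord l \<Longrightarrow> 0 < l"
  by (simp add: limit_ord_def omega1_neq_zero_iff)

lemma limit_ord_finite_bound:
  assumes "limit_ord l" "finite X" "X \<subseteq> {..<l}"
  shows "\<exists>\<beta><l. \<forall>x\<in>X. x < \<beta>"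
  using assms(2,3)
proof (induction X rule: finite_induct)
  case empty
  then show ?case using limit_ord_pos[OF assms(1)] by blast
next
  case (insert x X)
  then obtain \<beta> where "\<beta> < l" "\<forall>y\<in>X. y < \<beta>" by auto
  then show ?case
    using insert.prems limit_ord_succ[OF assms(1), of x]
    by (intro exI[of _ "max \<beta> (succ_ord x)"]) (auto simp: less_max_iff_disj)
qed

lemma omega1_cases:
  obtains (zero) "a = 0" | (succ) b where "a = succ_ord b" | (limit) "limit_ord a"
  by (auto simp: limit_ord_def)

lemma limit_ord_funpow_succ: "limit_ord l \<Longrightarrow> a < l \<Longrightarrow> (succ_ord ^^ n) a < l"
  by (induction n) (auto intro: limit_ord_succ)

lemma le_funpow_succ: "a \<le> (succ_ord ^^ n) a"
  by (induction n) (auto intro: order.trans less_imp_le[OF less_succ_ord])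

lemma funpow_succ_mono:
  assumes "m \<le> n" "a \<le> b"
  shows "(succ_ord ^^ m) a \<le> (succ_ord ^^ n) b"
proof -
  have "(succ_ord ^^ m) a \<le> (succ_ord ^^ m) b"
    using assms(2) by (induction m) (auto simp: succ_ord_le_iff less_succ_ord_iff)
  also have "\<dots> \<le> (succ_ord ^^ n) b"
    by (metis assms(1) funpow_add le_funpow_succ le_add_diff_inverse2 o_apply)
  finally show ?thesis .
qed


section \<open>Finite multisets as ordinals in Cantor normal form\<close>

declare mset_lt_single_right_iff [simp del] mset_le_single_right_iff [simp del]

lemma less_multiset_iff_greatest_difference:
  fixes M N :: "'a::linorder multiset"
  shows "M < N \<longleftrightarrow> (\<exists>a. count M a < count N a \<and> (\<forall>x>a. count M x = count N x))"
proof
  assume "\<exists>a. count M a < count N a \<and> (\<forall>x>a. count M x = count N x)"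
  then obtain a where a: "count M a < count N a" "\<And>x. x > a \<Longrightarrow> count M x = count N x"
    by blast
  have "\<exists>x>y. count M x < count N x" if "count N y < count M y" for y
    using a that by (cases y a rule: linorder_cases) auto
  then show "M < N"
    using a(1) unfolding less_multiset\<^sub>H\<^sub>O by auto
next
  assume less: "M < N"
  let ?D = "{x. count M x \<noteq> count N x}"
  have "?D \<subseteq> set_mset M \<union> set_mset N"
    by (auto simp: not_in_iff)
  then have fin: "finite ?D"
    by (rule finite_subset) simp
  have "?D \<noteq> {}"
    using less by (auto simp: multiset_eq_iff[symmetric])
  define a where "a = Max ?D"
  have "count M a \<noteq> count N a"
    using Max_in[OF fin \<open>?D \<noteq> {}\<close>] by (simp add: a_def)
  moreover have above: "count M x = count N x" if "x > a" for x
    using Max_ge[OF fin, of x] that by (force simp: a_def)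
  moreover have "\<not> count N a < count M a"
    using less above unfolding less_multiset\<^sub>H\<^sub>O by (metis less_irrefl)
  ultimately show "\<exists>a. count M a < count N a \<and> (\<forall>x>a. count M x = count N x)"
    by (metis linorder_neqE_nat)
qed

text \<open>A multiset \<open>{#b\<^sub>1, \<dots>, b\<^sub>k#}\<close> with \<open>b\<^sub>1 \<ge> \<dots> \<ge> b\<^sub>k\<close> stands for the ordinal
  \<open>\<omega>\<^bsup>b\<^sub>1\<^esup> + \<dots> + \<omega>\<^bsup>b\<^sub>k\<^esup>\<close>, and \<open>\<oplus>\<close> is ordinal addition.\<close>

definition osum :: "'a::linorder multiset \<Rightarrow> 'a multiset \<Rightarrow> 'a multiset" (infixl "\<oplus>" 65) where
  "l \<oplus> d = filter_mset (\<lambda>a. \<forall>b\<in>#d. b \<le> a) l + d"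

lemma count_osum: "count (l \<oplus> d) x = (if \<forall>b\<in>#d. b \<le> x then count l x else 0) + count d x"
  by (simp add: osum_def)

lemma osum_empty [simp]: "l \<oplus> {#} = l" "{#} \<oplus> d = d"
  by (auto simp: osum_def)

lemma osum_ball_iff:
  assumes "\<And>a b. P b \<Longrightarrow> a \<le> b \<Longrightarrow> P a"
  shows "(\<forall>x\<in>#d \<oplus> e. P x) \<longleftrightarrow> (\<forall>x\<in>#d. P x) \<and> (\<forall>x\<in>#e. P x)"
proof -
  have "P x" if "\<forall>x\<in>#d \<oplus> e. P x" "x \<in># d" for x
  proof (cases "\<forall>c\<in>#e. c \<le> x")
    case True
    with that show ?thesis by (simp add: osum_def)
  next
    case False
    then obtain c where "c \<in># e" "x \<le> c" by (meson linear)
    with that(1) show ?thesis by (simp add: osum_def assms[of c])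
  qed
  then show ?thesis by (auto simp: osum_def)
qed

lemma osum_assoc: "(l \<oplus> d) \<oplus> e = l \<oplus> (d \<oplus> e)"
  by (rule multiset_eqI) (simp add: count_osum osum_ball_iff)

lemma osum_strict_mono:
  assumes "d < e"
  shows "l \<oplus> d < l \<oplus> e"
proof -
  obtain a where a: "count d a < count e a" "\<And>x. x > a \<Longrightarrow> count d x = count e x"
    using assms less_multiset_iff_greatest_difference by blast
  have same_above: "x \<in># d \<longleftrightarrow> x \<in># e" if "x > a" for x
    using a(2)[OF that] by (metis count_eq_zero_iff)
  have "(\<forall>b\<in>#d. b \<le> x) \<longleftrightarrow> (\<forall>b\<in>#e. b \<le> x)" if "x \<ge> a" for x
    using same_above that by (meson leD leI order.strict_trans1)
  with a show ?thesis
    unfolding less_multiset_iff_greatest_difference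
    by (intro exI[of _ a]) (auto simp: count_osum)
qed

lemma osum_less_iff [simp]: "l \<oplus> d < l \<oplus> e \<longleftrightarrow> d < e"
  by (metis osum_strict_mono less_irrefl less_asym linorder_neqE)

lemma osum_le_iff [simp]: "l \<oplus> d \<le> l \<oplus> e \<longleftrightarrow> d \<le> e"
  by (simp add: linorder_not_less[symmetric])

lemma osum_left_cancel [simp]: "l \<oplus> d = l \<oplus> e \<longleftrightarrow> d = e"
  by (metis osum_strict_mono less_irrefl linorder_neqE)

lemma le_osum [simp]: "l \<le> l \<oplus> (d :: 'a::linorder multiset)"
  using osum_le_iff[of l "{#}" d] by simp

lemma less_osum_iff [simp]: "l < l \<oplus> (d :: 'a::linorder multiset) \<longleftrightarrow> d \<noteq> {#}"
  by (metis le_osum order_less_le osum_empty(1) osum_left_cancel)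

lemma le_imp_osum:
  assumes "l \<le> (z :: 'a::linorder multiset)"
  obtains w where "z = l \<oplus> w"
proof (cases "l = z")
  case True
  then show ?thesis using that[of "{#}"] by simp
next
  case False
  then obtain a where a: "count l a < count z a" "\<And>x. x > a \<Longrightarrow> count l x = count z x"
    using assms less_multiset_iff_greatest_difference[of l z] by force
  let ?w = "filter_mset (\<lambda>x. x < a) z + replicate_mset (count z a - count l a) a"
  have bound: "(\<forall>b\<in>#?w. b \<le> x) \<longleftrightarrow> a \<le> x" for x
    using a(1) by (auto simp: in_replicate_mset dest: less_imp_le)
  have "z = l \<oplus> ?w"
  proof (rule multiset_eqI)
    fix x
    show "count z x = count (l \<oplus> ?w) x"
      unfolding count_osum bound using a by (cases x a rule: linorder_cases) auto
  qed
  then show ?thesis by (rule that)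
qed

lemma singleton_osum: "(\<And>b. b \<in># w \<Longrightarrow> b \<le> c) \<Longrightarrow> {#c#} \<oplus> w = add_mset c w"
  by (auto simp: osum_def)

lemma osum_less_singleton_iff [simp]: "d \<oplus> e < {#c#} \<longleftrightarrow> d < {#c#} \<and> e < {#c#}"
  unfolding mset_lt_single_right_iff by (rule osum_ball_iff) simp

text \<open>Ordinals related by \<open>tail_equiv \<delta>\<close> agree modulo \<open>\<omega>\<^bsup>\<delta>\<^esup>\<close> and are either both below \<open>\<omega>\<^bsup>\<delta>\<^esup>\<close> or both not.\<close>

definition tail_equiv :: "'a::linorder \<Rightarrow> 'a multiset \<Rightarrow> 'a multiset \<Rightarrow> bool" where
  "tail_equiv \<delta> d d' \<longleftrightarrow> (\<forall>x<\<delta>. count d x = count d' x) \<and> (d < {#\<delta>#} \<longleftrightarrow> d' < {#\<delta>#})"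

lemma tail_equiv_refl [simp]: "tail_equiv \<delta> d d"
  by (simp add: tail_equiv_def)

lemma tail_equiv_sym: "tail_equiv \<delta> d d' \<Longrightarrow> tail_equiv \<delta> d' d"
  by (simp add: tail_equiv_def)

lemma tail_equiv_trans: "tail_equiv \<delta> c d \<Longrightarrow> tail_equiv \<delta> d e \<Longrightarrow> tail_equiv \<delta> c e"
  by (simp add: tail_equiv_def)

lemma tail_equiv_small_eq:
  assumes "tail_equiv \<delta> d d'" "d < {#\<delta>#}"
  shows "d' = d"
proof (rule multiset_eqI)
  fix x
  show "count d' x = count d x"
  proof (cases "x < \<delta>")
    case True
    with assms(1) show ?thesis by (simp add: tail_equiv_def)
  next
    case False
    moreover have "d' < {#\<delta>#}" using assms by (simp add: tail_equiv_def)
    ultimately have "x \<notin># d" "x \<notin># d'"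
      using assms(2) by (auto simp: mset_lt_single_right_iff)
    then show ?thesis by (simp add: not_in_iff)
  qed
qed

lemma tail_equiv_mono:
  assumes "tail_equiv \<delta> d d'" "\<delta>' \<le> \<delta>"
  shows "tail_equiv \<delta>' d d'"
proof -
  have "d' < {#\<delta>'#}" if "tail_equiv \<delta> d d'" "d < {#\<delta>'#}" for d d'
    using tail_equiv_small_eq[OF that(1)] that(2) assms(2) by (auto intro: order.strict_trans2)
  then have "d < {#\<delta>'#} \<longleftrightarrow> d' < {#\<delta>'#}"
    using assms(1) tail_equiv_sym by blast
  then show ?thesis
    using assms by (auto simp: tail_equiv_def)
qed

lemma tail_equiv_empty_iff:
  assumes "tail_equiv \<delta> d d'"
  shows "d = {#} \<longleftrightarrow> d' = {#}"
proof -
  have "d' = {#}" if "tail_equiv \<delta> d d'" "d = {#}" for d d'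
    using tail_equiv_small_eq[OF that(1)] that(2) by simp
  then show ?thesis using assms tail_equiv_sym by blast
qed

lemma tail_equiv_singleton: "c = c' \<or> \<delta> \<le> c \<and> \<delta> \<le> c' \<Longrightarrow> tail_equiv \<delta> {#c#} {#c'#}"
  by (auto simp: tail_equiv_def)

lemma tail_equiv_osum_large:
  assumes "\<not> e < {#\<delta>#}"
  shows "tail_equiv \<delta> (d \<oplus> e) e"
proof -
  obtain b where "b \<in># e" "\<delta> \<le> b" using assms by (auto simp: mset_lt_single_right_iff not_less)
  then have "\<not> (\<forall>b\<in>#e. b \<le> x)" if "x < \<delta>" for x
    using that by (meson leD order.strict_trans2)
  with assms show ?thesis
    by (auto simp: tail_equiv_def count_osum)
qed

lemma tail_equiv_osum:
  assumes d: "tail_equiv \<delta> d d'" and e: "tail_equiv \<delta> e e'"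
  shows "tail_equiv \<delta> (d \<oplus> e) (d' \<oplus> e')"
proof (cases "e < {#\<delta>#}")
  case True
  then show ?thesis
    using d tail_equiv_small_eq[OF e] by (simp add: tail_equiv_def count_osum)
next
  case False
  moreover from this e have "\<not> e' < {#\<delta>#}" by (simp add: tail_equiv_def)
  ultimately show ?thesis
    by (meson e tail_equiv_osum_large tail_equiv_sym tail_equiv_trans)
qed

lemma osum_absorb:
  assumes "d < {#\<delta>#}" "\<not> e < {#\<delta>#}"
  shows "d \<oplus> e = e"
proof -
  obtain b where "b \<in># e" "\<delta> \<le> b" using assms(2) by (auto simp: mset_lt_single_right_iff not_less)
  then have "\<not> (\<forall>b\<in>#e. b \<le> a)" if "a \<in># d" for a
    using assms(1) that by (metis leD mset_lt_single_right_iff order.strict_trans2)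
  then show ?thesis
    by (auto simp: osum_def filter_mset_eq_conv)
qed

lemma ex_tail_equiv_less_singleton:
  assumes "\<delta>' < \<delta>"
  obtains e' where "tail_equiv \<delta>' e e'" "e' < {#\<delta>#}"
proof
  let ?e = "filter_mset (\<lambda>x. x < \<delta>') e + (if e < {#\<delta>'#} then {#} else {#\<delta>'#})"
  show "tail_equiv \<delta>' e ?e" by (auto simp: tail_equiv_def mset_lt_single_right_iff)
  show "?e < {#\<delta>#}" using assms by (auto simp: mset_lt_single_right_iff)
qed

lemma tail_equiv_osum_small_split:
  assumes equiv: "tail_equiv \<delta> (e \<oplus> r) d" and r: "r < {#\<delta>#}"
  obtains e' where "d = e' \<oplus> r" "tail_equiv \<delta> e e'"
proof
  let ?e = "filter_mset (\<lambda>x. \<delta> \<le> x) d + filter_mset (\<lambda>x. x < \<delta>) e"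
  show "d = ?e \<oplus> r"
  proof (rule multiset_eqI)
    fix x
    show "count d x = count (?e \<oplus> r) x"
    proof (cases "x < \<delta>")
      case True
      with equiv have "count (e \<oplus> r) x = count d x" by (simp add: tail_equiv_def)
      moreover have "\<not> \<delta> \<le> x" using True by simp
      ultimately show ?thesis using True by (auto simp: count_osum split: if_splits)
    next
      case False
      then have "\<forall>b\<in>#r. b \<le> x" "x \<notin># r"
        using r by (auto simp: mset_lt_single_right_iff not_less dest: less_imp_le order.strict_trans2)
      moreover have "\<delta> \<le> x" using False by simp
      ultimately show ?thesis using False by (simp add: count_osum not_in_iff)
    qed
  qed
  have "?e < {#\<delta>#} \<longleftrightarrow> d < {#\<delta>#}"
    unfolding mset_lt_single_right_iff by (simp add: Ball_def) (meson leD leI)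
  also have "\<dots> \<longleftrightarrow> e < {#\<delta>#}"
    using equiv r by (simp add: tail_equiv_def)
  finally show "tail_equiv \<delta> e ?e"
    by (simp add: tail_equiv_def leD)
qed

lemma tail_equiv_osum_split:
  assumes equiv: "tail_equiv \<delta> (e \<oplus> r) d" and less: "\<delta>' < \<delta>"
  obtains e' r' where "d = e' \<oplus> r'" "tail_equiv \<delta>' e e'" "tail_equiv \<delta> r r'"
proof (cases "r < {#\<delta>#}")
  case True
  then obtain e' where "d = e' \<oplus> r" "tail_equiv \<delta> e e'"
    by (rule tail_equiv_osum_small_split[OF equiv])
  with less show ?thesis using that tail_equiv_mono less_imp_le by (metis tail_equiv_refl)
next
  case False
  then have r: "tail_equiv \<delta> r d"
    using equiv tail_equiv_osum_large tail_equiv_sym tail_equiv_trans by blast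
  obtain e' where e': "tail_equiv \<delta>' e e'" "e' < {#\<delta>#}"
    by (rule ex_tail_equiv_less_singleton[OF less])
  have "\<not> d < {#\<delta>#}" using False r by (simp add: tail_equiv_def)
  with e'(2) have "d = e' \<oplus> d" by (rule osum_absorb[symmetric])
  then show ?thesis using e'(1) r by (rule that)
qed


section \<open>Isomorphisms of linear orders\<close>

definition rel_iso :: "('a \<Rightarrow> 'b) \<Rightarrow> 'a set \<Rightarrow> 'a rel \<Rightarrow> 'b set \<Rightarrow> 'b rel \<Rightarrow> bool" where
  "rel_iso f A R B S \<longleftrightarrow> bij_betw f A B \<and> (\<forall>x\<in>A. \<forall>y\<in>A. (x, y) \<in> R \<longleftrightarrow> (f x, f y) \<in> S)"

lemma isomorphic_iff_rel_iso: "isomorphic A R B S \<longleftrightarrow> (\<exists>f. rel_iso f A R B S)"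
  by (simp add: isomorphic_def rel_iso_def)

lemma rel_isoI:
  "bij_betw f A B \<Longrightarrow> (\<And>x y. x \<in> A \<Longrightarrow> y \<in> A \<Longrightarrow> (x, y) \<in> R \<longleftrightarrow> (f x, f y) \<in> S) \<Longrightarrow> rel_iso f A R B S"
  by (simp add: rel_iso_def)

lemma rel_iso_image: "rel_iso f A R B S \<Longrightarrow> f ` A = B"
  by (simp add: rel_iso_def bij_betw_def)

lemma rel_iso_mem: "rel_iso f A R B S \<Longrightarrow> x \<in> A \<Longrightarrow> f x \<in> B"
  using rel_iso_image by blast

lemma rel_iso_preimage: "rel_iso f A R B S \<Longrightarrow> y \<in> B \<Longrightarrow> \<exists>x\<in>A. f x = y"
  using rel_iso_image by blast

lemma rel_iso_le_iff: "rel_iso f A R B S \<Longrightarrow> x \<in> A \<Longrightarrow> y \<in> A \<Longrightarrow> (f x, f y) \<in> S \<longleftrightarrow> (x, y) \<in> R"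
  by (simp add: rel_iso_def)

lemma rel_iso_eq_iff: "rel_iso f A R B S \<Longrightarrow> x \<in> A \<Longrightarrow> y \<in> A \<Longrightarrow> f x = f y \<longleftrightarrow> x = y"
  by (auto simp: rel_iso_def bij_betw_def inj_on_def)

lemma rel_iso_id: "rel_iso id A R A R"
  by (rule rel_isoI) auto

lemma rel_iso_cong: "rel_iso f A R B S \<Longrightarrow> (\<And>x. x \<in> A \<Longrightarrow> f x = g x) \<Longrightarrow> rel_iso g A R B S"
  using bij_betw_cong[of A f g B] by (simp add: rel_iso_def)

lemma rel_iso_Collect:
  assumes f: "rel_iso f A R B S" and "\<And>x. x \<in> A \<Longrightarrow> P x \<longleftrightarrow> Q (f x)"
  shows "rel_iso f {x \<in> A. P x} R {y \<in> B. Q y} S"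
proof (rule rel_isoI)
  have "f ` {x \<in> A. P x} = {y \<in> B. Q y}" using rel_iso_image[OF f] assms(2) by auto
  moreover have "inj_on f {x \<in> A. P x}" using rel_iso_eq_iff[OF f] by (simp add: inj_on_def)
  ultimately show "bij_betw f {x \<in> A. P x} {y \<in> B. Q y}" by (simp add: bij_betw_def)
qed (simp add: rel_iso_le_iff[OF f])

lemma rel_iso_inv_into:
  assumes "rel_iso f A R B S"
  shows "rel_iso (inv_into A f) B S A R"
proof (rule rel_isoI)
  show "bij_betw (inv_into A f) B A"
    using assms by (simp add: rel_iso_def bij_betw_inv_into)
  fix x y assume "x \<in> B" "y \<in> B"
  then show "(x, y) \<in> S \<longleftrightarrow> (inv_into A f x, inv_into A f y) \<in> R"
    using rel_iso_image[OF assms] rel_iso_le_iff[OF assms, of "inv_into A f x" "inv_into A f y"]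
    by (auto simp: inv_into_into f_inv_into_f)
qed

lemma rel_iso_comp:
  assumes f: "rel_iso f A R B S" and g: "rel_iso g B S C T"
  shows "rel_iso (g \<circ> f) A R C T"
  using f g bij_betw_trans[of f A B g C] rel_iso_mem[OF f] by (auto simp: rel_iso_def)

lemma isomorphicI: "rel_iso f A R B S \<Longrightarrow> isomorphic A R B S"
  using isomorphic_iff_rel_iso by blast

lemma isomorphic_refl [simp]: "isomorphic A R A R"
  using rel_iso_id by (rule isomorphicI)

lemma isomorphic_sym: "isomorphic A R B S \<Longrightarrow> isomorphic B S A R"
  unfolding isomorphic_iff_rel_iso using rel_iso_inv_into by blast

lemma isomorphic_trans: "isomorphic A R B S \<Longrightarrow> isomorphic B S C T \<Longrightarrow> isomorphic A R C T"
  unfolding isomorphic_iff_rel_iso using rel_iso_comp by blast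

lemma isomorphic_nonempty: "isomorphic A R B S \<Longrightarrow> A \<noteq> {} \<Longrightarrow> B \<noteq> {}"
  unfolding isomorphic_iff_rel_iso using rel_iso_image by blast

lemma rel_iso_glue:
  assumes "\<kappa> ` A \<subseteq> K" "\<kappa>' ` B \<subseteq> K"
    and fibre: "\<And>k. k \<in> K \<Longrightarrow> rel_iso (g k) {x \<in> A. \<kappa> x = k} R {y \<in> B. \<kappa>' y = k} S"
    and across: "\<And>x y x' y'. x \<in> A \<Longrightarrow> y \<in> A \<Longrightarrow> x' \<in> B \<Longrightarrow> y' \<in> B \<Longrightarrow> \<kappa>' x' = \<kappa> x \<Longrightarrow>
       \<kappa>' y' = \<kappa> y \<Longrightarrow> \<kappa> x \<noteq> \<kappa> y \<Longrightarrow> (x, y) \<in> R \<longleftrightarrow> (x', y') \<in> S"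
  shows "rel_iso (\<lambda>x. g (\<kappa> x) x) A R B S"
proof (rule rel_isoI)
  let ?h = "\<lambda>x. g (\<kappa> x) x"
  have fibre_h: "rel_iso ?h {x \<in> A. \<kappa> x = k} R {y \<in> B. \<kappa>' y = k} S" if "k \<in> K" for k
    by (rule rel_iso_cong[OF fibre[OF that]]) auto
  have "bij_betw ?h (\<Union>k\<in>K. {x \<in> A. \<kappa> x = k}) (\<Union>k\<in>K. {y \<in> B. \<kappa>' y = k})"
  proof (rule bij_betw_UNION_disjoint)
    show "disjoint_family_on (\<lambda>k. {y \<in> B. \<kappa>' y = k}) K"
      by (auto simp: disjoint_family_on_def)
    show "bij_betw ?h {x \<in> A. \<kappa> x = k} {y \<in> B. \<kappa>' y = k}" if "k \<in> K" for k
      using fibre_h[OF that] by (simp add: rel_iso_def)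
  qed
  moreover have "(\<Union>k\<in>K. {x \<in> A. \<kappa> x = k}) = A" "(\<Union>k\<in>K. {y \<in> B. \<kappa>' y = k}) = B"
    using assms(1,2) by auto
  ultimately show "bij_betw ?h A B" by simp
  fix x y assume xy: "x \<in> A" "y \<in> A"
  have h: "?h x \<in> B \<and> \<kappa>' (?h x) = \<kappa> x" if "x \<in> A" for x
    using rel_iso_mem[OF fibre_h, of "\<kappa> x" x] assms(1) that by auto
  show "(x, y) \<in> R \<longleftrightarrow> (?h x, ?h y) \<in> S"
  proof (cases "\<kappa> x = \<kappa> y")
    case True
    then show ?thesis
      using rel_iso_le_iff[OF fibre_h, of "\<kappa> x" x y] assms(1) xy by auto
  next
    case False
    then show ?thesis using across h xy by blast
  qed
qed

lemma isomorphic_glue: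
  assumes "\<kappa> ` A \<subseteq> K" "\<kappa>' ` B \<subseteq> K"
    and fibre: "\<And>k. k \<in> K \<Longrightarrow> isomorphic {x \<in> A. \<kappa> x = k} R {y \<in> B. \<kappa>' y = k} S"
    and across: "\<And>x y x' y'. x \<in> A \<Longrightarrow> y \<in> A \<Longrightarrow> x' \<in> B \<Longrightarrow> y' \<in> B \<Longrightarrow> \<kappa>' x' = \<kappa> x \<Longrightarrow>
       \<kappa>' y' = \<kappa> y \<Longrightarrow> \<kappa> x \<noteq> \<kappa> y \<Longrightarrow> (x, y) \<in> R \<longleftrightarrow> (x', y') \<in> S"
  shows "isomorphic A R B S"
proof -
  have "\<forall>k\<in>K. \<exists>g. rel_iso g {x \<in> A. \<kappa> x = k} R {y \<in> B. \<kappa>' y = k} S"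
    using fibre unfolding isomorphic_iff_rel_iso by blast
  from bchoice[OF this] obtain g
    where "\<And>k. k \<in> K \<Longrightarrow> rel_iso (g k) {x \<in> A. \<kappa> x = k} R {y \<in> B. \<kappa>' y = k} S" by blast
  from rel_iso_glue[OF assms(1,2) this across] show ?thesis by (rule isomorphicI)
qed

abbreviation less_in :: "'a rel \<Rightarrow> 'a \<Rightarrow> 'a \<Rightarrow> bool" where
  "less_in S x y \<equiv> (x, y) \<in> S \<and> x \<noteq> y"

locale linearly_ordered =
  fixes B :: "'a set" and S :: "'a rel"
  assumes linear_order: "linear_order_on B (Restr S B)"
begin

lemma rel_refl: "x \<in> B \<Longrightarrow> (x, x) \<in> S"
  using linear_order by (auto simp: order_on_defs refl_on_def)

lemma rel_antisym: "(x, y) \<in> S \<Longrightarrow> (y, x) \<in> S \<Longrightarrow> x \<in> B \<Longrightarrow> y \<in> B \<Longrightarrow> x = y"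
  using linear_order by (auto simp: order_on_defs antisym_def)

lemma rel_trans: "(x, y) \<in> S \<Longrightarrow> (y, z) \<in> S \<Longrightarrow> x \<in> B \<Longrightarrow> y \<in> B \<Longrightarrow> z \<in> B \<Longrightarrow> (x, z) \<in> S"
  using linear_order unfolding order_on_defs trans_def by blast

lemma rel_total: "x \<in> B \<Longrightarrow> y \<in> B \<Longrightarrow> (x, y) \<in> S \<or> (y, x) \<in> S"
  using linear_order rel_refl by (cases "x = y") (auto simp: order_on_defs total_on_def)

lemma less_le_trans: "less_in S x y \<Longrightarrow> (y, z) \<in> S \<Longrightarrow> x \<in> B \<Longrightarrow> y \<in> B \<Longrightarrow> z \<in> B \<Longrightarrow> less_in S x z"
  using rel_trans rel_antisym by metis

lemma le_less_trans: "(x, y) \<in> S \<Longrightarrow> less_in S y z \<Longrightarrow> x \<in> B \<Longrightarrow> y \<in> B \<Longrightarrow> z \<in> B \<Longrightarrow> less_in S x z"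
  using rel_trans rel_antisym by metis

lemma not_less: "x \<in> B \<Longrightarrow> y \<in> B \<Longrightarrow> \<not> less_in S x y \<longleftrightarrow> (y, x) \<in> S"
  using rel_refl rel_antisym rel_total by blast

lemma less_cases:
  assumes "x \<in> B" "y \<in> B"
  obtains (less) "less_in S x y" | (equal) "x = y" | (greater) "less_in S y x"
  using rel_total assms by blast

lemma converse: "linearly_ordered B (S\<inverse>)"
proof
  have "Restr (S\<inverse>) B = (Restr S B)\<inverse>" by blast
  then show "linear_order_on B (Restr (S\<inverse>) B)" using linear_order by simp
qed

lemma finite_has_greatest:
  assumes "finite X" "X \<subseteq> B" "X \<noteq> {}"
  shows "\<exists>m\<in>X. \<forall>x\<in>X. (x, m) \<in> S"
  using assms(1,3,2)
proof (induction X rule: finite_ne_induct)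
  case (singleton x)
  then show ?case using rel_refl by auto
next
  case (insert x X)
  then obtain m where m: "m \<in> X" "\<forall>x\<in>X. (x, m) \<in> S" by auto
  have B: "m \<in> B" "x \<in> B" "X \<subseteq> B" using insert m by auto
  from B(1,2) consider (below) "(x, m) \<in> S" | (above) "(m, x) \<in> S" using rel_total by blast
  then show ?case
  proof cases
    case below
    with m show ?thesis by auto
  next
    case above
    with m B have "\<forall>y\<in>X. (y, x) \<in> S" using rel_trans by blast
    with B(2) show ?thesis using rel_refl by auto
  qed
qed

lemma finite_has_least:
  assumes "finite X" "X \<subseteq> B" "X \<noteq> {}"
  shows "\<exists>m\<in>X. \<forall>x\<in>X. (m, x) \<in> S"
  using linearly_ordered.finite_has_greatest[OF converse assms] by simp

end

lemma linearly_ordered_iff: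
  "linearly_ordered B S \<longleftrightarrow> (\<forall>x\<in>B. \<forall>y\<in>B. \<forall>z\<in>B. (x, x) \<in> S \<and> ((x, y) \<in> S \<and> (y, x) \<in> S \<longrightarrow> x = y) \<and>
     ((x, y) \<in> S \<and> (y, z) \<in> S \<longrightarrow> (x, z) \<in> S) \<and> ((x, y) \<in> S \<or> (y, x) \<in> S))"
  (is "_ \<longleftrightarrow> ?axioms")
proof
  assume "linearly_ordered B S"
  then interpret linearly_ordered B S .
  show ?axioms using rel_refl rel_antisym rel_trans rel_total by blast
next
  assume ?axioms
  then show "linearly_ordered B S"
    unfolding linearly_ordered_def order_on_defs refl_on_def trans_def antisym_def total_on_def by blast
qed

lemma linearly_ordered_subset: "linearly_ordered B S \<Longrightarrow> A \<subseteq> B \<Longrightarrow> linearly_ordered A S"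
  unfolding linearly_ordered_iff by blast

lemma linear_order_on_imp_linearly_ordered: "linear_order_on B S \<Longrightarrow> linearly_ordered B S"
  by (simp add: linearly_ordered_def order_on_defs inf.absorb1)

lemma (in linearly_ordered) strict_mono_rel_iso:
  fixes f :: "'a \<Rightarrow> 'b"
  assumes "linearly_ordered C T" "f ` B = C"
    and mono: "\<And>x y. x \<in> B \<Longrightarrow> y \<in> B \<Longrightarrow> less_in S x y \<Longrightarrow> less_in T (f x) (f y)"
  shows "rel_iso f B S C T"
proof (rule rel_isoI)
  interpret C: linearly_ordered C T by fact
  have f_mem: "f x \<in> C" if "x \<in> B" for x using that assms(2) by blast
  have inj: "x = y" if "x \<in> B" "y \<in> B" "f x = f y" for x y
    using that mono by (metis less_cases)
  then show "bij_betw f B C" using assms(2) by (simp add: bij_betw_def inj_on_def)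
  fix x y assume xy: "x \<in> B" "y \<in> B"
  then show "(x, y) \<in> S \<longleftrightarrow> (f x, f y) \<in> T"
    using mono[OF xy] mono[OF xy(2,1)] inj f_mem C.rel_refl C.rel_antisym rel_refl rel_total by metis
qed


section \<open>Labelled dense orders\<close>

lemma bij_betw_of_relation:
  assumes "r \<subseteq> A \<times> B" "A \<subseteq> Domain r" "B \<subseteq> Range r"
    and bij: "\<And>a b a' b'. (a, b) \<in> r \<Longrightarrow> (a', b') \<in> r \<Longrightarrow> a = a' \<longleftrightarrow> b = b'"
  obtains f where "bij_betw f A B" "\<And>a. a \<in> A \<Longrightarrow> (a, f a) \<in> r"
proof -
  have "\<forall>a\<in>A. \<exists>b. (a, b) \<in> r" using assms(2) by blast
  from bchoice[OF this] obtain f where f: "\<forall>a\<in>A. (a, f a) \<in> r" ..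
  have "bij_betw f A B"
    unfolding bij_betw_def
  proof
    show "inj_on f A" using bij f by (intro inj_onI) blast
    have "b \<in> f ` A" if b: "b \<in> B" for b
    proof -
      obtain a where a: "(a, b) \<in> r" using b assms(3) by blast
      then have "a \<in> A" using assms(1) by blast
      moreover have "f a = b" using bij[OF a, of a "f a"] f \<open>a \<in> A\<close> by blast
      ultimately show ?thesis by blast
    qed
    then show "f ` A = B" using f assms(1) by blast
  qed
  then show ?thesis using that f by blast
qed

lemma back_and_forth_chain:
  fixes P :: "('a \<times> 'b) set \<Rightarrow> bool"
  assumes "countable A" "countable B" "P {}"
    and forth: "\<And>p a. P p \<Longrightarrow> a \<in> A \<Longrightarrow> \<exists>b. P (insert (a, b) p)"
    and backward: "\<And>p b. P p \<Longrightarrow> b \<in> B \<Longrightarrow> \<exists>a. P (insert (a, b) p)"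
  obtains q :: "nat \<Rightarrow> ('a \<times> 'b) set" where "\<And>n. P (q n)" "mono q" "A \<subseteq> Domain (\<Union>(range q))" "B \<subseteq> Range (\<Union>(range q))"
proof -
  let ?a = "from_nat_into A" and ?b = "from_nat_into B"
  have "\<exists>p'. P p' \<and> p \<subseteq> p' \<and> (?a n \<in> A \<longrightarrow> ?a n \<in> Domain p') \<and> (?b n \<in> B \<longrightarrow> ?b n \<in> Range p')"
    if p: "P p" for p n
  proof -
    have "\<exists>p'. P p' \<and> p \<subseteq> p' \<and> (?a n \<in> A \<longrightarrow> ?a n \<in> Domain p')"
      using p forth[OF p, of "?a n"] by (cases "?a n \<in> A") blast+
    then obtain p' where p': "P p'" "p \<subseteq> p'" "?a n \<in> A \<longrightarrow> ?a n \<in> Domain p'" by blast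
    have "\<exists>p''. P p'' \<and> p' \<subseteq> p'' \<and> (?b n \<in> B \<longrightarrow> ?b n \<in> Range p'')"
      using p' backward[OF p'(1), of "?b n"] by (cases "?b n \<in> B") blast+
    with p' show ?thesis by blast
  qed
  then have "\<exists>q. \<forall>n. P (q n) \<and> (q n \<subseteq> q (Suc n) \<and> (?a n \<in> A \<longrightarrow> ?a n \<in> Domain (q (Suc n))) \<and>
      (?b n \<in> B \<longrightarrow> ?b n \<in> Range (q (Suc n))))"
    using assms(3) by (intro dependent_nat_choice) blast+
  then obtain q where q: "\<And>n. P (q n)" "\<And>n. q n \<subseteq> q (Suc n)"
    "\<And>n. ?a n \<in> A \<Longrightarrow> ?a n \<in> Domain (q (Suc n))" "\<And>n. ?b n \<in> B \<Longrightarrow> ?b n \<in> Range (q (Suc n))"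
    by blast
  have "mono q" by (simp add: mono_iff_le_Suc q(2))
  moreover have "a \<in> Domain (\<Union>(range q))" if "a \<in> A" for a
    using q(3)[of "to_nat_on A a"] that assms(1) by auto
  moreover have "b \<in> Range (\<Union>(range q))" if "b \<in> B" for b
    using q(4)[of "to_nat_on B b"] that assms(2) by auto
  ultimately show ?thesis by (intro that[OF q(1)]) auto
qed

lemma back_and_forth_bij:
  fixes P :: "('a \<times> 'b) set \<Rightarrow> bool"
  assumes "countable A" "countable B" "P {}"
    and forth: "\<And>p a. P p \<Longrightarrow> a \<in> A \<Longrightarrow> \<exists>b. P (insert (a, b) p)"
    and backward: "\<And>p b. P p \<Longrightarrow> b \<in> B \<Longrightarrow> \<exists>a. P (insert (a, b) p)"
    and sub: "\<And>p. P p \<Longrightarrow> p \<subseteq> A \<times> B"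
    and bij: "\<And>p a b a' b'. P p \<Longrightarrow> (a, b) \<in> p \<Longrightarrow> (a', b') \<in> p \<Longrightarrow> a = a' \<longleftrightarrow> b = b'"
  obtains f where "bij_betw f A B"
    and "\<And>a a'. a \<in> A \<Longrightarrow> a' \<in> A \<Longrightarrow> \<exists>p. P p \<and> (a, f a) \<in> p \<and> (a', f a') \<in> p"
proof -
  obtain q :: "nat \<Rightarrow> ('a \<times> 'b) set" where q: "\<And>n. P (q n)" "mono q"
    "A \<subseteq> Domain (\<Union>(range q))" "B \<subseteq> Range (\<Union>(range q))"
    by (rule back_and_forth_chain[where P = P, OF assms(1-3)]) (erule (1) forth, erule (1) backward, rule that)
  have directed: "\<exists>p. P p \<and> x \<in> p \<and> y \<in> p" if xy: "x \<in> \<Union>(range q)" "y \<in> \<Union>(range q)" for x y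
  proof -
    obtain m n where "x \<in> q m" "y \<in> q n" using xy by blast
    then have "x \<in> q (max m n)" "y \<in> q (max m n)"
      using monoD[OF q(2), of m "max m n"] monoD[OF q(2), of n "max m n"] by auto
    with q(1) show ?thesis by blast
  qed
  have union_sub: "\<Union>(range q) \<subseteq> A \<times> B" using q(1) sub by blast
  have union_bij: "a = a' \<longleftrightarrow> b = b'" if "(a, b) \<in> \<Union>(range q)" "(a', b') \<in> \<Union>(range q)" for a b a' b'
    using directed[OF that] bij by blast
  obtain f where f: "bij_betw f A B" "\<And>a. a \<in> A \<Longrightarrow> (a, f a) \<in> \<Union>(range q)"
    by (rule bij_betw_of_relation[OF union_sub q(3,4)]) (erule (1) union_bij, rule that)
  show ?thesis by (rule that[OF f(1)]) (intro directed f(2))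
qed

definition dense_unbounded :: "('a \<Rightarrow> bool) \<Rightarrow> 'a set \<Rightarrow> 'a rel \<Rightarrow> bool" where
  "dense_unbounded Q A R \<longleftrightarrow> (\<exists>z\<in>A. Q z) \<and>
     (\<forall>x\<in>A. (\<exists>z\<in>A. Q z \<and> less_in R z x) \<and> (\<exists>z\<in>A. Q z \<and> less_in R x z)) \<and>
     (\<forall>x\<in>A. \<forall>y\<in>A. less_in R x y \<longrightarrow> (\<exists>z\<in>A. Q z \<and> less_in R x z \<and> less_in R z y))"

lemma dense_unboundedI:
  assumes "\<exists>z\<in>A. Q z"
    and "\<And>x. x \<in> A \<Longrightarrow> \<exists>z\<in>A. Q z \<and> less_in R z x"
    and "\<And>x. x \<in> A \<Longrightarrow> \<exists>z\<in>A. Q z \<and> less_in R x z"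
    and "\<And>x y. x \<in> A \<Longrightarrow> y \<in> A \<Longrightarrow> less_in R x y \<Longrightarrow> \<exists>z\<in>A. Q z \<and> less_in R x z \<and> less_in R z y"
  shows "dense_unbounded Q A R"
  unfolding dense_unbounded_def using assms by (intro conjI ballI impI)

lemma dense_unboundedD:
  assumes "dense_unbounded Q A R"
  shows "\<exists>z\<in>A. Q z"
    and "x \<in> A \<Longrightarrow> \<exists>z\<in>A. Q z \<and> less_in R z x"
    and "x \<in> A \<Longrightarrow> \<exists>z\<in>A. Q z \<and> less_in R x z"
    and "x \<in> A \<Longrightarrow> y \<in> A \<Longrightarrow> less_in R x y \<Longrightarrow> \<exists>z\<in>A. Q z \<and> less_in R x z \<and> less_in R z y"
  using assms unfolding dense_unbounded_def by blast+

lemma dense_unbounded_image: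
  assumes dense: "dense_unbounded P A R" and Q: "\<And>x. x \<in> A \<Longrightarrow> P x \<Longrightarrow> Q (h x)"
    and less: "\<And>x y. x \<in> A \<Longrightarrow> y \<in> A \<Longrightarrow> less_in S (h x) (h y) \<longleftrightarrow> less_in R x y"
  shows "dense_unbounded Q (h ` A) S"
proof (rule dense_unboundedI)
  show "\<exists>z\<in>h ` A. Q z" using dense_unboundedD(1)[OF dense] Q by blast
  fix u assume "u \<in> h ` A"
  then obtain x where x: "u = h x" "x \<in> A" by blast
  show "\<exists>z\<in>h ` A. Q z \<and> less_in S z u"
    using dense_unboundedD(2)[OF dense x(2)] Q less[OF _ x(2)] x(1) by blast
  show "\<exists>z\<in>h ` A. Q z \<and> less_in S u z"
    using dense_unboundedD(3)[OF dense x(2)] Q less[OF x(2)] x(1) by blast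
  fix v assume "v \<in> h ` A" "less_in S u v"
  then obtain y where y: "v = h y" "y \<in> A" "less_in R x y" using less[OF x(2)] x(1) by blast
  show "\<exists>z\<in>h ` A. Q z \<and> less_in S u z \<and> less_in S z v"
    using dense_unboundedD(4)[OF dense x(2) y(2,3)] Q less[OF x(2)] less[OF _ y(2)] x(1) y(1) by blast
qed

lemma dense_unbounded_mono:
  "dense_unbounded P A R \<Longrightarrow> (\<And>z. z \<in> A \<Longrightarrow> P z \<Longrightarrow> Q z) \<Longrightarrow> dense_unbounded Q A R"
  using dense_unbounded_image[of P A R Q id R] by simp

lemma (in linearly_ordered) dense_unbounded_between_finite:
  assumes dense: "dense_unbounded Q B S"
    and X: "finite X" "X \<subseteq> B" and Y: "finite Y" "Y \<subseteq> B" and XY: "\<And>x y. x \<in> X \<Longrightarrow> y \<in> Y \<Longrightarrow> less_in S x y"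
  shows "\<exists>z\<in>B. Q z \<and> (\<forall>x\<in>X. less_in S x z) \<and> (\<forall>y\<in>Y. less_in S z y)"
proof -
  have above: "\<forall>x\<in>X. less_in S x z" if "z \<in> B" "m \<in> X" "\<forall>x\<in>X. (x, m) \<in> S" "less_in S m z" for m z
    using that X(2) le_less_trans by blast
  have below: "\<forall>y\<in>Y. less_in S z y" if "z \<in> B" "n \<in> Y" "\<forall>y\<in>Y. (n, y) \<in> S" "less_in S z n" for n z
    using that Y(2) less_le_trans by blast
  consider (neither) "X = {}" "Y = {}"
    | (lower) m where "m \<in> X" "\<forall>x\<in>X. (x, m) \<in> S" "Y = {}"
    | (upper) n where "n \<in> Y" "\<forall>y\<in>Y. (n, y) \<in> S" "X = {}"
    | (both) m n where "m \<in> X" "\<forall>x\<in>X. (x, m) \<in> S" "n \<in> Y" "\<forall>y\<in>Y. (n, y) \<in> S"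
    using finite_has_greatest[OF X] finite_has_least[OF Y] by blast
  then show ?thesis
  proof cases
    case neither
    then show ?thesis using dense_unboundedD(1)[OF dense] by simp
  next
    case lower
    then obtain z where "z \<in> B" "Q z" "less_in S m z"
      using dense_unboundedD(3)[OF dense] X(2) by blast
    with lower show ?thesis using above by blast
  next
    case upper
    then obtain z where "z \<in> B" "Q z" "less_in S z n"
      using dense_unboundedD(2)[OF dense] Y(2) by blast
    with upper show ?thesis using below by blast
  next
    case both
    moreover have "m \<in> B" "n \<in> B" "less_in S m n" using both X(2) Y(2) XY by blast+
    then obtain z where "z \<in> B" "Q z" "less_in S m z" "less_in S z n"
      using dense_unboundedD(4)[OF dense] by blast
    ultimately show ?thesis using above below by blast
  qed
qed

definition labelled_dense :: "'a set \<Rightarrow> 'a rel \<Rightarrow> ('a \<Rightarrow> 'l) \<Rightarrow> 'l set \<Rightarrow> bool" where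
  "labelled_dense A R c L \<longleftrightarrow> c ` A \<subseteq> L \<and> (\<forall>l\<in>L. dense_unbounded (\<lambda>z. c z = l) A R)"

definition partial_rel_iso :: "'a rel \<Rightarrow> 'b rel \<Rightarrow> ('a \<times> 'b) set \<Rightarrow> bool" where
  "partial_rel_iso R S p \<longleftrightarrow>
     (\<forall>a b a' b'. (a, b) \<in> p \<longrightarrow> (a', b') \<in> p \<longrightarrow> (a = a' \<longleftrightarrow> b = b') \<and> ((a, a') \<in> R \<longleftrightarrow> (b, b') \<in> S))"

lemma partial_rel_isoD:
  assumes "partial_rel_iso R S p" "(a, b) \<in> p" "(a', b') \<in> p"
  shows "a = a' \<longleftrightarrow> b = b'" "(a, a') \<in> R \<longleftrightarrow> (b, b') \<in> S"
  using assms unfolding partial_rel_iso_def by blast+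

lemma partial_rel_iso_converse: "partial_rel_iso R S p \<Longrightarrow> partial_rel_iso S R (p\<inverse>)"
  unfolding partial_rel_iso_def by blast

lemma partial_rel_iso_insert:
  assumes p: "partial_rel_iso R S p" "p \<subseteq> A \<times> B"
    and A: "linearly_ordered A R" "a \<in> A" and B: "linearly_ordered B S" "b \<in> B"
    and below: "\<And>x y. (x, y) \<in> p \<Longrightarrow> less_in R x a \<Longrightarrow> less_in S y b"
    and above: "\<And>x y. (x, y) \<in> p \<Longrightarrow> less_in R a x \<Longrightarrow> less_in S b y"
    and new: "a \<notin> Domain p"
  shows "partial_rel_iso R S (insert (a, b) p)"
proof -
  interpret A: linearly_ordered A R by fact
  interpret B: linearly_ordered B S by fact
  have "x \<noteq> a \<and> y \<noteq> b \<and> ((x, a) \<in> R \<longleftrightarrow> (y, b) \<in> S) \<and> ((a, x) \<in> R \<longleftrightarrow> (b, y) \<in> S)" if xy: "(x, y) \<in> p" for x y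
  proof -
    have mem: "x \<in> A" "y \<in> B" using xy p(2) by auto
    from A.less_cases[OF mem(1) A(2)] consider "less_in R x a" | "less_in R a x"
      using xy new by blast
    then show ?thesis
      using below[OF xy] above[OF xy] A.rel_antisym[of x a] B.rel_antisym[of y b] mem A(2) B(2) by cases auto
  qed
  then show ?thesis
    using p(1) A.rel_refl[OF A(2)] B.rel_refl[OF B(2)] unfolding partial_rel_iso_def by auto
qed

definition labelled_partial_iso ::
  "'a set \<Rightarrow> 'a rel \<Rightarrow> ('a \<Rightarrow> 'l) \<Rightarrow> 'b set \<Rightarrow> 'b rel \<Rightarrow> ('b \<Rightarrow> 'l) \<Rightarrow> ('a \<times> 'b) set \<Rightarrow> bool" where
  "labelled_partial_iso A R c B S d p \<longleftrightarrow>
     finite p \<and> p \<subseteq> A \<times> B \<and> (\<forall>(a, b)\<in>p. c a = d b) \<and> partial_rel_iso R S p"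

lemma labelled_partial_iso_converse:
  "labelled_partial_iso A R c B S d p \<Longrightarrow> labelled_partial_iso B S d A R c (p\<inverse>)"
  unfolding labelled_partial_iso_def using partial_rel_iso_converse by fastforce

lemma labelled_partial_iso_extend:
  assumes p: "labelled_partial_iso A R c B S d p" and "a \<in> A"
    and A: "linearly_ordered A R" "labelled_dense A R c L" and B: "linearly_ordered B S" "labelled_dense B S d L"
  shows "\<exists>b. labelled_partial_iso A R c B S d (insert (a, b) p)"
proof (cases "a \<in> Domain p")
  case True
  then obtain b where "insert (a, b) p = p" by (auto simp: insert_absorb)
  with p show ?thesis by metis
next
  case False
  interpret A: linearly_ordered A R by fact
  interpret B: linearly_ordered B S by fact
  have p': "finite p" "p \<subseteq> A \<times> B" "partial_rel_iso R S p" using p by (auto simp: labelled_partial_iso_def)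
  let ?X = "snd ` {q \<in> p. less_in R (fst q) a}" and ?Y = "snd ` {q \<in> p. less_in R a (fst q)}"
  have cut: "less_in S y y'" if y: "y \<in> ?X" "y' \<in> ?Y" for y y'
  proof -
    obtain x x' where xs: "(x, y) \<in> p" "less_in R x a" "(x', y') \<in> p" "less_in R a x'"
      using y by auto
    moreover from this have "x \<in> A" "x' \<in> A" using p'(2) by auto
    ultimately have "less_in R x x'" using A.less_le_trans[of x a x'] \<open>a \<in> A\<close> by blast
    with xs show ?thesis using partial_rel_isoD[OF p'(3)] by blast
  qed
  have "dense_unbounded (\<lambda>z. d z = c a) B S"
    using A(2) B(2) \<open>a \<in> A\<close> by (auto simp: labelled_dense_def)
  then have "\<exists>b\<in>B. d b = c a \<and> (\<forall>y\<in>?X. less_in S y b) \<and> (\<forall>y\<in>?Y. less_in S b y)"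
    by (rule B.dense_unbounded_between_finite[OF _ _ _ _ _ cut]) (use p' in auto)
  then obtain b where b: "b \<in> B" "d b = c a" "\<forall>y\<in>?X. less_in S y b" "\<forall>y\<in>?Y. less_in S b y" by blast
  have "partial_rel_iso R S (insert (a, b) p)"
    by (rule partial_rel_iso_insert[OF p'(3,2) A(1) \<open>a \<in> A\<close> B(1) b(1) _ _ False]) (use b(3,4) in force)+
  then show ?thesis
    using p b \<open>a \<in> A\<close> unfolding labelled_partial_iso_def by (intro exI[of _ b]) auto
qed

lemma labelled_cantor:
  assumes A: "linearly_ordered A R" "countable A" "labelled_dense A R c L"
    and B: "linearly_ordered B S" "countable B" "labelled_dense B S d L"
  obtains f where "rel_iso f A R B S" "\<And>x. x \<in> A \<Longrightarrow> d (f x) = c x"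
proof -
  let ?P = "labelled_partial_iso A R c B S d"
  have P: "p \<subseteq> A \<times> B" "partial_rel_iso R S p" if "?P p" for p
    using that by (simp_all add: labelled_partial_iso_def)
  obtain f where f: "bij_betw f A B"
    "\<And>a a'. a \<in> A \<Longrightarrow> a' \<in> A \<Longrightarrow> \<exists>p. ?P p \<and> (a, f a) \<in> p \<and> (a', f a') \<in> p"
  proof (rule back_and_forth_bij[where P = ?P, OF A(2) B(2)])
    show "?P {}" by (simp add: labelled_partial_iso_def partial_rel_iso_def)
    show "\<exists>b. ?P (insert (a, b) p)" if "?P p" "a \<in> A" for p a
      using labelled_partial_iso_extend[OF that A(1,3) B(1,3)] .
    show "\<exists>a. ?P (insert (a, b) p)" if p: "?P p" and b: "b \<in> B" for p b
    proof -
      obtain a where "labelled_partial_iso B S d A R c (insert (b, a) (p\<inverse>))"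
        using labelled_partial_iso_extend[OF labelled_partial_iso_converse[OF p] b B(1,3) A(1,3)] by blast
      then have "?P ((insert (b, a) (p\<inverse>))\<inverse>)" by (rule labelled_partial_iso_converse)
      moreover have "(insert (b, a) (p\<inverse>))\<inverse> = insert (a, b) p" by auto
      ultimately show ?thesis by auto
    qed
    show "a = a' \<longleftrightarrow> b = b'" if "?P p" "(a, b) \<in> p" "(a', b') \<in> p" for p a b a' b'
      by (rule partial_rel_isoD(1)[OF P(2)[OF that(1)] that(2,3)])
  qed (erule P(1), rule that)
  have "rel_iso f A R B S"
  proof (rule rel_isoI[OF f(1)])
    fix x y assume "x \<in> A" "y \<in> A"
    then obtain p where "?P p" "(x, f x) \<in> p" "(y, f y) \<in> p" using f(2) by blast
    then show "(x, y) \<in> R \<longleftrightarrow> (f x, f y) \<in> S"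
      using partial_rel_isoD(2)[OF P(2)] by blast
  qed
  moreover have "d (f x) = c x" if "x \<in> A" for x
    using f(2)[OF that that] unfolding labelled_partial_iso_def by force
  ultimately show ?thesis by (rule that)
qed


section \<open>Order types of intervals\<close>

abbreviation le_rel :: "'a::ord rel" where
  "le_rel \<equiv> {(u, v). u \<le> v}"

lemma linearly_ordered_le_rel: "linearly_ordered (A :: 'a::linorder set) le_rel"
  by (auto simp: linearly_ordered_iff)

lemma isomorphic_initial_segments_eq:
  fixes w w' :: "'a::wellorder"
  assumes "isomorphic {..<w} le_rel {..<w'} le_rel"
  shows "w = w'"
proof -
  have "\<not> w' < w" if iso: "isomorphic {..<w} le_rel {..<w'} le_rel" for w w' :: 'a
  proof
    assume less: "w' < w"
    obtain f where f: "rel_iso f {..<w} le_rel {..<w'} le_rel"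
      using iso unfolding isomorphic_iff_rel_iso by blast
    have "x \<le> f x" if "x < w" for x
      using that
    proof (induction x rule: less_induct)
      case (less x)
      show ?case
      proof (rule ccontr)
        assume "\<not> x \<le> f x"
        then have fx: "f x < x" by simp
        then have "f x < w" "f x \<le> f (f x)" using less by auto
        then have "x \<le> f x" using rel_iso_le_iff[OF f, of x "f x"] less.prems by simp
        then show False using fx by simp
      qed
    qed
    from this[OF less] show False
      using rel_iso_mem[OF f, of w'] less by simp
  qed
  then show ?thesis using assms isomorphic_sym[OF assms] by (meson linorder_neqE)
qed

definition interval :: "'a set \<Rightarrow> 'a rel \<Rightarrow> 'a \<Rightarrow> 'a \<Rightarrow> 'a set" where
  "interval B S x y = {z \<in> B. (x, z) \<in> S \<and> less_in S z y}"

definition interval_type :: "'a set \<Rightarrow> 'a rel \<Rightarrow> 'a \<Rightarrow> 'a \<Rightarrow> 'b::wellorder \<Rightarrow> bool" where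
  "interval_type B S x y w \<longleftrightarrow> isomorphic (interval B S x y) S {..<w} le_rel"

lemma interval_type_unique: "interval_type B S x y w \<Longrightarrow> interval_type B S x y w' \<Longrightarrow> w = w'"
  unfolding interval_type_def by (meson isomorphic_initial_segments_eq isomorphic_sym isomorphic_trans)

lemma interval_typeE:
  assumes "interval_type B S x y w"
  obtains f where "rel_iso f (interval B S x y) S {..<w} le_rel"
  using assms unfolding interval_type_def isomorphic_iff_rel_iso by blast

lemma interval_type_empty_iff: "interval_type B S x y ({#} :: 'b::wellorder multiset) \<longleftrightarrow> interval B S x y = {}"
  by (auto simp: interval_type_def isomorphic_iff_rel_iso rel_iso_def bij_betw_def lessThan_def)

context linearly_ordered
begin

lemma interval_below: "x \<in> B \<Longrightarrow> y \<in> B \<Longrightarrow> v \<in> interval B S x y \<Longrightarrow>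
    interval B S x v = {z \<in> interval B S x y. less_in S z v}"
  unfolding interval_def using less_le_trans by blast

lemma interval_above: "x \<in> B \<Longrightarrow> y \<in> B \<Longrightarrow> v \<in> interval B S x y \<Longrightarrow>
    interval B S v y = {z \<in> interval B S x y. (v, z) \<in> S}"
  unfolding interval_def using rel_trans by blast

lemma interval_type_below:
  assumes xy: "x \<in> B" "y \<in> B" and v: "v \<in> interval B S x y"
    and f: "rel_iso f (interval B S x y) S {..<w} le_rel"
  shows "interval_type B S x v (f v)"
proof -
  have "less_in S z v \<longleftrightarrow> f z < f v" if "z \<in> interval B S x y" for z
    using rel_iso_le_iff[OF f that v] rel_iso_eq_iff[OF f that v] by (simp add: order_less_le)
  from rel_iso_Collect[where P = "\<lambda>z. less_in S z v" and Q = "\<lambda>u. u < f v", OF f this]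
  have "rel_iso f (interval B S x v) S {u \<in> {..<w}. u < f v} le_rel"
    by (simp add: interval_below[OF xy v])
  moreover have "{u \<in> {..<w}. u < f v} = {..<f v}" using rel_iso_mem[OF f v] by auto
  ultimately show ?thesis by (simp add: interval_type_def isomorphicI)
qed

lemma interval_type_less:
  assumes "x \<in> B" "y \<in> B" "interval_type B S x y w" "v \<in> interval B S x y"
  shows "\<exists>w'<w. interval_type B S x v w'"
proof -
  obtain f where f: "rel_iso f (interval B S x y) S {..<w} le_rel"
    using assms(3) by (rule interval_typeE)
  show ?thesis using interval_type_below[OF assms(1,2,4) f] rel_iso_mem[OF f assms(4)] by blast
qed

lemma ex_interval_type:
  assumes "x \<in> B" "y \<in> B" "interval_type B S x y w" "w' < w"
  shows "\<exists>v\<in>interval B S x y. interval_type B S x v w'"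
proof -
  obtain f where f: "rel_iso f (interval B S x y) S {..<w} le_rel"
    using assms(3) by (rule interval_typeE)
  obtain v where "v \<in> interval B S x y" "f v = w'" using rel_iso_preimage[OF f, of w'] assms(4) by auto
  then show ?thesis using interval_type_below[OF assms(1,2) _ f] by blast
qed

lemma interval_typeI:
  assumes xy: "x \<in> B" "y \<in> B"
    and types: "\<And>v. v \<in> interval B S x y \<Longrightarrow> \<exists>w'<w. interval_type B S x v w'"
    and onto: "\<And>w'. w' < w \<Longrightarrow> \<exists>v\<in>interval B S x y. interval_type B S x v w'"
  shows "interval_type B S x y w"
proof -
  have "\<forall>v\<in>interval B S x y. \<exists>w'. w' < w \<and> interval_type B S x v w'" using types by blast
  from bchoice[OF this] obtain f
    where f: "\<forall>v\<in>interval B S x y. f v < w \<and> interval_type B S x v (f v)" ..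
  interpret I: linearly_ordered "interval B S x y" S
    by (rule linearly_ordered_subset[OF linearly_ordered_axioms]) (auto simp: interval_def)
  have "rel_iso f (interval B S x y) S {..<w} le_rel"
  proof (rule I.strict_mono_rel_iso[OF linearly_ordered_le_rel])
    have "w' \<in> f ` interval B S x y" if less: "w' < w" for w'
    proof -
      obtain v where "v \<in> interval B S x y" "interval_type B S x v w'" using onto[OF less] by blast
      then show ?thesis using interval_type_unique[of B S x v w' "f v"] f by blast
    qed
    then show "f ` interval B S x y = {..<w}" using f by auto
    fix u v assume uv: "u \<in> interval B S x y" "v \<in> interval B S x y" "less_in S u v"
    then have "u \<in> interval B S x v" "v \<in> B" by (auto simp: interval_def)
    then obtain w' where "w' < f v" "interval_type B S x u w'"
      using interval_type_less[OF xy(1), of v "f v" u] f uv(2) by blast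
    then show "less_in le_rel (f u) (f v)"
      using interval_type_unique[of B S x u w' "f u"] f uv(1) by auto
  qed
  then show ?thesis by (simp add: interval_type_def isomorphicI)
qed

lemma interval_type_iff:
  assumes "x \<in> B" "y \<in> B"
  shows "interval_type B S x y w \<longleftrightarrow>
    (\<forall>v\<in>interval B S x y. \<exists>w'<w. interval_type B S x v w') \<and>
    (\<forall>w'<w. \<exists>v\<in>interval B S x y. interval_type B S x v w')"
  using interval_type_less[OF assms] ex_interval_type[OF assms] interval_typeI[OF assms] by blast

lemma interval_type_nonempty:
  assumes "x \<in> B" "y \<in> B" "interval_type B S x y (w :: 'b::wellorder multiset)" "w \<noteq> {#}"
  shows "less_in S x y"
proof -
  have "interval B S x y \<noteq> {}"
    using assms(3,4) interval_type_unique interval_type_empty_iff by metis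
  then show ?thesis using le_less_trans assms(1,2) by (auto simp: interval_def)
qed

end

lemma osum_segment_iso: "rel_iso ((\<oplus>) w) {..<v} le_rel {w..<w \<oplus> v :: 'a::wellorder multiset} le_rel"
proof (rule rel_isoI)
  have "u \<in> (\<oplus>) w ` {..<v}" if "w \<le> u" "u < w \<oplus> v" for u
    using that(2) by (cases rule: le_imp_osum[OF that(1)]) auto
  then show "bij_betw ((\<oplus>) w) {..<v} {w..<w \<oplus> v}" by (auto simp: bij_betw_def inj_on_def)
qed simp

context linearly_ordered
begin

lemma interval_type_osum:
  assumes B: "x \<in> B" "y \<in> B" "z \<in> B" and xyz: "(x, y) \<in> S" "(y, z) \<in> S"
    and w: "interval_type B S x y w" and v: "interval_type B S y z v"
  shows "interval_type B S x z (w \<oplus> v)"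
  unfolding interval_type_def
proof (rule isomorphic_glue[where \<kappa> = "\<lambda>a. less_in S a y" and \<kappa>' = "\<lambda>u. u < w" and K = UNIV])
  fix before :: bool
  show "isomorphic {a \<in> interval B S x z. less_in S a y = before} S {u \<in> {..<w \<oplus> v}. (u < w) = before} le_rel"
  proof (cases before)
    case True
    moreover have "{a \<in> interval B S x z. less_in S a y} = interval B S x y"
      using less_le_trans[of _ y z] B xyz by (auto simp: interval_def)
    moreover have "{u \<in> {..<w \<oplus> v}. u < w} = {..<w}" by (auto intro: order.strict_trans2)
    ultimately show ?thesis using w by (simp add: interval_type_def)
  next
    case False
    moreover have "{a \<in> interval B S x z. \<not> less_in S a y} = interval B S y z"
      using rel_trans[of x y] not_less[of _ y] B xyz unfolding interval_def by blast
    moreover have "{u \<in> {..<w \<oplus> v}. \<not> u < w} = {w..<w \<oplus> v}" by auto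
    ultimately show ?thesis
      using isomorphic_trans[OF v[unfolded interval_type_def] isomorphicI[OF osum_segment_iso]] by simp
  qed
next
  fix a b a' b'
  assume ab: "a \<in> interval B S x z" "b \<in> interval B S x z" "(a' < w) = less_in S a y" "(b' < w) = less_in S b y"
    "less_in S a y \<noteq> less_in S b y"
  then have mem: "a \<in> B" "b \<in> B" by (auto simp: interval_def)
  consider (less) "less_in S a y" "(y, b) \<in> S" "a' < w" "\<not> b' < w"
    | (greater) "less_in S b y" "(y, a) \<in> S" "b' < w" "\<not> a' < w"
    using ab not_less[OF mem(1) B(2)] not_less[OF mem(2) B(2)] by blast
  then show "(a, b) \<in> S \<longleftrightarrow> (a', b') \<in> le_rel"
  proof cases
    case less
    then have "(a, b) \<in> S" using rel_trans mem B(2) by blast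
    with less show ?thesis by auto
  next
    case greater
    then have "less_in S b a" using less_le_trans mem B(2) by blast
    then have "(a, b) \<notin> S" using rel_antisym mem by blast
    with greater show ?thesis by auto
  qed
qed auto

lemma interval_type_osum_split:
  assumes B: "x \<in> B" "z \<in> B" "(x, z) \<in> S"
    and type: "interval_type B S x z (w \<oplus> v :: 'b::wellorder multiset)"
  obtains y where "y \<in> B" "(x, y) \<in> S" "(y, z) \<in> S" "interval_type B S x y w" "interval_type B S y z v"
proof (cases "v = {#}")
  case True
  moreover have "interval B S z z = {}" using rel_antisym B(2) unfolding interval_def by blast
  ultimately show ?thesis using that[of z] B type rel_refl by (simp add: interval_type_empty_iff)
next
  case False
  obtain f where f: "rel_iso f (interval B S x z) S {..<w \<oplus> v} le_rel"
    using type by (rule interval_typeE)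
  obtain y where y: "y \<in> interval B S x z" "f y = w"
    using rel_iso_preimage[OF f, of w] False by auto
  have "interval_type B S x y w" using interval_type_below[OF B(1,2) y(1) f] y(2) by simp
  moreover have "interval_type B S y z v"
  proof -
    have "(y, a) \<in> S \<longleftrightarrow> w \<le> f a" if "a \<in> interval B S x z" for a
      using rel_iso_le_iff[OF f y(1) that] y(2) by simp
    from rel_iso_Collect[where P = "\<lambda>a. (y, a) \<in> S" and Q = "\<lambda>u. w \<le> u", OF f this]
    have "rel_iso f (interval B S y z) S {u \<in> {..<w \<oplus> v}. w \<le> u} le_rel"
      by (simp add: interval_above[OF B(1,2) y(1)])
    moreover have "{u \<in> {..<w \<oplus> v}. w \<le> u} = {w..<w \<oplus> v}" by auto
    ultimately have "rel_iso f (interval B S y z) S {w..<w \<oplus> v} le_rel" by simp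
    then show ?thesis
      unfolding interval_type_def
      using isomorphic_trans[OF isomorphicI isomorphic_sym[OF isomorphicI[OF osum_segment_iso]]] by blast
  qed
  ultimately show ?thesis using that[of y] y(1) by (simp add: interval_def)
qed

lemma closed_interval_isomorphic:
  assumes "s \<in> B" "e \<in> B" "(s, e) \<in> S" "interval_type B S s e w"
  shows "isomorphic {x \<in> B. (s, x) \<in> S \<and> (x, e) \<in> S} S {..w} le_rel"
proof (rule isomorphic_glue[where \<kappa> = "\<lambda>x. x = e" and \<kappa>' = "\<lambda>u. u = w" and K = UNIV])
  let ?I = "{x \<in> B. (s, x) \<in> S \<and> (x, e) \<in> S}"
  have e: "(e, e) \<in> S" using rel_refl assms(2) .
  fix last :: bool
  show "isomorphic {x \<in> ?I. (x = e) = last} S {u \<in> {..w}. (u = w) = last} le_rel"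
  proof (cases last)
    case True
    then have "{x \<in> ?I. (x = e) = last} = {e}" "{u \<in> {..w}. (u = w) = last} = {w}"
      using assms e by auto
    moreover have "rel_iso (\<lambda>_. w) {e} S {w} le_rel" using e by (simp add: rel_iso_def bij_betw_def)
    ultimately show ?thesis using isomorphicI by metis
  next
    case False
    then have "{x \<in> ?I. (x = e) = last} = interval B S s e" "{u \<in> {..w}. (u = w) = last} = {..<w}"
      by (auto simp: interval_def)
    then show ?thesis using assms(4) by (simp add: interval_type_def)
  qed
next
  fix x y x' y'
  assume "x \<in> {x \<in> B. (s, x) \<in> S \<and> (x, e) \<in> S}" "y \<in> {x \<in> B. (s, x) \<in> S \<and> (x, e) \<in> S}"
    "x' \<in> {..w}" "y' \<in> {..w}" "(x' = w) = (x = e)" "(y' = w) = (y = e)" "(x = e) \<noteq> (y = e)"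
  then show "(x, y) \<in> S \<longleftrightarrow> (x', y') \<in> le_rel"
    using rel_antisym[of x y] by (cases "x = e") auto
qed auto

end

definition chain :: "'a set \<Rightarrow> ('b \<Rightarrow> 'a \<Rightarrow> 'a \<Rightarrow> bool) \<Rightarrow> 'b list \<Rightarrow> 'a \<Rightarrow> 'a \<Rightarrow> bool" where
  "chain B P bs u v \<longleftrightarrow> (\<exists>w. w 0 = u \<and> w (length bs) = v \<and> (\<forall>i\<le>length bs. w i \<in> B) \<and>
     (\<forall>i<length bs. P (bs ! i) (w i) (w (Suc i))))"

lemma chain_Nil: "chain B P [] u v \<longleftrightarrow> u \<in> B \<and> u = v"
  by (auto simp: chain_def intro: exI[of _ "\<lambda>_. u"])

lemma chain_Cons: "chain B P (b # bs) u v \<longleftrightarrow> u \<in> B \<and> (\<exists>y. P b u y \<and> chain B P bs y v)"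
proof
  assume "chain B P (b # bs) u v"
  then obtain w where w: "w 0 = u" "w (Suc (length bs)) = v" "\<forall>i\<le>Suc (length bs). w i \<in> B"
    "\<forall>i<Suc (length bs). P ((b # bs) ! i) (w i) (w (Suc i))"
    by (auto simp: chain_def)
  have "chain B P bs (w 1) v"
    unfolding chain_def by (rule exI[of _ "w \<circ> Suc"]) (use w in auto)
  moreover have "u \<in> B" "P b u (w 1)" using w(1) w(3,4)[rule_format, of 0] by auto
  ultimately show "u \<in> B \<and> (\<exists>y. P b u y \<and> chain B P bs y v)" by blast
next
  assume "u \<in> B \<and> (\<exists>y. P b u y \<and> chain B P bs y v)"
  then obtain w where w: "u \<in> B" "P b u (w 0)" "w (length bs) = v" "\<forall>i\<le>length bs. w i \<in> B"
    "\<forall>i<length bs. P (bs ! i) (w i) (w (Suc i))"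
    by (auto simp: chain_def)
  show "chain B P (b # bs) u v"
    unfolding chain_def
    by (rule exI[of _ "case_nat u w"]) (use w in \<open>auto split: nat.split simp: nth_Cons\<close>)
qed

definition at_distance :: "'a set \<Rightarrow> 'a rel \<Rightarrow> 'b::wellorder \<Rightarrow> 'a \<Rightarrow> 'a \<Rightarrow> bool" where
  "at_distance B S w x y \<longleftrightarrow> (x, y) \<in> S \<and> interval_type B S x y w"

lemma at_distance_unique: "at_distance B S w x y \<Longrightarrow> at_distance B S w' x y \<Longrightarrow> w = w'"
  using interval_type_unique[of B S x y w w'] by (simp add: at_distance_def)

context linearly_ordered
begin

lemma at_distance_iff:
  assumes "x \<in> B" "y \<in> B"
  shows "at_distance B S w x y \<longleftrightarrow> (x, y) \<in> S \<and>
    (\<forall>v\<in>B. (x, v) \<in> S \<and> less_in S v y \<longrightarrow> (\<exists>w'\<in>{..<w}. at_distance B S w' x v)) \<and>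
    (\<forall>w'\<in>{..<w}. \<exists>v\<in>B. less_in S v y \<and> at_distance B S w' x v)"
  unfolding at_distance_def interval_type_iff[OF assms] by (auto simp: interval_def)

lemma at_distance_empty_iff:
  assumes "x \<in> B" "y \<in> B"
  shows "at_distance B S ({#} :: 'b::wellorder multiset) x y \<longleftrightarrow> x = y"
  using rel_refl rel_antisym assms
  by (auto simp: at_distance_def interval_type_empty_iff interval_def)

lemma at_distance_imp_less:
  "at_distance B S (w :: 'b::wellorder multiset) x y \<Longrightarrow> w \<noteq> {#} \<Longrightarrow> x \<in> B \<Longrightarrow> y \<in> B \<Longrightarrow> less_in S x y"
  using interval_type_nonempty[of x y w] by (simp add: at_distance_def)

lemma at_distance_osum_iff:
  assumes "x \<in> B" "z \<in> B"
  shows "at_distance B S (w \<oplus> v) x z \<longleftrightarrow> (\<exists>y\<in>B. at_distance B S w x y \<and> at_distance B S v y z)"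
  using interval_type_osum[OF assms(1) _ assms(2)] interval_type_osum_split[OF assms]
    rel_trans[OF _ _ assms(1) _ assms(2)]
  unfolding at_distance_def by metis

lemma at_distance_mset_iff_chain:
  fixes bs :: "'b::wellorder list"
  assumes "v \<in> B"
  shows "sorted_wrt (\<ge>) bs \<Longrightarrow> u \<in> B \<Longrightarrow>
    at_distance B S (mset bs) u v \<longleftrightarrow> chain B (\<lambda>b. at_distance B S {#b#}) bs u v"
proof (induction bs arbitrary: u)
  case Nil
  then show ?case using assms by (simp add: at_distance_empty_iff chain_Nil)
next
  case (Cons b bs)
  have "mset (b # bs) = {#b#} \<oplus> mset bs"
    using Cons.prems(1) by (subst singleton_osum) auto
  moreover have "y \<in> B" if "chain B (\<lambda>b. at_distance B S {#b#}) bs y v" for y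
    using that by (auto simp: chain_def)
  ultimately show ?case
    using Cons assms by (auto simp: at_distance_osum_iff chain_Cons)
qed

end


section \<open>Infinitary formulas\<close>

lemma range_fun_upd_subset: "range e \<subseteq> A \<Longrightarrow> a \<in> A \<Longrightarrow> range (e(x := a)) \<subseteq> A"
  by auto

lemma sat_rel_iso:
  assumes f: "rel_iso f A R B S"
  shows "range e \<subseteq> A \<Longrightarrow> sat B S \<phi> (f \<circ> e) \<longleftrightarrow> sat A R \<phi> e"
proof (induction \<phi> arbitrary: e)
  case (Eq x y)
  then show ?case by (simp add: rel_iso_eq_iff[OF f] image_subset_iff)
next
  case (Le x y)
  then show ?case by (simp add: rel_iso_le_iff[OF f] image_subset_iff)
next
  case (Ex x \<phi>)
  have "sat B S \<phi> ((f \<circ> e)(x := f a)) \<longleftrightarrow> sat A R \<phi> (e(x := a))" if "a \<in> A" for a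
    using Ex.IH[OF range_fun_upd_subset[OF Ex.prems that], of x] by (simp only: fun_upd_comp)
  then show ?case unfolding rel_iso_image[OF f, symmetric] by (simp add: comp_def)
next
  case (All x \<phi>)
  have "sat B S \<phi> ((f \<circ> e)(x := f a)) \<longleftrightarrow> sat A R \<phi> (e(x := a))" if "a \<in> A" for a
    using All.IH[OF range_fun_upd_subset[OF All.prems that], of x] by (simp only: fun_upd_comp)
  then show ?case unfolding rel_iso_image[OF f, symmetric] by (simp add: comp_def)
qed auto

lemma models_isomorphic:
  assumes "isomorphic A R B S" "models A R \<phi>"
  shows "models B S \<phi>"
  unfolding models_def
proof (intro allI impI)
  fix e :: "nat \<Rightarrow> 'b" assume e: "range e \<subseteq> B"
  obtain f where f: "rel_iso f B S A R"
    using isomorphic_sym[OF assms(1)] unfolding isomorphic_iff_rel_iso by blast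
  have "range (f \<circ> e) \<subseteq> A" using e rel_iso_mem[OF f] by auto
  then have "sat A R \<phi> (f \<circ> e)" using assms(2) by (simp add: models_def)
  then show "sat B S \<phi> e" by (simp add: sat_rel_iso[OF f e])
qed

lemma sat_cong_fv: "\<forall>v\<in>fv \<phi>. e v = e' v \<Longrightarrow> sat A R \<phi> e \<longleftrightarrow> sat A R \<phi> e'"
proof (induction \<phi> arbitrary: e e')
  case (Ex x \<phi>)
  have "sat A R \<phi> (e(x := a)) \<longleftrightarrow> sat A R \<phi> (e'(x := a))" for a
    by (rule Ex.IH) (use Ex.prems in simp)
  then show ?case by simp
next
  case (All x \<phi>)
  have "sat A R \<phi> (e(x := a)) \<longleftrightarrow> sat A R \<phi> (e'(x := a))" for a
    by (rule All.IH) (use All.prems in simp)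
  then show ?case by simp
next
  case (Conj \<Phi>)
  have "sat A R (\<Phi> i) e \<longleftrightarrow> sat A R (\<Phi> i) e'" for i
    by (rule Conj.IH) (use Conj.prems in auto)
  then show ?case by simp
next
  case (Disj \<Phi>)
  have "sat A R (\<Phi> i) e \<longleftrightarrow> sat A R (\<Phi> i) e'" for i
    by (rule Disj.IH) (use Disj.prems in auto)
  then show ?case by simp
qed (simp_all add: ball_Un, blast+)

definition reassigns :: "'a set \<Rightarrow> nat list \<Rightarrow> (nat \<Rightarrow> 'a) \<Rightarrow> (nat \<Rightarrow> 'a) \<Rightarrow> bool" where
  "reassigns A xs e e' \<longleftrightarrow> (\<forall>v. v \<notin> set xs \<longrightarrow> e' v = e v) \<and> (\<forall>v\<in>set xs. e' v \<in> A)"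

lemma reassigns_Nil [simp]: "reassigns A [] e e' \<longleftrightarrow> e' = e"
  by (auto simp: reassigns_def)

lemma reassigns_Cons: "reassigns A (x # xs) e e' \<longleftrightarrow> (\<exists>a\<in>A. reassigns A xs (e(x := a)) e')"
proof
  assume "reassigns A (x # xs) e e'"
  then show "\<exists>a\<in>A. reassigns A xs (e(x := a)) e'"
    by (intro bexI[of _ "e' x"]) (auto simp: reassigns_def)
next
  assume "\<exists>a\<in>A. reassigns A xs (e(x := a)) e'"
  then show "reassigns A (x # xs) e e'"
    by (cases "x \<in> set xs") (auto simp: reassigns_def)
qed

lemma reassigns_self: "range e \<subseteq> A \<Longrightarrow> reassigns A xs e e"
  by (auto simp: reassigns_def)

lemma range_reassigns:
  assumes "reassigns A xs e e'" "range e \<subseteq> A"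
  shows "range e' \<subseteq> A"
proof (rule image_subsetI)
  show "e' v \<in> A" for v
    using assms by (cases "v \<in> set xs") (auto simp: reassigns_def)
qed

lemma sat_Exs: "sat A R (Exs xs \<phi>) e \<longleftrightarrow> (\<exists>e'. reassigns A xs e e' \<and> sat A R \<phi> e')"
  by (induction xs arbitrary: e) (auto simp: Exs_def reassigns_Cons)

lemma sat_Alls: "sat A R (Alls xs \<phi>) e \<longleftrightarrow> (\<forall>e'. reassigns A xs e e' \<longrightarrow> sat A R \<phi> e')"
  by (induction xs arbitrary: e) (auto simp: Alls_def reassigns_Cons)

lemma fv_Exs [simp]: "fv (Exs xs \<phi>) = fv \<phi> - set xs"
  by (induction xs) (auto simp: Exs_def)

lemma fv_Alls [simp]: "fv (Alls xs \<phi>) = fv \<phi> - set xs"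
  by (induction xs) (auto simp: Alls_def)

primrec dual :: "form \<Rightarrow> form" where
  "dual Bot = Neg Bot"
| "dual (Eq x y) = Neg (Eq x y)"
| "dual (Le x y) = Neg (Le x y)"
| "dual (Neg \<phi>) = Neg (Neg \<phi>)"
| "dual (And \<phi> \<psi>) = Neg (And \<phi> \<psi>)"
| "dual (Or \<phi> \<psi>) = Neg (Or \<phi> \<psi>)"
| "dual (Conj \<Phi>) = Disj (\<lambda>i. dual (\<Phi> i))"
| "dual (Disj \<Phi>) = Conj (\<lambda>i. dual (\<Phi> i))"
| "dual (Ex x \<phi>) = All x (dual \<phi>)"
| "dual (All x \<phi>) = Ex x (dual \<phi>)"

lemma sat_dual [simp]: "sat A R (dual \<phi>) e \<longleftrightarrow> \<not> sat A R \<phi> e"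
  by (induction \<phi> arbitrary: e) auto

lemma fv_dual [simp]: "fv (dual \<phi>) = fv \<phi>"
  by (induction \<phi>) auto

lemma dual_Exs: "dual (Exs xs \<phi>) = Alls xs (dual \<phi>)"
  by (induction xs) (auto simp: Exs_def Alls_def)

lemma dual_Alls: "dual (Alls xs \<phi>) = Exs xs (dual \<phi>)"
  by (induction xs) (auto simp: Exs_def Alls_def)

lemma finitary_qf_dual: "finitary_qf \<phi> \<Longrightarrow> finitary_qf (dual \<phi>)"
  by (cases \<phi>) auto

lemma Pi_in_dual: "Sigma_in \<alpha> \<phi> \<Longrightarrow> Pi_in \<alpha> (dual \<phi>)"
  and Sigma_in_dual: "Pi_in \<alpha>' \<phi>' \<Longrightarrow> Sigma_in \<alpha>' (dual \<phi>')"
proof (induction rule: Sigma_in_Pi_in.inducts)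
  case (Sigma_pos \<beta> \<alpha> \<Phi> xs)
  then show ?case
    by (simp add: dual_Exs) (intro Pi_pos[where \<beta> = \<beta>], blast)
next
  case (Pi_pos \<beta> \<alpha> \<Phi> xs)
  then show ?case
    by (simp add: dual_Alls) (intro Sigma_pos[where \<beta> = \<beta>], blast)
qed (auto intro: Sigma_zero Pi_zero finitary_qf_dual)

lemma Pi_posE:
  assumes "Pi_in \<alpha> \<phi>" "0 < \<alpha>"
  obtains \<beta> \<Phi> xs where "\<phi> = Conj (\<lambda>i. Alls (xs i) (\<Phi> i))" "\<And>i. \<beta> i < \<alpha>" "\<And>i. Sigma_in (\<beta> i) (\<Phi> i)"
  using assms by (cases rule: Pi_in.cases) auto

lemma Sigma_posE:
  assumes "Sigma_in \<alpha> \<phi>" "0 < \<alpha>"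
  obtains \<beta> \<Phi> xs where "\<phi> = Disj (\<lambda>i. Exs (xs i) (\<Phi> i))" "\<And>i. \<beta> i < \<alpha>" "\<And>i. Pi_in (\<beta> i) (\<Phi> i)"
  using assms by (cases rule: Sigma_in.cases) auto

lemma Pi_in_zero_iff: "Pi_in 0 \<phi> \<longleftrightarrow> finitary_qf \<phi>"
  by (auto intro: Pi_zero elim: Pi_in.cases)

lemma Sigma_in_zero_iff: "Sigma_in 0 \<phi> \<longleftrightarrow> finitary_qf \<phi>"
  by (auto intro: Sigma_zero elim: Sigma_in.cases)

lemma Pi_in_mono: "Pi_in \<alpha> \<phi> \<Longrightarrow> 0 < \<alpha> \<Longrightarrow> \<alpha> \<le> \<beta> \<Longrightarrow> Pi_in \<beta> \<phi>"
  by (erule Pi_posE, assumption) (simp, rule Pi_pos, blast intro: order.strict_trans2)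

lemma Sigma_in_mono: "Sigma_in \<alpha> \<phi> \<Longrightarrow> 0 < \<alpha> \<Longrightarrow> \<alpha> \<le> \<beta> \<Longrightarrow> Sigma_in \<beta> \<phi>"
  by (erule Sigma_posE, assumption) (simp, rule Sigma_pos, blast intro: order.strict_trans2)

definition trivial_conj :: "form \<Rightarrow> form" where
  "trivial_conj \<phi> = Conj (\<lambda>i. Alls [] \<phi>)"

lemma sat_trivial_conj [simp]: "sat A R (trivial_conj \<phi>) e \<longleftrightarrow> sat A R \<phi> e"
  by (simp add: trivial_conj_def Alls_def)

lemma fv_trivial_conj [simp]: "fv (trivial_conj \<phi>) = fv \<phi>"
  by (simp add: trivial_conj_def)

lemma Pi_in_trivial_conj: "Sigma_in \<alpha> \<phi> \<Longrightarrow> \<alpha> < \<beta> \<Longrightarrow> Pi_in \<beta> (trivial_conj \<phi>)"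
  unfolding trivial_conj_def by (rule Pi_pos[where \<beta> = "\<lambda>_. \<alpha>"]) simp

lemma Pi_in_countable_conj:
  assumes "\<And>i :: nat. Pi_in \<alpha> (\<phi> i)" "0 < \<alpha>"
  obtains \<chi> where "Pi_in \<alpha> \<chi>" "fv \<chi> = (\<Union>i. fv (\<phi> i))"
    "\<And>(A :: 'a set) R e. sat A R \<chi> e \<longleftrightarrow> (\<forall>i. sat A R (\<phi> i) e)"
proof -
  have "\<exists>\<Phi> xs \<beta>. \<phi> i = Conj (\<lambda>j. Alls (xs j) (\<Phi> j)) \<and> (\<forall>j. \<beta> j < \<alpha>) \<and> (\<forall>j. Sigma_in (\<beta> j) (\<Phi> j))" for i
    by (rule Pi_posE[OF assms(1)[of i] assms(2)]) blast
  then obtain \<Phi> xs \<beta> where \<Phi>: "\<And>i. \<phi> i = Conj (\<lambda>j. Alls (xs i j) (\<Phi> i j))" "\<And>i j. \<beta> i j < \<alpha>"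
    "\<And>i j. Sigma_in (\<beta> i j) (\<Phi> i j)"
    by metis
  let ?f = "\<lambda>n. fst (prod_decode n)" and ?s = "\<lambda>n. snd (prod_decode n)"
  have decode: "(\<forall>n. P (?f n) (?s n)) \<longleftrightarrow> (\<forall>i j. P i j)" for P :: "nat \<Rightarrow> nat \<Rightarrow> bool"
    by (metis fst_conv snd_conv prod_encode_inverse)
  let ?\<chi> = "Conj (\<lambda>n. Alls (xs (?f n) (?s n)) (\<Phi> (?f n) (?s n)))"
  show ?thesis
  proof
    show "Pi_in \<alpha> ?\<chi>"
      by (rule Pi_pos[where \<beta> = "\<lambda>n. \<beta> (?f n) (?s n)"]) (simp add: \<Phi>)
    show "fv ?\<chi> = (\<Union>i. fv (\<phi> i))"
    proof (rule set_eqI)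
      show "v \<in> fv ?\<chi> \<longleftrightarrow> v \<in> (\<Union>i. fv (\<phi> i))" for v
        using decode[of "\<lambda>i j. v \<notin> fv (Alls (xs i j) (\<Phi> i j))"] unfolding \<Phi>(1) fv.simps by blast
    qed
    show "sat A R ?\<chi> e \<longleftrightarrow> (\<forall>i. sat A R (\<phi> i) e)" for A :: "'a set" and R e
      using decode[of "\<lambda>i j. sat A R (Alls (xs i j) (\<Phi> i j)) e"] by (simp add: \<Phi>(1))
  qed
qed

lemma Pi_in_conj:
  assumes "Pi_in \<alpha> \<phi>" "Pi_in \<alpha> \<psi>" "0 < \<alpha>"
  obtains \<chi> where "Pi_in \<alpha> \<chi>" "fv \<chi> = fv \<phi> \<union> fv \<psi>"
    "\<And>(A :: 'a set) R e. sat A R \<chi> e \<longleftrightarrow> sat A R \<phi> e \<and> sat A R \<psi> e"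
proof -
  have "Pi_in \<alpha> (case_nat \<phi> (\<lambda>_. \<psi>) i)" for i
    using assms(1,2) by (cases i) auto
  then obtain \<chi> where \<chi>: "Pi_in \<alpha> \<chi>" "fv \<chi> = (\<Union>i. fv (case_nat \<phi> (\<lambda>_. \<psi>) i))"
    "\<And>(A :: 'a set) R e. sat A R \<chi> e \<longleftrightarrow> (\<forall>i. sat A R (case_nat \<phi> (\<lambda>_. \<psi>) i) e)"
    by (rule Pi_in_countable_conj[OF _ assms(3)]) (rule that)
  have all_nat: "(\<forall>i. P i) \<longleftrightarrow> P 0 \<and> (\<forall>i. P (Suc i))" for P
    by (metis nat.exhaust)
  have "fv \<chi> = fv \<phi> \<union> fv \<psi>"
    unfolding \<chi>(2) by (auto simp: all_nat split: nat.splits)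
  then show ?thesis by (rule that[OF \<chi>(1)]) (simp add: \<chi>(3) all_nat)
qed


section \<open>Back-and-forth systems\<close>

locale back_forth_system =
  fixes A :: "'a set" and R and B :: "'b set" and S and J :: "omega1 \<Rightarrow> ('a \<times> 'b) set \<Rightarrow> bool"
  assumes dom: "J \<alpha> p \<Longrightarrow> p \<subseteq> A \<times> B"
    and partial_iso: "J \<alpha> p \<Longrightarrow> partial_rel_iso R S p"
    and forth: "J \<alpha> p \<Longrightarrow> \<beta> < \<alpha> \<Longrightarrow> finite F \<Longrightarrow> F \<subseteq> A \<Longrightarrow> \<exists>q. p \<subseteq> q \<and> J \<beta> q \<and> F \<subseteq> Domain q"
    and backward: "J \<alpha> p \<Longrightarrow> \<beta> < \<alpha> \<Longrightarrow> finite G \<Longrightarrow> G \<subseteq> B \<Longrightarrow> \<exists>q. p \<subseteq> q \<and> J \<beta> q \<and> G \<subseteq> Range q"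
begin

lemma converse: "back_forth_system B S A R (\<lambda>\<alpha> p. J \<alpha> (p\<inverse>))"
proof
  show "p \<subseteq> B \<times> A" if "J \<alpha> (p\<inverse>)" for \<alpha> p using dom[OF that] by auto
  show "partial_rel_iso S R p" if "J \<alpha> (p\<inverse>)" for \<alpha> p
    using partial_rel_iso_converse[OF partial_iso[OF that]] by simp
  show "\<exists>q. p \<subseteq> q \<and> J \<beta> (q\<inverse>) \<and> F \<subseteq> Domain q"
    if extend: "J \<alpha> (p\<inverse>)" "\<beta> < \<alpha>" "finite F" "F \<subseteq> B" for \<alpha> p \<beta> F
  proof -
    obtain q where "p\<inverse> \<subseteq> q" "J \<beta> q" "F \<subseteq> Range q" using backward[OF extend] by blast
    then show ?thesis by (intro exI[of _ "q\<inverse>"]) auto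
  qed
  show "\<exists>q. p \<subseteq> q \<and> J \<beta> (q\<inverse>) \<and> G \<subseteq> Range q"
    if extend: "J \<alpha> (p\<inverse>)" "\<beta> < \<alpha>" "finite G" "G \<subseteq> A" for \<alpha> p \<beta> G
  proof -
    obtain q where "p\<inverse> \<subseteq> q" "J \<beta> q" "G \<subseteq> Domain q" using forth[OF extend] by blast
    then show ?thesis by (intro exI[of _ "q\<inverse>"]) auto
  qed
qed

lemma sat_qf_agree:
  assumes "J \<alpha> p"
  shows "finitary_qf \<phi> \<Longrightarrow> (\<And>v. v \<in> fv \<phi> \<Longrightarrow> (e v, e' v) \<in> p) \<Longrightarrow> sat A R \<phi> e \<longleftrightarrow> sat B S \<phi> e'"
proof (induction \<phi>)
  case (Eq x y)
  then show ?case using partial_rel_isoD(1)[OF partial_iso[OF assms], of "e x" "e' x" "e y" "e' y"] by simp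
next
  case (Le x y)
  then show ?case using partial_rel_isoD(2)[OF partial_iso[OF assms], of "e x" "e' x" "e y" "e' y"] by simp
qed auto

lemma extend_assignment:
  assumes p: "J \<alpha> p" "\<beta> < \<alpha>" and V: "\<And>v. v \<in> V - set xs \<Longrightarrow> (e v, e' v) \<in> p" and e\<^sub>1: "reassigns A xs e e\<^sub>1"
  obtains e\<^sub>2 q where "reassigns B xs e' e\<^sub>2" "J \<beta> q" "\<And>v. v \<in> V \<Longrightarrow> (e\<^sub>1 v, e\<^sub>2 v) \<in> q"
proof -
  have new: "e\<^sub>1 ` set xs \<subseteq> A" using e\<^sub>1 by (auto simp: reassigns_def)
  obtain q where q: "p \<subseteq> q" "J \<beta> q" "e\<^sub>1 ` set xs \<subseteq> Domain q"
    using forth[OF p finite_imageI[OF finite_set] new] by blast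
  then have "\<forall>v\<in>set xs. \<exists>b. (e\<^sub>1 v, b) \<in> q" by blast
  from bchoice[OF this] obtain g where g: "\<forall>v\<in>set xs. (e\<^sub>1 v, g v) \<in> q" ..
  let ?e = "\<lambda>v. if v \<in> set xs then g v else e' v"
  show ?thesis
  proof
    show "reassigns B xs e' ?e" using g dom[OF q(2)] by (auto simp: reassigns_def)
    show "(e\<^sub>1 v, ?e v) \<in> q" if "v \<in> V" for v
      using g V[of v] q(1) e\<^sub>1 that by (auto simp: reassigns_def)
  qed (rule q(2))
qed

lemma sat_Exs_transfer:
  assumes p: "J \<alpha> p" "\<beta> < \<alpha>" "\<And>v. v \<in> fv \<Phi> - set xs \<Longrightarrow> (e v, e' v) \<in> p"
    and transfer: "\<And>q e e'. J \<beta> q \<Longrightarrow> (\<And>v. v \<in> fv \<Phi> \<Longrightarrow> (e v, e' v) \<in> q) \<Longrightarrow> sat A R \<Phi> e \<Longrightarrow> sat B S \<Phi> e'"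
    and sat: "sat A R (Exs xs \<Phi>) e"
  shows "sat B S (Exs xs \<Phi>) e'"
proof -
  obtain e\<^sub>1 where e\<^sub>1: "reassigns A xs e e\<^sub>1" "sat A R \<Phi> e\<^sub>1" using sat by (auto simp: sat_Exs)
  obtain e\<^sub>2 q where e\<^sub>2: "reassigns B xs e' e\<^sub>2" "J \<beta> q" "\<And>v. v \<in> fv \<Phi> \<Longrightarrow> (e\<^sub>1 v, e\<^sub>2 v) \<in> q"
    by (rule extend_assignment[where V = "fv \<Phi>", OF p e\<^sub>1(1)]) (assumption, rule that)
  have "sat B S \<Phi> e\<^sub>2" by (rule transfer[OF e\<^sub>2(2,3) e\<^sub>1(2)])
  with e\<^sub>2(1) show ?thesis by (auto simp: sat_Exs)
qed

lemma sat_Exs_agree: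
  assumes p: "J \<alpha> p" "\<beta> < \<alpha>" "\<And>v. v \<in> fv \<Phi> - set xs \<Longrightarrow> (e v, e' v) \<in> p"
    and agree: "\<And>q e e'. J \<beta> q \<Longrightarrow> (\<And>v. v \<in> fv \<Phi> \<Longrightarrow> (e v, e' v) \<in> q) \<Longrightarrow> sat A R \<Phi> e \<longleftrightarrow> sat B S \<Phi> e'"
  shows "sat A R (Exs xs \<Phi>) e \<longleftrightarrow> sat B S (Exs xs \<Phi>) e'"
proof
  show "sat B S (Exs xs \<Phi>) e'" if "sat A R (Exs xs \<Phi>) e"
  proof (rule sat_Exs_transfer[OF p _ that])
    show "sat B S \<Phi> e\<^sub>2" if "J \<beta> q" "\<And>v. v \<in> fv \<Phi> \<Longrightarrow> (e\<^sub>1 v, e\<^sub>2 v) \<in> q" "sat A R \<Phi> e\<^sub>1" for q e\<^sub>1 e\<^sub>2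
      using agree[OF that(1,2)] that(3) by simp
  qed
  interpret converse: back_forth_system B S A R "\<lambda>\<alpha> p. J \<alpha> (p\<inverse>)" by (rule converse)
  show "sat A R (Exs xs \<Phi>) e" if "sat B S (Exs xs \<Phi>) e'"
  proof (rule converse.sat_Exs_transfer[OF _ p(2) _ _ that])
    show "J \<alpha> ((p\<inverse>)\<inverse>)" using p(1) by simp
    show "(e' v, e v) \<in> p\<inverse>" if "v \<in> fv \<Phi> - set xs" for v using p(3)[OF that] by simp
    show "sat A R \<Phi> e\<^sub>1" if "J \<beta> (q\<inverse>)" "\<And>v. v \<in> fv \<Phi> \<Longrightarrow> (e\<^sub>2 v, e\<^sub>1 v) \<in> q" "sat B S \<Phi> e\<^sub>2" for q e\<^sub>2 e\<^sub>1
      using agree[OF that(1), of e\<^sub>1 e\<^sub>2] that(2,3) by simp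
  qed
qed

lemma sat_Sigma_agree:
    "Sigma_in \<alpha> \<phi> \<Longrightarrow> J \<alpha> p \<Longrightarrow> (\<And>v. v \<in> fv \<phi> \<Longrightarrow> (e v, e' v) \<in> p) \<Longrightarrow> sat A R \<phi> e \<longleftrightarrow> sat B S \<phi> e'"
  and sat_Pi_agree:
    "Pi_in \<alpha>' \<phi>' \<Longrightarrow> J \<alpha>' p \<Longrightarrow> (\<And>v. v \<in> fv \<phi>' \<Longrightarrow> (e v, e' v) \<in> p) \<Longrightarrow> sat A R \<phi>' e \<longleftrightarrow> sat B S \<phi>' e'"
proof (induction arbitrary: p e e' and p e e' rule: Sigma_in_Pi_in.inducts)
  case (Sigma_pos \<beta> \<alpha> \<Phi> xs)
  have "sat A R (Exs (xs i) (\<Phi> i)) e \<longleftrightarrow> sat B S (Exs (xs i) (\<Phi> i)) e'" for i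
  proof (rule sat_Exs_agree[OF Sigma_pos.prems(1)])
    show "\<beta> i < \<alpha>" using Sigma_pos.IH by blast
    show "(e v, e' v) \<in> p" if "v \<in> fv (\<Phi> i) - set (xs i)" for v
      by (rule Sigma_pos.prems(2)) (use that in auto)
    show "sat A R (\<Phi> i) e\<^sub>1 \<longleftrightarrow> sat B S (\<Phi> i) e\<^sub>2"
      if "J (\<beta> i) q" "\<And>v. v \<in> fv (\<Phi> i) \<Longrightarrow> (e\<^sub>1 v, e\<^sub>2 v) \<in> q" for q e\<^sub>1 e\<^sub>2
      using Sigma_pos.IH[of i] that by simp
  qed
  then show ?case by simp
next
  case (Pi_pos \<beta> \<alpha> \<Phi> xs)
  have "sat A R (Exs (xs i) (dual (\<Phi> i))) e \<longleftrightarrow> sat B S (Exs (xs i) (dual (\<Phi> i))) e'" for i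
  proof (rule sat_Exs_agree[OF Pi_pos.prems(1)])
    show "\<beta> i < \<alpha>" using Pi_pos.IH by blast
    show "(e v, e' v) \<in> p" if "v \<in> fv (dual (\<Phi> i)) - set (xs i)" for v
      by (rule Pi_pos.prems(2)) (use that in auto)
    show "sat A R (dual (\<Phi> i)) e\<^sub>1 \<longleftrightarrow> sat B S (dual (\<Phi> i)) e\<^sub>2"
      if "J (\<beta> i) q" "\<And>v. v \<in> fv (dual (\<Phi> i)) \<Longrightarrow> (e\<^sub>1 v, e\<^sub>2 v) \<in> q" for q e\<^sub>1 e\<^sub>2
      using Pi_pos.IH[of i] that by simp
  qed
  then show ?case by (simp flip: dual_Alls)
qed (use sat_qf_agree in blast)+

end

locale covering_maps =
  fixes A :: "'a set" and R and B :: "'b set" and S and H :: "('a \<Rightarrow> 'b) set" and \<mu> :: omega1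
  assumes covering: "finite F \<Longrightarrow> F \<subseteq> B \<Longrightarrow> \<exists>h\<in>H. F \<subseteq> h ` A"
    and maps_to: "h \<in> H \<Longrightarrow> a \<in> A \<Longrightarrow> h a \<in> B"
    and preserves_Pi: "h \<in> H \<Longrightarrow> Pi_in \<gamma> \<psi> \<Longrightarrow> \<gamma> \<le> \<mu> \<Longrightarrow> finite (fv \<psi>) \<Longrightarrow> range e \<subseteq> A \<Longrightarrow>
      sat A R \<psi> e \<Longrightarrow> sat B S \<psi> (h \<circ> e)"
begin

lemma preserves_Sigma:
  assumes h: "h \<in> H" and \<phi>: "Sigma_in \<beta> \<phi>" "\<beta> \<le> succ_ord \<mu>" "finite (fv \<phi>)"
    and e: "range e \<subseteq> A" and sat: "sat A R \<phi> e"
  shows "sat B S \<phi> (h \<circ> e)"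
proof (cases "\<beta> = 0")
  case True
  then have "Pi_in 0 \<phi>" using \<phi>(1) by (simp add: Sigma_in_zero_iff Pi_in_zero_iff)
  then show ?thesis using preserves_Pi[OF h] \<phi>(3) e sat by simp
next
  case False
  then have "0 < \<beta>" by (simp add: omega1_neq_zero_iff)
  obtain \<gamma> \<Psi> ys where \<Psi>: "\<phi> = Disj (\<lambda>j. Exs (ys j) (\<Psi> j))" "\<And>j. \<gamma> j < \<beta>" "\<And>j. Pi_in (\<gamma> j) (\<Psi> j)"
    by (rule Sigma_posE[OF \<phi>(1) \<open>0 < \<beta>\<close>]) (rule that)
  obtain j e\<^sub>1 where e\<^sub>1: "reassigns A (ys j) e e\<^sub>1" "sat A R (\<Psi> j) e\<^sub>1"
    using sat by (auto simp: \<Psi>(1) sat_Exs)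
  have "sat B S (\<Psi> j) (h \<circ> e\<^sub>1)"
  proof (rule preserves_Pi[OF h \<Psi>(3) _ _ range_reassigns[OF e\<^sub>1(1) e] e\<^sub>1(2)])
    show "\<gamma> j \<le> \<mu>" using \<Psi>(2)[of j] \<phi>(2) by (meson less_succ_ord_iff order.strict_trans2)
    have "fv (\<Psi> j) \<subseteq> fv \<phi> \<union> set (ys j)" by (auto simp: \<Psi>(1))
    then show "finite (fv (\<Psi> j))" by (rule finite_subset) (simp add: \<phi>(3))
  qed
  moreover have "reassigns B (ys j) (h \<circ> e) (h \<circ> e\<^sub>1)"
    using e\<^sub>1(1) maps_to[OF h] by (auto simp: reassigns_def)
  ultimately show ?thesis by (auto simp: \<Psi>(1) sat_Exs)
qed

lemma models_Pi_transfer: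
  assumes \<phi>: "Pi_in (succ_ord (succ_ord \<mu>)) \<phi>" "sentence \<phi>" and A: "models A R \<phi>"
  shows "models B S \<phi>"
proof -
  obtain \<beta> \<Phi> xs where \<Phi>: "\<phi> = Conj (\<lambda>i. Alls (xs i) (\<Phi> i))" "\<And>i. \<beta> i < succ_ord (succ_ord \<mu>)"
    "\<And>i. Sigma_in (\<beta> i) (\<Phi> i)"
    by (rule Pi_posE[OF \<phi>(1) succ_ord_pos]) (rule that)
  have closed: "fv (\<Phi> i) \<subseteq> set (xs i)" for i
    using \<phi>(2) unfolding sentence_def \<Phi>(1) by auto
  have sat: "sat B S (\<Phi> i) e'" if e': "range e' \<subseteq> B" for i e'
  proof -
    have "e' ` insert 0 (set (xs i)) \<subseteq> B" using e' by auto
    then obtain h where h: "h \<in> H" "e' ` insert 0 (set (xs i)) \<subseteq> h ` A"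
      using covering[of "e' ` insert 0 (set (xs i))"] by auto
    then have "\<forall>v\<in>insert 0 (set (xs i)). \<exists>a\<in>A. e' v = h a" by blast
    then obtain g where g: "\<forall>v\<in>insert 0 (set (xs i)). g v \<in> A \<and> e' v = h (g v)"
      by metis
    define e where "e v = (if v \<in> set (xs i) then g v else g 0)" for v
    have e: "range e \<subseteq> A" using g by (auto simp: e_def)
    then have "sat A R (Alls (xs i) (\<Phi> i)) e" using A by (simp add: models_def \<Phi>(1))
    then have "sat A R (\<Phi> i) e" using reassigns_self[OF e] by (simp add: sat_Alls)
    then have "sat B S (\<Phi> i) (h \<circ> e)"
      using preserves_Sigma[OF h(1) \<Phi>(3) _ finite_subset[OF closed] e] \<Phi>(2)[of i] by (simp add: less_succ_ord_iff)
    moreover have "e' v = (h \<circ> e) v" if "v \<in> fv (\<Phi> i)" for v using closed that g by (auto simp: e_def)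
    ultimately show ?thesis using sat_cong_fv[of "\<Phi> i" e' "h \<circ> e"] by blast
  qed
  show ?thesis
    unfolding models_def \<Phi>(1) sat.simps sat_Alls by (intro allI impI sat) (erule (1) range_reassigns)
qed

end


section \<open>Definable predicates\<close>

definition Pi_definable :: "omega1 \<Rightarrow> nat set \<Rightarrow> ('a set \<Rightarrow> 'a rel \<Rightarrow> (nat \<Rightarrow> 'a) \<Rightarrow> bool) \<Rightarrow> bool" where
  "Pi_definable \<alpha> V P \<longleftrightarrow> (\<exists>\<phi>. Pi_in \<alpha> \<phi> \<and> fv \<phi> \<subseteq> V \<and>
     (\<forall>B S e. linearly_ordered B S \<longrightarrow> range e \<subseteq> B \<longrightarrow> (sat B S \<phi> e \<longleftrightarrow> P B S e)))"

lemma Pi_definableI: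
  "Pi_in \<alpha> \<phi> \<Longrightarrow> fv \<phi> \<subseteq> V \<Longrightarrow>
    (\<And>B S e. linearly_ordered B S \<Longrightarrow> range e \<subseteq> B \<Longrightarrow> sat B S \<phi> e \<longleftrightarrow> P B S e) \<Longrightarrow> Pi_definable \<alpha> V P"
  unfolding Pi_definable_def by blast

lemma Pi_definableE:
  assumes "Pi_definable \<alpha> V P"
  obtains \<phi> where "Pi_in \<alpha> \<phi>" "fv \<phi> \<subseteq> V"
    "\<And>B S e. linearly_ordered B S \<Longrightarrow> range e \<subseteq> B \<Longrightarrow> sat B S \<phi> e \<longleftrightarrow> P B S e"
  using assms unfolding Pi_definable_def by blast

lemma Pi_definable_cong:
  assumes "Pi_definable \<alpha> V P" "\<And>B S e. linearly_ordered B S \<Longrightarrow> range e \<subseteq> B \<Longrightarrow> P B S e \<longleftrightarrow> Q B S e"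
  shows "Pi_definable \<alpha> V Q"
proof -
  obtain \<phi> where \<phi>: "Pi_in \<alpha> \<phi>" "fv \<phi> \<subseteq> V"
    "\<And>B S e. linearly_ordered B S \<Longrightarrow> range e \<subseteq> B \<Longrightarrow> sat B S \<phi> e \<longleftrightarrow> P B S e"
    by (rule Pi_definableE[OF assms(1)]) (rule that)
  show ?thesis
    by (rule Pi_definableI[OF \<phi>(1,2)]) (use \<phi>(3) assms(2) in simp)
qed

lemma Pi_definable_mono:
  assumes "Pi_definable \<alpha> V P" "\<alpha> \<le> \<beta>" "V \<subseteq> W"
  shows "Pi_definable \<beta> W P"
proof -
  obtain \<phi> where \<phi>: "Pi_in \<alpha> \<phi>" "fv \<phi> \<subseteq> V"
    "\<And>B S e. linearly_ordered B S \<Longrightarrow> range e \<subseteq> B \<Longrightarrow> sat B S \<phi> e \<longleftrightarrow> P B S e"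
    by (rule Pi_definableE[OF assms(1)]) (rule that)
  consider (equal) "\<alpha> = \<beta>" | (zero) "\<alpha> = 0" "\<alpha> < \<beta>" | (pos) "0 < \<alpha>"
    using assms(2) omega1_neq_zero_iff by fastforce
  then obtain \<psi> where "Pi_in \<beta> \<psi>" "fv \<psi> = fv \<phi>" "\<And>(B :: 'a set) S e. sat B S \<psi> e \<longleftrightarrow> sat B S \<phi> e"
  proof cases
    case equal
    with \<phi>(1) show ?thesis by (intro that[of \<phi>]) auto
  next
    case zero
    then have "Sigma_in 0 \<phi>" using \<phi>(1) by (simp add: Pi_in_zero_iff Sigma_in_zero_iff)
    with zero show ?thesis by (intro that[of "trivial_conj \<phi>"]) (auto intro: Pi_in_trivial_conj)
  next
    case pos
    with \<phi>(1) assms(2) show ?thesis by (intro that[of \<phi>]) (auto intro: Pi_in_mono)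
  qed
  with \<phi>(2,3) assms(3) show ?thesis by (intro Pi_definableI[of _ \<psi>]) auto
qed

lemma Pi_definable_qf:
  assumes "finitary_qf \<phi>" "fv \<phi> \<subseteq> V"
  shows "Pi_definable \<alpha> V (\<lambda>B S e. sat B S \<phi> e)"
  by (rule Pi_definable_mono[of 0 V], rule Pi_definableI[OF Pi_zero]) (use assms in simp_all)

lemma Pi_definable_not_Exs:
  assumes "Pi_definable \<alpha> W P" "\<alpha> < \<beta>" "W \<subseteq> V \<union> set zs"
  shows "Pi_definable \<beta> V (\<lambda>B S e. \<not> (\<exists>e'. reassigns B zs e e' \<and> P B S e'))"
proof -
  obtain \<phi> where \<phi>: "Pi_in \<alpha> \<phi>" "fv \<phi> \<subseteq> W"
    "\<And>B S e. linearly_ordered B S \<Longrightarrow> range e \<subseteq> B \<Longrightarrow> sat B S \<phi> e \<longleftrightarrow> P B S e"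
    by (rule Pi_definableE[OF assms(1)]) (rule that)
  show ?thesis
  proof (rule Pi_definableI)
    show "Pi_in \<beta> (Conj (\<lambda>i. Alls zs (dual \<phi>)))"
      by (rule Pi_pos[where \<beta> = "\<lambda>_. \<alpha>"]) (use Sigma_in_dual[OF \<phi>(1)] assms(2) in simp)
    show "fv (Conj (\<lambda>i. Alls zs (dual \<phi>))) \<subseteq> V" using \<phi>(2) assms(3) by auto
    fix B S and e :: "nat \<Rightarrow> 'a" assume B: "linearly_ordered B S" "range e \<subseteq> B"
    have "sat B S \<phi> e' \<longleftrightarrow> P B S e'" if "reassigns B zs e e'" for e'
      by (rule \<phi>(3)[OF B(1) range_reassigns[OF that B(2)]])
    then show "sat B S (Conj (\<lambda>i. Alls zs (dual \<phi>))) e \<longleftrightarrow> \<not> (\<exists>e'. reassigns B zs e e' \<and> P B S e')"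
      by (auto simp: sat_Alls)
  qed
qed

lemma Pi_definable_not:
  assumes "Pi_definable \<alpha> V P" "\<alpha> < \<beta>"
  shows "Pi_definable \<beta> V (\<lambda>B S e. \<not> P B S e)"
  using Pi_definable_not_Exs[OF assms, of V "[]"] by simp

lemma Pi_definable_ball:
  assumes P: "\<And>k. k \<in> K \<Longrightarrow> Pi_definable \<alpha> V (P k)" and "0 < \<alpha>" "countable K"
  shows "Pi_definable \<alpha> V (\<lambda>B S e. \<forall>k\<in>K. P k B S e)"
proof (cases "K = {}")
  case True
  then show ?thesis using Pi_definable_qf[of "Neg Bot" V \<alpha>] by simp
next
  case False
  then have "\<forall>i. Pi_definable \<alpha> V (P (from_nat_into K i))"
    using P by (simp add: from_nat_into)
  then have "\<forall>i. \<exists>\<phi>. Pi_in \<alpha> \<phi> \<and> fv \<phi> \<subseteq> V \<and>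
     (\<forall>B S e. linearly_ordered B S \<longrightarrow> range e \<subseteq> B \<longrightarrow> (sat B S \<phi> e \<longleftrightarrow> P (from_nat_into K i) B S e))"
    unfolding Pi_definable_def .
  from choice[OF this] obtain \<phi> where \<phi>: "\<And>i. Pi_in \<alpha> (\<phi> i)" "\<And>i. fv (\<phi> i) \<subseteq> V"
    "\<And>i B S e. linearly_ordered B S \<Longrightarrow> range e \<subseteq> B \<Longrightarrow> sat B S (\<phi> i) e \<longleftrightarrow> P (from_nat_into K i) B S e"
    by blast
  obtain \<chi> where \<chi>: "Pi_in \<alpha> \<chi>" "fv \<chi> = (\<Union>i. fv (\<phi> i))"
    "\<And>(B :: 'b set) S e. sat B S \<chi> e \<longleftrightarrow> (\<forall>i. sat B S (\<phi> i) e)"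
    by (rule Pi_in_countable_conj[OF \<phi>(1) assms(2)]) (rule that)
  have all_K: "(\<forall>i. Q (from_nat_into K i)) \<longleftrightarrow> (\<forall>k\<in>K. Q k)" for Q
    using False assms(3) by (metis from_nat_into from_nat_into_to_nat_on)
  show ?thesis
  proof (rule Pi_definableI[OF \<chi>(1)])
    show "fv \<chi> \<subseteq> V" using \<phi>(2) by (auto simp: \<chi>(2))
    show "sat B S \<chi> e \<longleftrightarrow> (\<forall>k\<in>K. P k B S e)" if "linearly_ordered B S" "range e \<subseteq> B" for B S e
      using all_K[of "\<lambda>k. P k B S e"] by (simp add: \<chi>(3) \<phi>(3)[OF that])
  qed
qed

lemma Pi_definable_conj:
  assumes "Pi_definable \<alpha> V P" "Pi_definable \<alpha> V Q" "0 < \<alpha>"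
  shows "Pi_definable \<alpha> V (\<lambda>B S e. P B S e \<and> Q B S e)"
proof -
  have "Pi_definable \<alpha> V (\<lambda>B S e. \<forall>b\<in>UNIV. (if b then P else Q) B S e)"
    by (rule Pi_definable_ball) (use assms in auto)
  then show ?thesis by (rule Pi_definable_cong) (auto simp: all_bool_eq split: if_splits)
qed

lemma Pi_definable_All:
  assumes "Pi_definable \<alpha> W P" "0 < \<alpha>" "W \<subseteq> insert z V"
  shows "Pi_definable \<alpha> V (\<lambda>B S e. \<forall>a\<in>B. P B S (e(z := a)))"
proof -
  obtain \<phi> where \<phi>: "Pi_in \<alpha> \<phi>" "fv \<phi> \<subseteq> W"
    "\<And>B S e. linearly_ordered B S \<Longrightarrow> range e \<subseteq> B \<Longrightarrow> sat B S \<phi> e \<longleftrightarrow> P B S e"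
    by (rule Pi_definableE[OF assms(1)]) (rule that)
  obtain \<beta> \<Phi> xs where \<Phi>: "\<phi> = Conj (\<lambda>i. Alls (xs i) (\<Phi> i))" "\<And>i. \<beta> i < \<alpha>" "\<And>i. Sigma_in (\<beta> i) (\<Phi> i)"
    by (rule Pi_posE[OF \<phi>(1) assms(2)]) (rule that)
  let ?\<psi> = "Conj (\<lambda>i. Alls (z # xs i) (\<Phi> i))"
  show ?thesis
  proof (rule Pi_definableI)
    show "Pi_in \<alpha> ?\<psi>"
      by (rule Pi_pos[where \<beta> = \<beta>]) (simp add: \<Phi>)
    have "fv (Alls (xs i) (\<Phi> i)) \<subseteq> insert z V" for i
      using \<phi>(2) assms(3) unfolding \<Phi>(1) fv.simps by blast
    then show "fv ?\<psi> \<subseteq> V" unfolding fv.simps fv_Alls by force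
    fix B S and e :: "nat \<Rightarrow> 'a" assume B: "linearly_ordered B S" "range e \<subseteq> B"
    have "sat B S \<phi> (e(z := a)) \<longleftrightarrow> P B S (e(z := a))" if "a \<in> B" for a
      by (rule \<phi>(3)[OF B(1) range_fun_upd_subset[OF B(2) that]])
    moreover have "sat B S ?\<psi> e \<longleftrightarrow> (\<forall>a\<in>B. sat B S \<phi> (e(z := a)))"
      by (auto simp: \<Phi>(1) Alls_def)
    ultimately show "sat B S ?\<psi> e \<longleftrightarrow> (\<forall>a\<in>B. P B S (e(z := a)))" by simp
  qed
qed

lemma chain_iff_reassigns:
  "chain B P bs u v \<longleftrightarrow> (\<exists>e'. reassigns B [m..<Suc (m + length bs)] e e' \<and> e' m = u \<and> e' (m + length bs) = v \<and>
     (\<forall>i<length bs. P (bs ! i) (e' (m + i)) (e' (Suc (m + i)))))"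
  (is "_ \<longleftrightarrow> ?assignment")
proof
  assume "chain B P bs u v"
  then obtain w where w: "w 0 = u" "w (length bs) = v" "\<forall>i\<le>length bs. w i \<in> B"
    "\<forall>i<length bs. P (bs ! i) (w i) (w (Suc i))"
    by (auto simp: chain_def)
  let ?e = "\<lambda>v. if m \<le> v \<and> v \<le> m + length bs then w (v - m) else e v"
  have "?e (m + i) = w i" if "i \<le> length bs" for i using that by simp
  moreover from this[of "Suc i" for i] have "?e (Suc (m + i)) = w (Suc i)" if "i < length bs" for i
    using that by simp
  moreover have "reassigns B [m..<Suc (m + length bs)] e ?e"
    using w(3) by (auto simp: reassigns_def)
  ultimately show ?assignment
    using w by (intro exI[of _ ?e]) auto
next
  assume ?assignment
  then obtain e' where e': "reassigns B [m..<Suc (m + length bs)] e e'" "e' m = u" "e' (m + length bs) = v"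
    "\<forall>i<length bs. P (bs ! i) (e' (m + i)) (e' (Suc (m + i)))"
    by blast
  then show "chain B P bs u v"
    unfolding chain_def by (intro exI[of _ "\<lambda>i. e' (m + i)"]) (auto simp: reassigns_def)
qed

lemma Pi_definable_chain:
  fixes P :: "'a set \<Rightarrow> 'a rel \<Rightarrow> 'b \<Rightarrow> 'a \<Rightarrow> 'a \<Rightarrow> bool"
  assumes P: "\<And>b x y. b \<in> set bs \<Longrightarrow> Pi_definable \<alpha> {x, y} (\<lambda>B S e. P B S b (e x) (e y))" and "0 < \<alpha>"
  shows "Pi_definable (succ_ord (succ_ord \<alpha>)) {x, y} (\<lambda>B S e. chain B (P B S) bs (e x) (e y))"
proof -
  obtain m where m: "x < m" "y < m" using that[of "Suc (max x y)"] by simp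
  let ?L = "length bs"
  let ?zs = "[m..<Suc (m + ?L)]"
  let ?Q = "\<lambda>B S e. (\<forall>i\<in>{..<?L}. P B S (bs ! i) (e (m + i)) (e (Suc (m + i)))) \<and>
    sat B S (And (Eq m x) (Eq (m + ?L) y)) e"
  have "Pi_definable \<alpha> ({x, y} \<union> set ?zs) ?Q"
  proof (intro Pi_definable_conj Pi_definable_ball Pi_definable_qf assms(2))
    fix i assume "i \<in> {..<?L}"
    then show "Pi_definable \<alpha> ({x, y} \<union> set ?zs) (\<lambda>B S e. P B S (bs ! i) (e (m + i)) (e (Suc (m + i))))"
      by (intro Pi_definable_mono[OF P]) auto
  qed auto
  then have "Pi_definable (succ_ord \<alpha>) {x, y} (\<lambda>B S e. \<not> (\<exists>e'. reassigns B ?zs e e' \<and> ?Q B S e'))"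
    by (rule Pi_definable_not_Exs) auto
  from Pi_definable_not[OF this less_succ_ord]
  have "Pi_definable (succ_ord (succ_ord \<alpha>)) {x, y} (\<lambda>B S e. \<exists>e'. reassigns B ?zs e e' \<and> ?Q B S e')"
    by (simp only: not_not)
  then show ?thesis
  proof (rule Pi_definable_cong)
    fix B S and e :: "nat \<Rightarrow> 'a"
    have "x \<notin> set ?zs" "y \<notin> set ?zs" using m by simp_all
    then have "e' x = e x" "e' y = e y" if "reassigns B ?zs e e'" for e'
      using that unfolding reassigns_def by blast+
    then show "(\<exists>e'. reassigns B ?zs e e' \<and> ?Q B S e') \<longleftrightarrow> chain B (P B S) bs (e x) (e y)"
      unfolding chain_iff_reassigns[of _ _ _ _ _ m e] by auto
  qed
qed

text \<open>A countable conjunction of formulas raises the complexity only if the complexities of the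
  conjuncts are uniformly bounded, so definability is tracked for families. Predicates of \<open>n\<close> arguments
  take the list of their arguments, so that quantification becomes consing.\<close>

definition uniformly_definable ::
  "omega1 \<Rightarrow> 'k set \<Rightarrow> nat \<Rightarrow> ('k \<Rightarrow> 'a set \<Rightarrow> 'a rel \<Rightarrow> 'a list \<Rightarrow> bool) \<Rightarrow> bool" where
  "uniformly_definable \<alpha> K n P \<longleftrightarrow> (\<exists>m. \<forall>k\<in>K. \<forall>vs. length vs = n \<longrightarrow>
     Pi_definable ((succ_ord ^^ m) \<alpha>) (set vs) (\<lambda>B S e. P k B S (map e vs)))"

lemma uniformly_definableI:
  "(\<And>k vs. k \<in> K \<Longrightarrow> length vs = n \<Longrightarrow>
      Pi_definable ((succ_ord ^^ m) \<alpha>) (set vs) (\<lambda>B S e. P k B S (map e vs))) \<Longrightarrow>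
    uniformly_definable \<alpha> K n P"
  unfolding uniformly_definable_def by blast

lemma uniformly_definableE:
  assumes "uniformly_definable \<alpha> K n P"
  obtains m where "\<And>m' k vs. m \<le> m' \<Longrightarrow> k \<in> K \<Longrightarrow> length vs = n \<Longrightarrow>
    Pi_definable ((succ_ord ^^ m') \<alpha>) (set vs) (\<lambda>B S e. P k B S (map e vs))"
proof -
  obtain m where m: "\<And>k vs. k \<in> K \<Longrightarrow> length vs = n \<Longrightarrow>
      Pi_definable ((succ_ord ^^ m) \<alpha>) (set vs) (\<lambda>B S e. P k B S (map e vs))"
    using assms unfolding uniformly_definable_def by blast
  show ?thesis
    by (rule that[of m], rule Pi_definable_mono[OF m]) (simp_all add: funpow_succ_mono)
qed

lemma uniformly_definable_cong:
  assumes "uniformly_definable \<alpha> K n P"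
    and "\<And>k B S xs. k \<in> K \<Longrightarrow> linearly_ordered B S \<Longrightarrow> set xs \<subseteq> B \<Longrightarrow> length xs = n \<Longrightarrow> P k B S xs \<longleftrightarrow> Q k B S xs"
  shows "uniformly_definable \<alpha> K n Q"
proof -
  obtain m where m: "\<And>m' k vs. m \<le> m' \<Longrightarrow> k \<in> K \<Longrightarrow> length vs = n \<Longrightarrow>
      Pi_definable ((succ_ord ^^ m') \<alpha>) (set vs) (\<lambda>B S e. P k B S (map e vs))"
    by (rule uniformly_definableE[OF assms(1)]) (rule that)
  show ?thesis
  proof (rule uniformly_definableI[of _ _ m])
    fix k and vs :: "nat list" assume k: "k \<in> K" and vs: "length vs = n"
    show "Pi_definable ((succ_ord ^^ m) \<alpha>) (set vs) (\<lambda>B S e. Q k B S (map e vs))"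
      by (rule Pi_definable_cong[OF m[OF order_refl k vs]], rule assms(2)) (use k vs in auto)
  qed
qed

lemma uniformly_definable_Un:
  assumes "uniformly_definable \<alpha> K n P" "uniformly_definable \<alpha> K' n P"
  shows "uniformly_definable \<alpha> (K \<union> K') n P"
proof -
  obtain m where m: "\<And>m' k vs. m \<le> m' \<Longrightarrow> k \<in> K \<Longrightarrow> length vs = n \<Longrightarrow>
      Pi_definable ((succ_ord ^^ m') \<alpha>) (set vs) (\<lambda>B S e. P k B S (map e vs))"
    by (rule uniformly_definableE[OF assms(1)]) (rule that)
  obtain l where l: "\<And>m' k vs. l \<le> m' \<Longrightarrow> k \<in> K' \<Longrightarrow> length vs = n \<Longrightarrow>
      Pi_definable ((succ_ord ^^ m') \<alpha>) (set vs) (\<lambda>B S e. P k B S (map e vs))"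
    by (rule uniformly_definableE[OF assms(2)]) (rule that)
  show ?thesis
    by (rule uniformly_definableI[of _ _ "max m l"]) (use m l in auto)
qed

lemma uniformly_definable_mono:
  assumes "uniformly_definable \<alpha> K n P" "\<alpha> \<le> \<beta>"
  shows "uniformly_definable \<beta> K n P"
proof -
  obtain m where m: "\<And>m' k vs. m \<le> m' \<Longrightarrow> k \<in> K \<Longrightarrow> length vs = n \<Longrightarrow>
      Pi_definable ((succ_ord ^^ m') \<alpha>) (set vs) (\<lambda>B S e. P k B S (map e vs))"
    by (rule uniformly_definableE[OF assms(1)]) (rule that)
  show ?thesis
    by (rule uniformly_definableI[of _ _ m], rule Pi_definable_mono[OF m[OF order_refl]])
      (use funpow_succ_mono[OF order_refl assms(2)] in auto)
qed

lemma uniformly_definable_below_limit: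
  assumes "uniformly_definable \<alpha> K n P" "limit_ord l" "\<alpha> < l" "k \<in> K" "length vs = n"
  obtains \<beta> where "\<beta> < l" "Pi_definable \<beta> (set vs) (\<lambda>B S e. P k B S (map e vs))"
proof -
  obtain m where "Pi_definable ((succ_ord ^^ m) \<alpha>) (set vs) (\<lambda>B S e. P k B S (map e vs))"
    using assms(1,4,5) unfolding uniformly_definable_def by blast
  then show ?thesis using limit_ord_funpow_succ[OF assms(2,3)] that by blast
qed

definition coordinate :: "nat \<Rightarrow> ('a list \<Rightarrow> 'a) \<Rightarrow> bool" where
  "coordinate n f \<longleftrightarrow> (\<exists>i<n. \<forall>xs. length xs = n \<longrightarrow> f xs = xs ! i)"

lemma coordinate_nth: "i < n \<Longrightarrow> coordinate n (\<lambda>xs. xs ! i)"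
  by (auto simp: coordinate_def)

lemma coordinate_hd: "coordinate (Suc n) hd"
  unfolding coordinate_def by (rule exI[of _ 0]) (auto simp: length_Suc_conv)

lemma coordinate_tl: "coordinate n f \<Longrightarrow> coordinate (Suc n) (\<lambda>xs. f (tl xs))"
  unfolding coordinate_def by (metis Suc_less_eq diff_Suc_1 length_tl nth_tl)

lemma uniformly_definable_subst2:
  assumes P: "uniformly_definable \<alpha> L 2 (\<lambda>l B S xs. P l B S (xs ! 0) (xs ! 1))"
    and g: "\<And>k. k \<in> K \<Longrightarrow> g k \<in> L" and f: "coordinate n f" "coordinate n f'"
  shows "uniformly_definable \<alpha> K n (\<lambda>k B S xs. P (g k) B S (f xs) (f' xs))"
proof -
  obtain i j where ij: "i < n" "j < n" "\<And>xs. length xs = n \<Longrightarrow> f xs = xs ! i" "\<And>xs. length xs = n \<Longrightarrow> f' xs = xs ! j"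
    using f unfolding coordinate_def by blast
  obtain m where m: "\<And>m' l vs. m \<le> m' \<Longrightarrow> l \<in> L \<Longrightarrow> length vs = 2 \<Longrightarrow>
      Pi_definable ((succ_ord ^^ m') \<alpha>) (set vs) (\<lambda>B S e. P l B S (map e vs ! 0) (map e vs ! 1))"
    by (rule uniformly_definableE[OF P]) (rule that)
  show ?thesis
  proof (rule uniformly_definableI[of _ _ m])
    fix k and vs :: "nat list" assume k: "k \<in> K" and vs: "length vs = n"
    have "Pi_definable ((succ_ord ^^ m) \<alpha>) {vs ! i, vs ! j} (\<lambda>B S e. P (g k) B S (e (vs ! i)) (e (vs ! j)))"
      using m[OF order_refl g[OF k], of "[vs ! i, vs ! j]"] by simp
    then show "Pi_definable ((succ_ord ^^ m) \<alpha>) (set vs) (\<lambda>B S e. P (g k) B S (f (map e vs)) (f' (map e vs)))"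
      using ij vs by (simp add: Pi_definable_mono)
  qed
qed

lemma uniformly_definable_le:
  fixes f f' :: "'a list \<Rightarrow> 'a"
  assumes "coordinate n f" "coordinate n f'"
  shows "uniformly_definable \<alpha> K n (\<lambda>k B S xs. (f xs, f' xs) \<in> S)"
proof -
  have "Pi_definable \<alpha> {x, y} (\<lambda>B S (e :: nat \<Rightarrow> 'a). (e x, e y) \<in> S)" for x y
    using Pi_definable_qf[of "Le x y" "{x, y}" \<alpha>] by simp
  then have "uniformly_definable \<alpha> UNIV 2 (\<lambda>_ :: unit. \<lambda>B S xs. (xs ! 0, xs ! 1 :: 'a) \<in> S)"
    by (intro uniformly_definableI[of _ _ 0]) (auto simp: numeral_2_eq_2 length_Suc_conv)
  from uniformly_definable_subst2[OF this _ assms, of K "\<lambda>_. ()"] show ?thesis by simp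
qed

lemma uniformly_definable_eq:
  fixes f f' :: "'a list \<Rightarrow> 'a"
  assumes "coordinate n f" "coordinate n f'"
  shows "uniformly_definable \<alpha> K n (\<lambda>k B S xs. f xs = f' xs)"
proof -
  have "Pi_definable \<alpha> {x, y} (\<lambda>B S (e :: nat \<Rightarrow> 'a). e x = e y)" for x y
    using Pi_definable_qf[of "Eq x y" "{x, y}" \<alpha>] by simp
  then have "uniformly_definable \<alpha> UNIV 2 (\<lambda>_ :: unit. \<lambda>B S xs. xs ! 0 = (xs ! 1 :: 'a))"
    by (intro uniformly_definableI[of _ _ 0]) (auto simp: numeral_2_eq_2 length_Suc_conv)
  from uniformly_definable_subst2[OF this _ assms, of K "\<lambda>_. ()"] show ?thesis by simp
qed

lemma uniformly_definable_not:
  assumes "uniformly_definable \<alpha> K n P"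
  shows "uniformly_definable \<alpha> K n (\<lambda>k B S xs. \<not> P k B S xs)"
proof -
  obtain m where m: "\<And>m' k vs. m \<le> m' \<Longrightarrow> k \<in> K \<Longrightarrow> length vs = n \<Longrightarrow>
      Pi_definable ((succ_ord ^^ m') \<alpha>) (set vs) (\<lambda>B S e. P k B S (map e vs))"
    by (rule uniformly_definableE[OF assms]) (rule that)
  show ?thesis
    by (rule uniformly_definableI[of _ _ "Suc m"], rule Pi_definable_not[OF m[OF order_refl]]) auto
qed

lemma uniformly_definable_conj:
  assumes "uniformly_definable \<alpha> K n P" "uniformly_definable \<alpha> K n Q"
  shows "uniformly_definable \<alpha> K n (\<lambda>k B S xs. P k B S xs \<and> Q k B S xs)"
proof -
  obtain m where m: "\<And>m' k vs. m \<le> m' \<Longrightarrow> k \<in> K \<Longrightarrow> length vs = n \<Longrightarrow>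
      Pi_definable ((succ_ord ^^ m') \<alpha>) (set vs) (\<lambda>B S e. P k B S (map e vs))"
    by (rule uniformly_definableE[OF assms(1)]) (rule that)
  obtain l where l: "\<And>m' k vs. l \<le> m' \<Longrightarrow> k \<in> K \<Longrightarrow> length vs = n \<Longrightarrow>
      Pi_definable ((succ_ord ^^ m') \<alpha>) (set vs) (\<lambda>B S e. Q k B S (map e vs))"
    by (rule uniformly_definableE[OF assms(2)]) (rule that)
  show ?thesis
    by (rule uniformly_definableI[of _ _ "Suc (max m l)"], rule Pi_definable_conj[OF m l]) auto
qed

lemma uniformly_definable_imp:
  assumes "uniformly_definable \<alpha> K n P" "uniformly_definable \<alpha> K n Q"
  shows "uniformly_definable \<alpha> K n (\<lambda>k B S xs. P k B S xs \<longrightarrow> Q k B S xs)"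
  using uniformly_definable_not[OF uniformly_definable_conj[OF assms(1) uniformly_definable_not[OF assms(2)]]] by simp

lemma uniformly_definable_all:
  assumes "uniformly_definable \<alpha> K (Suc n) (\<lambda>k B S xs. P k B S (hd xs) (tl xs))"
  shows "uniformly_definable \<alpha> K n (\<lambda>k B S xs. \<forall>a\<in>B. P k B S a xs)"
proof -
  obtain m where m: "\<And>m' k vs. m \<le> m' \<Longrightarrow> k \<in> K \<Longrightarrow> length vs = Suc n \<Longrightarrow>
      Pi_definable ((succ_ord ^^ m') \<alpha>) (set vs) (\<lambda>B S e. P k B S (hd (map e vs)) (tl (map e vs)))"
    by (rule uniformly_definableE[OF assms]) (rule that)
  show ?thesis
  proof (rule uniformly_definableI[of _ _ "Suc m"])
    fix k and vs :: "nat list" assume k: "k \<in> K" and vs: "length vs = n"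
    define z where "z = Suc (sum_list vs)"
    have fresh: "z \<notin> set vs"
      unfolding z_def using member_le_sum_list[of "Suc (sum_list vs)" vs] by auto
    have "Pi_definable ((succ_ord ^^ Suc m) \<alpha>) (insert z (set vs)) (\<lambda>B S e. P k B S (e z) (map e vs))"
      using m[of "Suc m" k "z # vs"] k vs by simp
    from Pi_definable_All[OF this, of z "set vs"]
    show "Pi_definable ((succ_ord ^^ Suc m) \<alpha>) (set vs) (\<lambda>B S e. \<forall>a\<in>B. P k B S a (map e vs))"
      using fresh by (simp add: map_fun_upd)
  qed
qed

lemma uniformly_definable_ex:
  assumes "uniformly_definable \<alpha> K (Suc n) (\<lambda>k B S xs. P k B S (hd xs) (tl xs))"
  shows "uniformly_definable \<alpha> K n (\<lambda>k B S xs. \<exists>a\<in>B. P k B S a xs)"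
  using uniformly_definable_not[OF uniformly_definable_all[OF uniformly_definable_not[OF assms]]] by simp

lemma uniformly_definable_ball:
  assumes "uniformly_definable \<alpha> (Sigma K J) n (\<lambda>kj. P (fst kj) (snd kj))" "\<And>k. k \<in> K \<Longrightarrow> countable (J k)"
  shows "uniformly_definable \<alpha> K n (\<lambda>k B S xs. \<forall>j\<in>J k. P k j B S xs)"
proof -
  obtain m where m: "\<And>m' kj vs. m \<le> m' \<Longrightarrow> kj \<in> Sigma K J \<Longrightarrow> length vs = n \<Longrightarrow>
      Pi_definable ((succ_ord ^^ m') \<alpha>) (set vs) (\<lambda>B S e. P (fst kj) (snd kj) B S (map e vs))"
    by (rule uniformly_definableE[OF assms(1)]) (rule that)
  have "Pi_definable ((succ_ord ^^ Suc m) \<alpha>) (set vs) (\<lambda>B S e. P k j B S (map e vs))"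
    if "k \<in> K" "j \<in> J k" "length vs = n" for k j vs
    using m[of "Suc m" "(k, j)"] that by simp
  then show ?thesis
    by (intro uniformly_definableI[of _ _ "Suc m"] Pi_definable_ball assms(2)) auto
qed

lemma uniformly_definable_bex:
  assumes "uniformly_definable \<alpha> (Sigma K J) n (\<lambda>kj. P (fst kj) (snd kj))" "\<And>k. k \<in> K \<Longrightarrow> countable (J k)"
  shows "uniformly_definable \<alpha> K n (\<lambda>k B S xs. \<exists>j\<in>J k. P k j B S xs)"
  using uniformly_definable_not[OF uniformly_definable_ball[OF uniformly_definable_not[OF assms(1)] assms(2)]] by simp

lemmas definable_intros =
  uniformly_definable_le uniformly_definable_eq uniformly_definable_not uniformly_definable_conj
  uniformly_definable_imp uniformly_definable_all uniformly_definable_ex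
  uniformly_definable_ball uniformly_definable_bex coordinate_nth coordinate_hd coordinate_tl

lemma uniformly_definable_dense_unbounded:
  assumes P: "\<And>m g g'. coordinate m g \<Longrightarrow> coordinate m g' \<Longrightarrow>
      uniformly_definable \<alpha> K m (\<lambda>k B S xs. P k B S (g xs) (g' xs))"
    and Q: "\<And>m g. coordinate m g \<Longrightarrow> uniformly_definable \<alpha> K m (\<lambda>k B S xs. Q k B S (g xs))"
    and f: "coordinate n f"
  shows "uniformly_definable \<alpha> K n (\<lambda>k B S xs. dense_unbounded (Q k B S) {z \<in> B. P k B S z (f xs)} S)"
proof -
  have "uniformly_definable \<alpha> K n (\<lambda>k B S xs. (\<exists>z\<in>B. P k B S z (f xs) \<and> Q k B S z) \<and>
     (\<forall>x\<in>B. P k B S x (f xs) \<longrightarrow> (\<exists>z\<in>B. P k B S z (f xs) \<and> Q k B S z \<and> less_in S z x) \<and>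
        (\<exists>z\<in>B. P k B S z (f xs) \<and> Q k B S z \<and> less_in S x z)) \<and>
     (\<forall>x\<in>B. P k B S x (f xs) \<longrightarrow> (\<forall>y\<in>B. P k B S y (f xs) \<longrightarrow> less_in S x y \<longrightarrow>
        (\<exists>z\<in>B. P k B S z (f xs) \<and> Q k B S z \<and> less_in S x z \<and> less_in S z y))))"
    by (intro P Q definable_intros f)
  then show ?thesis
    by (rule uniformly_definable_cong) (unfold dense_unbounded_def, blast)
qed


section \<open>Definability of order types\<close>

lemma countable_less_singleton_mset: "countable {..<{#\<alpha> :: omega1#}}"
proof (rule countable_subset)
  show "{..<{#\<alpha>#}} \<subseteq> mset ` lists {..<\<alpha>}"
  proof
    fix w assume "w \<in> {..<{#\<alpha>#}}"
    then have "\<forall>b\<in>#w. b < \<alpha>" by (simp add: mset_lt_single_right_iff)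
    moreover obtain xs where "w = mset xs" by (metis ex_mset)
    ultimately show "w \<in> mset ` lists {..<\<alpha>}" by auto
  qed
  show "countable (mset ` lists {..<\<alpha>})"
    by (intro countable_image countable_lists countable_below)
qed

lemma uniformly_definable_at_distance_below:
  assumes "uniformly_definable \<alpha> {..<\<alpha>} 2 (\<lambda>\<gamma> B S (xs :: 'a list). at_distance B S {#\<gamma>#} (xs ! 0) (xs ! 1))"
  shows "uniformly_definable \<alpha> {..<{#\<alpha>#}} 2 (\<lambda>w B S (xs :: 'a list). at_distance B S w (xs ! 0) (xs ! 1))"
proof -
  obtain m where m: "\<And>m' \<gamma> vs. m \<le> m' \<Longrightarrow> \<gamma> \<in> {..<\<alpha>} \<Longrightarrow> length vs = 2 \<Longrightarrow> Pi_definable ((succ_ord ^^ m') \<alpha>) (set vs)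
      (\<lambda>B S (e :: nat \<Rightarrow> 'a). at_distance B S {#\<gamma>#} (map e vs ! 0) (map e vs ! 1))"
    by (rule uniformly_definableE[OF assms]) (rule that)
  show ?thesis
  proof (rule uniformly_definableI[of _ _ "Suc (Suc (Suc m))"])
    fix w :: "omega1 multiset" and vs :: "nat list"
    assume w: "w \<in> {..<{#\<alpha>#}}" and "length vs = 2"
    then obtain x y where vs: "vs = [x, y]" by (auto simp: numeral_2_eq_2 length_Suc_conv)
    let ?bs = "rev (sorted_list_of_multiset w)"
    have "Pi_definable (succ_ord (succ_ord ((succ_ord ^^ Suc m) \<alpha>))) {x, y}
        (\<lambda>B S (e :: nat \<Rightarrow> 'a). chain B (\<lambda>b. at_distance B S {#b#}) ?bs (e x) (e y))"
    proof (rule Pi_definable_chain)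
      fix b x y assume "b \<in> set ?bs"
      then have "b < \<alpha>" using w by (auto simp: mset_lt_single_right_iff)
      then show "Pi_definable ((succ_ord ^^ Suc m) \<alpha>) {x, y}
          (\<lambda>B S (e :: nat \<Rightarrow> 'a). at_distance B S {#b#} (e x) (e y))"
        using m[of "Suc m" b "[x, y]"] by simp
    qed simp
    then have "Pi_definable (succ_ord (succ_ord ((succ_ord ^^ Suc m) \<alpha>))) {x, y}
        (\<lambda>B S (e :: nat \<Rightarrow> 'a). at_distance B S w (e x) (e y))"
    proof (rule Pi_definable_cong)
      fix B S and e :: "nat \<Rightarrow> 'a" assume "linearly_ordered B S" "range e \<subseteq> B"
      then interpret linearly_ordered B S by blast
      have "sorted_wrt (\<ge>) ?bs" by (simp add: sorted_wrt_rev)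
      with \<open>range e \<subseteq> B\<close> show "chain B (\<lambda>b. at_distance B S {#b#}) ?bs (e x) (e y) \<longleftrightarrow> at_distance B S w (e x) (e y)"
        using at_distance_mset_iff_chain[of "e y" ?bs "e x"] by (auto simp: image_subset_iff)
    qed
    then show "Pi_definable ((succ_ord ^^ Suc (Suc (Suc m))) \<alpha>) (set vs)
        (\<lambda>B S (e :: nat \<Rightarrow> 'a). at_distance B S w (map e vs ! 0) (map e vs ! 1))"
      by (simp add: vs)
  qed
qed

lemma uniformly_definable_at_distance_step:
  assumes "uniformly_definable \<alpha> {..<\<alpha>} 2 (\<lambda>\<gamma> B S (xs :: 'a list). at_distance B S {#\<gamma>#} (xs ! 0) (xs ! 1))"
  shows "uniformly_definable \<alpha> {\<alpha>} 2 (\<lambda>\<gamma> B S (xs :: 'a list). at_distance B S {#\<gamma>#} (xs ! 0) (xs ! 1))"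
proof -
  note below = uniformly_definable_subst2[OF uniformly_definable_at_distance_below[OF assms]]
  have "uniformly_definable \<alpha> {\<alpha>} 2 (\<lambda>\<gamma> B S (xs :: 'a list). (xs ! 0, xs ! 1) \<in> S \<and>
      (\<forall>v\<in>B. (xs ! 0, v) \<in> S \<and> less_in S v (xs ! 1) \<longrightarrow> (\<exists>w\<in>{..<{#\<alpha>#}}. at_distance B S w (xs ! 0) v)) \<and>
      (\<forall>w\<in>{..<{#\<alpha>#}}. \<exists>v\<in>B. less_in S v (xs ! 1) \<and> at_distance B S w (xs ! 0) v))"
    by (intro definable_intros below countable_less_singleton_mset) auto
  then show ?thesis
  proof (rule uniformly_definable_cong)
    fix \<gamma> B S and xs :: "'a list"
    assume "\<gamma> \<in> {\<alpha>}" "linearly_ordered B S" "set xs \<subseteq> B" "length xs = 2"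
    moreover from this have "xs ! 0 \<in> B" "xs ! 1 \<in> B" by auto
    ultimately show "((xs ! 0, xs ! 1) \<in> S \<and>
      (\<forall>v\<in>B. (xs ! 0, v) \<in> S \<and> less_in S v (xs ! 1) \<longrightarrow> (\<exists>w\<in>{..<{#\<alpha>#}}. at_distance B S w (xs ! 0) v)) \<and>
      (\<forall>w\<in>{..<{#\<alpha>#}}. \<exists>v\<in>B. less_in S v (xs ! 1) \<and> at_distance B S w (xs ! 0) v)) \<longleftrightarrow>
      at_distance B S {#\<gamma>#} (xs ! 0) (xs ! 1)"
      using linearly_ordered.at_distance_iff[of B S "xs ! 0" "xs ! 1" "{#\<alpha>#}"] by simp
  qed
qed

lemma uniformly_definable_at_distance_singleton:
  "uniformly_definable \<alpha> {..\<alpha>} 2 (\<lambda>\<gamma> B S (xs :: 'a list). at_distance B S {#\<gamma>#} (xs ! 0) (xs ! 1))"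
  (is "uniformly_definable _ _ _ ?P")
proof (induction \<alpha> rule: less_induct)
  case (less \<alpha>)
  have below: "uniformly_definable \<alpha> {..<\<alpha>} 2 ?P"
  proof (cases \<alpha> rule: omega1_cases)
    case zero
    then show ?thesis by (auto simp: uniformly_definable_def)
  next
    case (succ \<beta>)
    then have "{..<\<alpha>} = {..\<beta>}" by (auto simp: less_succ_ord_iff)
    with succ show ?thesis using uniformly_definable_mono[OF less[of \<beta>], of \<alpha>] by (simp add: less_imp_le)
  next
    case limit
    show ?thesis
    proof (rule uniformly_definableI[of _ _ 0])
      fix \<gamma> and vs :: "nat list" assume "\<gamma> \<in> {..<\<alpha>}" "length vs = 2"
      then obtain \<beta> where "\<beta> < \<alpha>" "Pi_definable \<beta> (set vs) (\<lambda>B S (e :: nat \<Rightarrow> 'a). ?P \<gamma> B S (map e vs))"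
        using uniformly_definable_below_limit[OF less limit] by blast
      then show "Pi_definable ((succ_ord ^^ 0) \<alpha>) (set vs) (\<lambda>B S (e :: nat \<Rightarrow> 'a). ?P \<gamma> B S (map e vs))"
        by (auto intro: Pi_definable_mono)
    qed
  qed
  have "{..\<alpha>} = {..<\<alpha>} \<union> {\<alpha>}" by auto
  then show ?case
    using uniformly_definable_Un[OF below uniformly_definable_at_distance_step[OF below]] by simp
qed

lemma uniformly_definable_at_distance:
  "(\<And>k. k \<in> K \<Longrightarrow> g k \<le> \<alpha>) \<Longrightarrow> coordinate n f \<Longrightarrow> coordinate n f' \<Longrightarrow>
    uniformly_definable \<alpha> K n (\<lambda>k B S xs. at_distance B S {#g k#} (f xs) (f' xs))"
  by (rule uniformly_definable_subst2[OF uniformly_definable_at_distance_singleton]) simp_all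


section \<open>Canonical orders\<close>

text \<open>In a densely ordered sum of blocks \<open>\<omega>\<^bsup>\<gamma>\<^esup> + 1\<close>, the last elements of the blocks are exactly the
  elements without immediate successor.\<close>

definition no_successor :: "'a set \<Rightarrow> 'a rel \<Rightarrow> 'a \<Rightarrow> bool" where
  "no_successor B S x \<longleftrightarrow> \<not> (\<exists>y\<in>B. less_in S x y \<and> \<not> (\<exists>z\<in>B. less_in S x z \<and> less_in S z y))"

definition block_start :: "'a set \<Rightarrow> 'a rel \<Rightarrow> 'a \<Rightarrow> bool" where
  "block_start B S s \<longleftrightarrow> (\<forall>z\<in>B. less_in S z s \<longrightarrow> (\<exists>n\<in>B. no_successor B S n \<and> (z, n) \<in> S \<and> less_in S n s))"

definition is_block :: "omega1 \<Rightarrow> 'a set \<Rightarrow> 'a rel \<Rightarrow> 'a \<Rightarrow> 'a \<Rightarrow> bool" where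
  "is_block \<gamma> B S s e \<longleftrightarrow> block_start B S s \<and> no_successor B S e \<and>
     (\<forall>n\<in>B. (s, n) \<in> S \<and> less_in S n e \<longrightarrow> \<not> no_successor B S n) \<and> at_distance B S {#\<gamma>#} s e"

definition starts_block :: "omega1 \<Rightarrow> 'a set \<Rightarrow> 'a rel \<Rightarrow> 'a \<Rightarrow> bool" where
  "starts_block \<gamma> B S s \<longleftrightarrow> (\<exists>e\<in>B. is_block \<gamma> B S s e)"

definition in_block :: "omega1 \<Rightarrow> 'a set \<Rightarrow> 'a rel \<Rightarrow> 'a \<Rightarrow> bool" where
  "in_block \<gamma> B S x \<longleftrightarrow> (\<exists>s\<in>B. \<exists>e\<in>B. is_block \<gamma> B S s e \<and> (s, x) \<in> S \<and> (x, e) \<in> S)"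

text \<open>The blocks of the summand \<open>Q\<^sub>\<beta>\<close> are those after \<open>p\<close> whose final segment has exactly the labels up to \<open>\<beta>\<close>.\<close>

definition in_summand :: "omega1 \<Rightarrow> 'a set \<Rightarrow> 'a rel \<Rightarrow> 'a \<Rightarrow> 'a \<Rightarrow> bool" where
  "in_summand \<beta> B S p s \<longleftrightarrow> less_in S p s \<and> block_start B S s \<and> (\<exists>t\<in>B. (s, t) \<in> S \<and> starts_block \<beta> B S t) \<and>
     (\<forall>t\<in>B. (s, t) \<in> S \<and> block_start B S t \<longrightarrow> (\<exists>\<gamma>\<in>{..\<beta>}. starts_block \<gamma> B S t))"

definition canonical :: "omega1 \<Rightarrow> 'a set \<Rightarrow> 'a rel \<Rightarrow> 'a \<Rightarrow> bool" where
  "canonical l B S p \<longleftrightarrow> starts_block 0 B S p \<and> (\<forall>x\<in>B. \<exists>\<gamma>\<in>{..<l}. in_block \<gamma> B S x) \<and>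
     (\<forall>s\<in>B. \<exists>\<beta>\<in>{..<l}. less_in S p s \<and> block_start B S s \<longrightarrow> in_summand \<beta> B S p s) \<and>
     (\<forall>\<gamma>\<in>{..<l}. dense_unbounded (starts_block \<gamma> B S) {s \<in> B. block_start B S s \<and> less_in S s p} S) \<and>
     (\<forall>\<beta>\<in>{..<l}. \<forall>\<gamma>\<in>{..\<beta>}. dense_unbounded (starts_block \<gamma> B S) {s \<in> B. in_summand \<beta> B S p s} S)"

lemma uniformly_definable_no_successor:
  "coordinate n f \<Longrightarrow> uniformly_definable \<alpha> K n (\<lambda>k B S xs. no_successor B S (f xs))"
  unfolding no_successor_def by (intro definable_intros)

lemma uniformly_definable_block_start:
  "coordinate n f \<Longrightarrow> uniformly_definable \<alpha> K n (\<lambda>k B S xs. block_start B S (f xs))"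
  unfolding block_start_def by (intro definable_intros uniformly_definable_no_successor)

lemma uniformly_definable_is_block:
  assumes "\<And>k. k \<in> K \<Longrightarrow> g k \<le> \<alpha>" "coordinate n f" "coordinate n f'"
  shows "uniformly_definable \<alpha> K n (\<lambda>k B S xs. is_block (g k) B S (f xs) (f' xs))"
  unfolding is_block_def
  by (intro definable_intros uniformly_definable_no_successor uniformly_definable_block_start
      uniformly_definable_at_distance assms)

lemma uniformly_definable_starts_block:
  assumes "\<And>k. k \<in> K \<Longrightarrow> g k \<le> \<alpha>" "coordinate n f"
  shows "uniformly_definable \<alpha> K n (\<lambda>k B S xs. starts_block (g k) B S (f xs))"
  unfolding starts_block_def by (intro definable_intros uniformly_definable_is_block assms)

lemma uniformly_definable_in_block:
  assumes "\<And>k. k \<in> K \<Longrightarrow> g k \<le> \<alpha>" "coordinate n f"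
  shows "uniformly_definable \<alpha> K n (\<lambda>k B S xs. in_block (g k) B S (f xs))"
  unfolding in_block_def by (intro definable_intros uniformly_definable_is_block assms)

lemma uniformly_definable_in_summand:
  assumes "\<beta> \<le> \<alpha>" "coordinate n f" "coordinate n f'"
  shows "uniformly_definable \<alpha> K n (\<lambda>k B S xs. in_summand \<beta> B S (f xs) (f' xs))"
  unfolding in_summand_def
  by (intro definable_intros uniformly_definable_starts_block uniformly_definable_block_start
      countable_atMost_omega1 assms) (use assms(1) in auto)

lemma Pi_definable_limit:
  assumes "uniformly_definable \<alpha> {()} (length vs) (\<lambda>_. P)" "limit_ord l" "\<alpha> < l" "l \<le> \<beta>"
  shows "Pi_definable \<beta> (set vs) (\<lambda>B S e. P B S (map e vs))"
proof -
  obtain \<delta> where "\<delta> < l" "Pi_definable \<delta> (set vs) (\<lambda>B S e. P B S (map e vs))"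
    by (rule uniformly_definable_below_limit[OF assms(1-3)]) (simp, rule refl, rule that)
  then show ?thesis using assms(4) by (auto intro: Pi_definable_mono)
qed

lemma Pi_definable_all_bex:
  assumes "\<And>k. k \<in> K \<Longrightarrow> Pi_definable l {0, 1} (\<lambda>B S e. \<not> Q k B S (e 0) (e 1))" "countable K" "0 < l"
  shows "Pi_definable (succ_ord l) {0} (\<lambda>B S e. \<forall>a\<in>B. \<exists>k\<in>K. Q k B S (e 0) a)"
proof -
  have "Pi_definable l {0, 1} (\<lambda>B S e. \<forall>k\<in>K. \<not> Q k B S (e 0) (e 1))"
    by (intro Pi_definable_ball assms)
  from Pi_definable_not[OF this less_succ_ord]
  have "Pi_definable (succ_ord l) {0, 1} (\<lambda>B S e. \<exists>k\<in>K. Q k B S (e 0) (e 1))" by simp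
  from Pi_definable_All[OF this succ_ord_pos, of 1 "{0}"] show ?thesis by simp
qed

lemma Pi_definable_limit_unary:
  assumes "limit_ord l" "\<alpha> < l" "uniformly_definable \<alpha> {()} 1 (\<lambda>_ B S xs. P B S (xs ! 0))"
  shows "Pi_definable (succ_ord l) {0} (\<lambda>B S e. P B S (e 0))"
  using Pi_definable_limit[where vs = "[0]" and P = "\<lambda>B S xs. P B S (xs ! 0)",
      OF _ assms(1,2), of "succ_ord l"] assms(3)
  by (simp add: less_imp_le)

lemma Pi_definable_limit_binary:
  assumes "limit_ord l" "\<alpha> < l" "uniformly_definable \<alpha> {()} 2 (\<lambda>_ B S xs. P B S (xs ! 0) (xs ! 1))"
  shows "Pi_definable l {0, 1} (\<lambda>B S e. P B S (e 0) (e 1))"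
  using Pi_definable_limit[where vs = "[0, 1]" and P = "\<lambda>B S xs. P B S (xs ! 0) (xs ! 1)",
      OF _ assms(1,2) order_refl] assms(3)
  by (simp add: numeral_2_eq_2)

lemma uniformly_definable_dense_before:
  "coordinate n f \<Longrightarrow> uniformly_definable \<gamma> K n (\<lambda>k B S xs.
    dense_unbounded (starts_block \<gamma> B S) {s \<in> B. block_start B S s \<and> less_in S s (f xs)} S)"
  by (rule uniformly_definable_dense_unbounded[where P = "\<lambda>_ B S s p. block_start B S s \<and> less_in S s p"])
    (intro definable_intros uniformly_definable_block_start uniformly_definable_starts_block; simp)+

lemma uniformly_definable_dense_in_summand:
  "\<gamma> \<le> \<beta> \<Longrightarrow> coordinate n f \<Longrightarrow> uniformly_definable \<beta> K n (\<lambda>k B S xs.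
    dense_unbounded (starts_block \<gamma> B S) {s \<in> B. in_summand \<beta> B S (f xs) s} S)"
  by (rule uniformly_definable_dense_unbounded[where P = "\<lambda>_ B S s p. in_summand \<beta> B S p s"])
    (intro definable_intros uniformly_definable_in_summand uniformly_definable_starts_block; simp)+

lemma Pi_definable_canonical:
  assumes l: "limit_ord l"
  shows "Pi_definable (succ_ord l) {0} (\<lambda>B S (e :: nat \<Rightarrow> 'a). canonical l B S (e 0))"
  unfolding canonical_def
proof (intro Pi_definable_conj succ_ord_pos)
  let ?definable = "Pi_definable (succ_ord l) {0} :: ('a set \<Rightarrow> 'a rel \<Rightarrow> (nat \<Rightarrow> 'a) \<Rightarrow> bool) \<Rightarrow> bool"
  note unary = Pi_definable_limit_unary[OF l] and binary = Pi_definable_limit_binary[OF l]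
    and all_bex = Pi_definable_all_bex[OF _ countable_below limit_ord_pos[OF l]]
  show "?definable (\<lambda>B S e. starts_block 0 B S (e 0))"
    by (rule unary[OF limit_ord_pos[OF l]], intro uniformly_definable_starts_block coordinate_nth) auto
  show "?definable (\<lambda>B S e. \<forall>x\<in>B. \<exists>\<gamma>\<in>{..<l}. in_block \<gamma> B S x)"
    by (rule all_bex, rule binary, erule lessThan_iff[THEN iffD1])
      (intro definable_intros uniformly_definable_in_block, auto)
  show "?definable (\<lambda>B S e. \<forall>s\<in>B. \<exists>\<beta>\<in>{..<l}. less_in S (e 0) s \<and> block_start B S s \<longrightarrow> in_summand \<beta> B S (e 0) s)"
    by (rule all_bex, rule binary, erule lessThan_iff[THEN iffD1])
      (intro definable_intros uniformly_definable_block_start uniformly_definable_in_summand, auto)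
  show "?definable (\<lambda>B S e. \<forall>\<gamma>\<in>{..<l}.
      dense_unbounded (starts_block \<gamma> B S) {s \<in> B. block_start B S s \<and> less_in S s (e 0)} S)"
    by (rule Pi_definable_ball[OF unary succ_ord_pos countable_below], erule lessThan_iff[THEN iffD1])
      (intro uniformly_definable_dense_before coordinate_nth, simp)
  show "?definable (\<lambda>B S e. \<forall>\<beta>\<in>{..<l}. \<forall>\<gamma>\<in>{..\<beta>}.
      dense_unbounded (starts_block \<gamma> B S) {s \<in> B. in_summand \<beta> B S (e 0) s} S)"
    by (rule Pi_definable_ball[OF Pi_definable_ball[OF unary succ_ord_pos countable_atMost_omega1]
          succ_ord_pos countable_below], erule lessThan_iff[THEN iffD1])
      (intro uniformly_definable_dense_in_summand coordinate_nth, simp_all)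
qed


section \<open>Uniqueness of canonical orders\<close>

lemma canonicalD:
  assumes "canonical l B S p"
  shows "starts_block 0 B S p"
    and "x \<in> B \<Longrightarrow> \<exists>\<gamma><l. in_block \<gamma> B S x"
    and "s \<in> B \<Longrightarrow> less_in S p s \<Longrightarrow> block_start B S s \<Longrightarrow> \<exists>\<beta><l. in_summand \<beta> B S p s"
    and "\<gamma> < l \<Longrightarrow> dense_unbounded (starts_block \<gamma> B S) {s \<in> B. block_start B S s \<and> less_in S s p} S"
    and "\<beta> < l \<Longrightarrow> \<gamma> \<le> \<beta> \<Longrightarrow> dense_unbounded (starts_block \<gamma> B S) {s \<in> B. in_summand \<beta> B S p s} S"
  using assms by (auto simp: canonical_def)

context linearly_ordered
begin

lemma is_block_less: "is_block \<gamma> B S s e \<Longrightarrow> s \<in> B \<Longrightarrow> e \<in> B \<Longrightarrow> less_in S s e"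
  using at_distance_imp_less[of "{#\<gamma>#}" s e] by (simp add: is_block_def)

lemma is_block_end_le:
  assumes "is_block \<gamma> B S s e" "e \<in> B" "n \<in> B" "no_successor B S n" "(s, n) \<in> S"
  shows "(e, n) \<in> S"
  using assms not_less[of n e] unfolding is_block_def by blast

lemma is_block_unique:
  assumes e: "is_block \<gamma> B S s e" and e': "is_block \<gamma>' B S s e'" and B: "s \<in> B" "e \<in> B" "e' \<in> B"
  shows "e = e'" "\<gamma> = \<gamma>'"
proof -
  have "(e, e') \<in> S" "(e', e) \<in> S"
    using is_block_end_le[OF e B(2,3)] is_block_end_le[OF e' B(3,2)] e e'
      is_block_less[OF e B(1,2)] is_block_less[OF e' B(1,3)]
    by (simp_all add: is_block_def)
  then show "e = e'" using rel_antisym B(2,3) by blast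
  then show "\<gamma> = \<gamma>'"
    using at_distance_unique[of B S "{#\<gamma>#}" s e "{#\<gamma>'#}"] e e' by (simp add: is_block_def)
qed

lemma is_block_end_less_start:
  assumes "is_block \<gamma> B S s e" "e \<in> B" "t \<in> B" "block_start B S t" "s \<in> B" "less_in S s t"
  shows "less_in S e t"
proof -
  obtain n where n: "n \<in> B" "no_successor B S n" "(s, n) \<in> S" "less_in S n t"
    using assms(4-6) unfolding block_start_def by blast
  show ?thesis
    using le_less_trans[OF is_block_end_le[OF assms(1,2) n(1-3)] n(4)] assms(2,3) n(1) by blast
qed

lemma is_block_containing_unique:
  assumes block: "is_block \<gamma> B S s e" "is_block \<gamma>' B S s' e'" and B: "s \<in> B" "e \<in> B" "s' \<in> B" "e' \<in> B" "x \<in> B"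
    and x: "(s, x) \<in> S" "(x, e) \<in> S" "(s', x) \<in> S" "(x, e') \<in> S"
  shows "s = s'"
proof -
  have "\<not> less_in S t t'"
    if "is_block \<gamma> B S t u" "block_start B S t'" "t \<in> B" "u \<in> B" "t' \<in> B" "(x, u) \<in> S" "(t', x) \<in> S" for \<gamma> t u t'
  proof
    assume "less_in S t t'"
    then have "less_in S u t'" using is_block_end_less_start that by blast
    then have "less_in S x t'" using le_less_trans[OF that(6)] that(4,5) B(5) by blast
    then show False using rel_antisym that(5,7) B(5) by blast
  qed
  then have "\<not> less_in S s s'" "\<not> less_in S s' s"
    using block B x unfolding is_block_def by blast+
  then show ?thesis using less_cases[OF B(1,3)] by blast
qed

lemma starts_block_imp_block_start: "starts_block \<gamma> B S s \<Longrightarrow> block_start B S s"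
  by (auto simp: starts_block_def is_block_def)

lemma starts_block_unique: "starts_block \<gamma> B S s \<Longrightarrow> starts_block \<gamma>' B S s \<Longrightarrow> s \<in> B \<Longrightarrow> \<gamma> = \<gamma>'"
  unfolding starts_block_def using is_block_unique(2) by blast

lemma in_summand_antimono:
  assumes "in_summand \<beta> B S p s" "in_summand \<beta>' B S p t" "(s, t) \<in> S" "s \<in> B" "t \<in> B"
  shows "\<beta>' \<le> \<beta>"
proof -
  obtain u where u: "u \<in> B" "(t, u) \<in> S" "starts_block \<beta>' B S u"
    using assms(2) unfolding in_summand_def by blast
  then have "(s, u) \<in> S" "block_start B S u"
    using rel_trans[OF assms(3)] assms(4,5) starts_block_imp_block_start by blast+
  then obtain \<gamma> where "\<gamma> \<le> \<beta>" "starts_block \<gamma> B S u" using assms(1) u(1) unfolding in_summand_def by blast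
  then show ?thesis using starts_block_unique[OF u(3) _ u(1)] by blast
qed

lemma in_summand_unique: "in_summand \<beta> B S p s \<Longrightarrow> in_summand \<beta>' B S p s \<Longrightarrow> s \<in> B \<Longrightarrow> \<beta> = \<beta>'"
  using in_summand_antimono rel_refl by (meson order_antisym)

end

datatype piece = Before | Parameter | Summand omega1

fun piece_less :: "piece \<Rightarrow> piece \<Rightarrow> bool" where
  "piece_less Before q \<longleftrightarrow> q \<noteq> Before"
| "piece_less Parameter (Summand \<beta>) \<longleftrightarrow> True"
| "piece_less (Summand \<beta>) (Summand \<beta>') \<longleftrightarrow> \<beta>' < \<beta>"
| "piece_less _ _ \<longleftrightarrow> False"

lemma piece_less_linear: "q = q' \<or> piece_less q q' \<or> piece_less q' q"
  by (cases q; cases q') auto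

locale canonical_order = linearly_ordered B S for B :: "'a set" and S +
  fixes l :: omega1 and p :: 'a
  assumes countable: "countable B" and p_mem: "p \<in> B" and canonical: "canonical l B S p"
begin

definition starts :: "'a set" where
  "starts = {s \<in> B. block_start B S s}"

definition label :: "'a \<Rightarrow> omega1" where
  "label s = (THE \<gamma>. starts_block \<gamma> B S s)"

lemma starts_blockD: "starts_block \<gamma> B S s \<Longrightarrow> s \<in> B \<Longrightarrow> s \<in> starts \<and> label s = \<gamma>"
  unfolding starts_def label_def using starts_block_imp_block_start starts_block_unique by blast

lemma p_start: "p \<in> starts" "label p = 0"
  using starts_blockD[OF canonicalD(1)[OF canonical] p_mem] by blast+

lemma ex_block_containing:
  assumes "x \<in> B"
  obtains s e where "s \<in> starts" "e \<in> B" "label s < l" "is_block (label s) B S s e" "(s, x) \<in> S" "(x, e) \<in> S"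
proof -
  obtain \<gamma> s e where block: "\<gamma> < l" "s \<in> B" "e \<in> B" "is_block \<gamma> B S s e" "(s, x) \<in> S" "(x, e) \<in> S"
    using canonicalD(2)[OF canonical assms] unfolding in_block_def by blast
  then have "starts_block \<gamma> B S s" unfolding starts_block_def by blast
  from starts_blockD[OF this block(2)] show ?thesis using that[of s e] block by simp
qed

lemma ex_block_starting:
  assumes s: "s \<in> starts"
  shows "label s < l" "\<exists>e\<in>B. is_block (label s) B S s e"
proof -
  have B: "s \<in> B" "block_start B S s" using s by (auto simp: starts_def)
  obtain t e where t: "t \<in> starts" "e \<in> B" "label t < l" "is_block (label t) B S t e" "(t, s) \<in> S" "(s, e) \<in> S"
    by (rule ex_block_containing[OF B(1)]) (rule that)
  have "\<not> less_in S t s"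
  proof
    assume "less_in S t s"
    then have "less_in S e s" using is_block_end_less_start[OF t(4,2) B] t(1) by (simp add: starts_def)
    then show False using t(6) rel_antisym B(1) t(2) by blast
  qed
  then have "t = s" using t(5) by blast
  with t show "label s < l" "\<exists>e\<in>B. is_block (label s) B S s e" by auto
qed

definition block_end :: "'a \<Rightarrow> 'a" where
  "block_end s = (SOME e. e \<in> B \<and> is_block (label s) B S s e)"

lemma block_end:
  assumes "s \<in> starts"
  shows "block_end s \<in> B" "is_block (label s) B S s (block_end s)" "(s, block_end s) \<in> S"
proof -
  have "\<exists>e. e \<in> B \<and> is_block (label s) B S s e" using ex_block_starting(2)[OF assms] by blast
  from someI_ex[OF this]
  show "block_end s \<in> B" "is_block (label s) B S s (block_end s)" by (simp_all add: block_end_def)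
  then show "(s, block_end s) \<in> S" by (simp add: is_block_def at_distance_def)
qed

definition block_of :: "'a \<Rightarrow> 'a" where
  "block_of x = (THE s. s \<in> starts \<and> (s, x) \<in> S \<and> (x, block_end s) \<in> S)"

lemma block_of_eqI:
  assumes s: "s \<in> starts" and x: "x \<in> B" "(s, x) \<in> S" "(x, block_end s) \<in> S"
  shows "block_of x = s"
  unfolding block_of_def
proof (rule the_equality)
  fix t assume t: "t \<in> starts \<and> (t, x) \<in> S \<and> (x, block_end t) \<in> S"
  then have "t \<in> starts" by blast
  then have "t \<in> B" "s \<in> B" using s by (simp_all add: starts_def)
  then show "t = s"
    using is_block_containing_unique[OF block_end(2)[OF \<open>t \<in> starts\<close>] block_end(2)[OF s]]
      block_end(1)[OF \<open>t \<in> starts\<close>] block_end(1)[OF s] x t by blast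
qed (use s x in simp)

lemma block_of:
  assumes "x \<in> B"
  shows "block_of x \<in> starts" "(block_of x, x) \<in> S" "(x, block_end (block_of x)) \<in> S"
proof -
  obtain s e where s: "s \<in> starts" "e \<in> B" "is_block (label s) B S s e" "(s, x) \<in> S" "(x, e) \<in> S"
    by (rule ex_block_containing[OF assms]) (rule that)
  then have "s \<in> B" by (simp add: starts_def)
  then have "e = block_end s"
    using is_block_unique(1)[OF s(3) block_end(2)[OF s(1)]] s(2) block_end(1)[OF s(1)] by blast
  then have "block_of x = s" using block_of_eqI[OF s(1) assms s(4)] s(5) by simp
  with s \<open>e = block_end s\<close>
  show "block_of x \<in> starts" "(block_of x, x) \<in> S" "(x, block_end (block_of x)) \<in> S" by simp_all
qed

lemma block_isomorphic:
  assumes "s \<in> starts"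
  shows "isomorphic {x \<in> B. block_of x = s} S {..{#label s#}} le_rel"
proof -
  have "{x \<in> B. block_of x = s} = {x \<in> B. (s, x) \<in> S \<and> (x, block_end s) \<in> S}"
    using block_of block_of_eqI[OF assms] by blast
  moreover have "s \<in> B" using assms by (simp add: starts_def)
  ultimately show ?thesis
    using closed_interval_isomorphic[of s "block_end s" "{#label s#}"] block_end[OF assms]
    by (simp add: is_block_def at_distance_def)
qed

lemma le_iff_block_of_le:
  assumes "x \<in> B" "y \<in> B" "block_of x \<noteq> block_of y"
  shows "(x, y) \<in> S \<longleftrightarrow> (block_of x, block_of y) \<in> S"
proof -
  have less: "less_in S x y" if B: "x \<in> B" "y \<in> B" and xy: "less_in S (block_of x) (block_of y)" for x y
  proof -
    let ?e = "block_end (block_of x)"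
    have mem: "block_of x \<in> B" "block_of y \<in> B" "block_start B S (block_of y)"
      using block_of(1)[OF B(1)] block_of(1)[OF B(2)] by (simp_all add: starts_def)
    have e: "?e \<in> B" "is_block (label (block_of x)) B S (block_of x) ?e"
      using block_end block_of(1)[OF B(1)] by blast+
    have "less_in S ?e (block_of y)" by (rule is_block_end_less_start[OF e(2,1) mem(2,3,1) xy])
    then have "less_in S x (block_of y)" using le_less_trans[OF block_of(3)[OF B(1)]] B(1) e(1) mem(2) by blast
    then show ?thesis using less_le_trans[OF _ block_of(2)[OF B(2)]] B mem(2) by blast
  qed
  have "block_of x \<in> B" "block_of y \<in> B"
    using block_of(1)[OF assms(1)] block_of(1)[OF assms(2)] by (simp_all add: starts_def)
  then show ?thesis
    using less[OF assms(1,2)] less[OF assms(2,1)] assms rel_antisym rel_total by metis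
qed

definition piece_of :: "'a \<Rightarrow> piece" where
  "piece_of s = (if less_in S s p then Before else if s = p then Parameter
     else Summand (THE \<beta>. in_summand \<beta> B S p s))"

lemma piece_of_cases:
  assumes "s \<in> starts"
  obtains (before) "less_in S s p" "piece_of s = Before"
    | (parameter) "s = p" "piece_of s = Parameter"
    | (summand) \<beta> where "less_in S p s" "piece_of s = Summand \<beta>" "\<beta> < l" "in_summand \<beta> B S p s"
proof -
  have s: "s \<in> B" "block_start B S s" using assms by (auto simp: starts_def)
  show ?thesis
    using s(1) p_mem
  proof (cases rule: less_cases)
    case less
    then show ?thesis using before by (simp add: piece_of_def)
  next
    case equal
    then show ?thesis using parameter by (simp add: piece_of_def)
  next
    case greater
    then obtain \<beta> where \<beta>: "\<beta> < l" "in_summand \<beta> B S p s"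
      using canonicalD(3)[OF canonical s(1) _ s(2)] by blast
    then have "(THE \<beta>. in_summand \<beta> B S p s) = \<beta>" using in_summand_unique s(1) by blast
    moreover have "\<not> less_in S s p" using greater rel_antisym s(1) p_mem by blast
    ultimately have "piece_of s = Summand \<beta>" using greater by (auto simp: piece_of_def)
    with greater \<beta> show ?thesis by (intro summand)
  qed
qed

lemma piece_of_Before_iff: "s \<in> starts \<Longrightarrow> piece_of s = Before \<longleftrightarrow> less_in S s p"
  by (auto simp: piece_of_def)

lemma piece_of_Parameter_iff: "s \<in> starts \<Longrightarrow> piece_of s = Parameter \<longleftrightarrow> s = p"
  by (auto simp: piece_of_def)

lemma piece_of_Summand_iff:
  assumes "s \<in> starts"
  shows "piece_of s = Summand \<beta> \<longleftrightarrow> in_summand \<beta> B S p s"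
  using assms
proof (cases rule: piece_of_cases)
  case before
  then show ?thesis using rel_antisym[of s p] assms p_mem by (auto simp: in_summand_def starts_def)
next
  case parameter
  then show ?thesis by (simp add: in_summand_def)
next
  case (summand \<beta>')
  moreover have "s \<in> B" using assms by (simp add: starts_def)
  ultimately show ?thesis using in_summand_unique by auto
qed

lemma piece_of_mem: "s \<in> starts \<Longrightarrow> piece_of s \<in> {Before, Parameter} \<union> Summand ` {..<l}"
  by (cases rule: piece_of_cases) auto

lemma piece_less_imp_less:
  assumes s: "s \<in> starts" and t: "t \<in> starts" and less: "piece_less (piece_of s) (piece_of t)"
  shows "less_in S s t"
proof -
  have B: "s \<in> B" "t \<in> B" using s t by (auto simp: starts_def)
  show ?thesis
  proof (cases rule: piece_of_cases[OF s]; cases rule: piece_of_cases[OF t])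
    show ?thesis if "less_in S s p" "less_in S p t" using less_le_trans[of s p t] that B p_mem by blast
    show ?thesis
      if "piece_of s = Summand \<beta>" "in_summand \<beta> B S p s" "piece_of t = Summand \<beta>'" "in_summand \<beta>' B S p t"
      for \<beta> \<beta>'
    proof (rule ccontr)
      assume "\<not> less_in S s t"
      then have "(t, s) \<in> S" using not_less B by blast
      then have "\<beta> \<le> \<beta>'" by (rule in_summand_antimono[OF that(4,2) _ B(2,1)])
      then show False using less that(1,3) by simp
    qed
  qed (use less in simp_all)
qed

lemma le_iff_piece_less:
  assumes "s \<in> starts" "t \<in> starts" "piece_of s \<noteq> piece_of t"
  shows "(s, t) \<in> S \<longleftrightarrow> piece_less (piece_of s) (piece_of t)"
proof -
  have "s \<in> B" "t \<in> B" using assms by (auto simp: starts_def)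
  then show ?thesis
    using piece_less_imp_less[OF assms(1,2)] piece_less_imp_less[OF assms(2,1)]
      piece_less_linear assms(3) rel_antisym by metis
qed

lemma labelled_dense_Before: "labelled_dense {s \<in> starts. piece_of s = Before} S label {..<l}"
proof -
  have "{s \<in> starts. piece_of s = Before} = {s \<in> B. block_start B S s \<and> less_in S s p}"
    using piece_of_Before_iff by (auto simp: starts_def)
  moreover have "dense_unbounded (\<lambda>s. label s = \<gamma>) {s \<in> B. block_start B S s \<and> less_in S s p} S" if "\<gamma> < l" for \<gamma>
  proof (rule dense_unbounded_mono)
    show "dense_unbounded (starts_block \<gamma> B S) {s \<in> B. block_start B S s \<and> less_in S s p} S"
      using that by (rule canonicalD(4)[OF canonical])
  qed (use starts_blockD in blast)
  ultimately show ?thesis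
    unfolding labelled_dense_def using ex_block_starting(1) by (auto simp: starts_def)
qed

lemma labelled_dense_Summand:
  assumes "\<beta> < l"
  shows "labelled_dense {s \<in> starts. piece_of s = Summand \<beta>} S label {..\<beta>}"
proof -
  have "{s \<in> starts. piece_of s = Summand \<beta>} = {s \<in> B. in_summand \<beta> B S p s}"
    using piece_of_Summand_iff by (auto simp: starts_def in_summand_def)
  moreover have "dense_unbounded (\<lambda>s. label s = \<gamma>) {s \<in> B. in_summand \<beta> B S p s} S" if "\<gamma> \<le> \<beta>" for \<gamma>
  proof (rule dense_unbounded_mono)
    show "dense_unbounded (starts_block \<gamma> B S) {s \<in> B. in_summand \<beta> B S p s} S"
      using assms that by (rule canonicalD(5)[OF canonical])
  qed (use starts_blockD in blast)
  moreover have "label s \<le> \<beta>" if s: "s \<in> B" "in_summand \<beta> B S p s" for s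
  proof -
    obtain \<gamma> where "\<gamma> \<le> \<beta>" "starts_block \<gamma> B S s" using s rel_refl unfolding in_summand_def by blast
    then show ?thesis using starts_blockD s(1) by blast
  qed
  ultimately show ?thesis unfolding labelled_dense_def by auto
qed

end

locale two_canonical_orders =
  C: canonical_order B S l p + D: canonical_order B' S' l p'
  for B :: "'a set" and S and B' :: "'b set" and S' and l p p'
begin

lemma ex_piece_isomorphism:
  assumes "k \<in> {Before, Parameter} \<union> Summand ` {..<l}"
  obtains f where "rel_iso f {s \<in> C.starts. C.piece_of s = k} S {s \<in> D.starts. D.piece_of s = k} S'"
    "\<And>s. s \<in> {s \<in> C.starts. C.piece_of s = k} \<Longrightarrow> D.label (f s) = C.label s"
proof -
  let ?C = "{s \<in> C.starts. C.piece_of s = k}" and ?D = "{s \<in> D.starts. D.piece_of s = k}"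
  consider (dense) L where "labelled_dense ?C S C.label L" "labelled_dense ?D S' D.label L"
    | (parameter) "k = Parameter"
    using assms C.labelled_dense_Before D.labelled_dense_Before C.labelled_dense_Summand D.labelled_dense_Summand
    by blast
  then show ?thesis
  proof cases
    case (dense L)
    have sub: "?C \<subseteq> B" "?D \<subseteq> B'" by (auto simp: C.starts_def D.starts_def)
    show ?thesis
      by (rule labelled_cantor[OF linearly_ordered_subset[OF C.linearly_ordered_axioms sub(1)]
            countable_subset[OF sub(1) C.countable] dense(1)
            linearly_ordered_subset[OF D.linearly_ordered_axioms sub(2)]
            countable_subset[OF sub(2) D.countable] dense(2)]) (rule that)
  next
    case parameter
    then have "?C = {p}" "?D = {p'}"
      using C.p_start D.p_start C.piece_of_Parameter_iff D.piece_of_Parameter_iff by auto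
    moreover have "rel_iso (\<lambda>_. p') {p} S {p'} S'"
      using C.rel_refl[OF C.p_mem] D.rel_refl[OF D.p_mem] by (auto simp: rel_iso_def bij_betw_def)
    ultimately show ?thesis using that[of "\<lambda>_. p'"] C.p_start D.p_start by simp
  qed
qed

lemma block_unions_isomorphic:
  assumes f: "rel_iso f I S I' S'" and label: "\<And>s. s \<in> I \<Longrightarrow> D.label (f s) = C.label s"
    and I: "I \<subseteq> C.starts" "I' \<subseteq> D.starts"
  shows "isomorphic {x \<in> B. C.block_of x \<in> I} S {x \<in> B'. D.block_of x \<in> I'} S'"
proof (rule isomorphic_glue[where \<kappa> = "f \<circ> C.block_of" and \<kappa>' = D.block_of and K = I'])
  fix s' assume "s' \<in> I'"
  then obtain s where s: "s \<in> I" "f s = s'" using rel_iso_preimage[OF f] by blast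
  have "{x \<in> {x \<in> B. C.block_of x \<in> I}. (f \<circ> C.block_of) x = s'} = {x \<in> B. C.block_of x = s}"
    using s rel_iso_eq_iff[OF f] by auto
  moreover have "{x \<in> {x \<in> B'. D.block_of x \<in> I'}. D.block_of x = s'} = {x \<in> B'. D.block_of x = s'}"
    using \<open>s' \<in> I'\<close> by auto
  moreover have "isomorphic {x \<in> B. C.block_of x = s} S {x \<in> B'. D.block_of x = s'} S'"
  proof (rule isomorphic_trans[OF _ isomorphic_sym])
    show "isomorphic {x \<in> B. C.block_of x = s} S {..{#C.label s#}} le_rel"
      using C.block_isomorphic I(1) s(1) by blast
    show "isomorphic {x \<in> B'. D.block_of x = s'} S' {..{#C.label s#}} le_rel"
      using D.block_isomorphic[of s'] I(2) \<open>s' \<in> I'\<close> label[OF s(1)] s(2) by auto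
  qed
  ultimately show "isomorphic {x \<in> {x \<in> B. C.block_of x \<in> I}. (f \<circ> C.block_of) x = s'} S
      {x \<in> {x \<in> B'. D.block_of x \<in> I'}. D.block_of x = s'} S'"
    by (simp only:)
next
  fix x y x' y'
  assume "x \<in> {x \<in> B. C.block_of x \<in> I}" "y \<in> {x \<in> B. C.block_of x \<in> I}" "x' \<in> {x \<in> B'. D.block_of x \<in> I'}"
    "y' \<in> {x \<in> B'. D.block_of x \<in> I'}" "D.block_of x' = (f \<circ> C.block_of) x" "D.block_of y' = (f \<circ> C.block_of) y"
    "(f \<circ> C.block_of) x \<noteq> (f \<circ> C.block_of) y"
  moreover from this have "C.block_of x \<noteq> C.block_of y" "D.block_of x' \<noteq> D.block_of y'" by auto
  ultimately show "(x, y) \<in> S \<longleftrightarrow> (x', y') \<in> S'"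
    using C.le_iff_block_of_le[of x y] D.le_iff_block_of_le[of x' y']
      rel_iso_le_iff[OF f, of "C.block_of x" "C.block_of y"] by auto
qed (use rel_iso_mem[OF f] in auto)

theorem isomorphic: "isomorphic B S B' S'"
proof (rule isomorphic_glue[where \<kappa> = "C.piece_of \<circ> C.block_of" and \<kappa>' = "D.piece_of \<circ> D.block_of"
      and K = "{Before, Parameter} \<union> Summand ` {..<l}"])
  show "(C.piece_of \<circ> C.block_of) ` B \<subseteq> {Before, Parameter} \<union> Summand ` {..<l}"
    "(D.piece_of \<circ> D.block_of) ` B' \<subseteq> {Before, Parameter} \<union> Summand ` {..<l}"
    using C.piece_of_mem C.block_of(1) D.piece_of_mem D.block_of(1) by auto
  fix k assume "k \<in> {Before, Parameter} \<union> Summand ` {..<l}"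
  then obtain f where f: "rel_iso f {s \<in> C.starts. C.piece_of s = k} S {s \<in> D.starts. D.piece_of s = k} S'"
    "\<And>s. s \<in> {s \<in> C.starts. C.piece_of s = k} \<Longrightarrow> D.label (f s) = C.label s"
    by (rule ex_piece_isomorphism) (rule that)
  have "isomorphic {x \<in> B. C.block_of x \<in> {s \<in> C.starts. C.piece_of s = k}} S
      {x \<in> B'. D.block_of x \<in> {s \<in> D.starts. D.piece_of s = k}} S'"
    by (rule block_unions_isomorphic[OF f]) auto
  moreover have "{x \<in> B. C.block_of x \<in> {s \<in> C.starts. C.piece_of s = k}} = {x \<in> B. (C.piece_of \<circ> C.block_of) x = k}"
    "{x \<in> B'. D.block_of x \<in> {s \<in> D.starts. D.piece_of s = k}} = {x \<in> B'. (D.piece_of \<circ> D.block_of) x = k}"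
    using C.block_of(1) D.block_of(1) by auto
  ultimately show "isomorphic {x \<in> B. (C.piece_of \<circ> C.block_of) x = k} S {x \<in> B'. (D.piece_of \<circ> D.block_of) x = k} S'"
    by simp
next
  fix x y x' y'
  assume "x \<in> B" "y \<in> B" "x' \<in> B'" "y' \<in> B'"
    "(D.piece_of \<circ> D.block_of) x' = (C.piece_of \<circ> C.block_of) x"
    "(D.piece_of \<circ> D.block_of) y' = (C.piece_of \<circ> C.block_of) y"
    "(C.piece_of \<circ> C.block_of) x \<noteq> (C.piece_of \<circ> C.block_of) y"
  moreover from this have "C.block_of x \<noteq> C.block_of y" "D.block_of x' \<noteq> D.block_of y'" by auto
  ultimately show "(x, y) \<in> S \<longleftrightarrow> (x', y') \<in> S'"
    using C.le_iff_block_of_le[of x y] D.le_iff_block_of_le[of x' y']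
      C.le_iff_piece_less[of "C.block_of x" "C.block_of y"]
      D.le_iff_piece_less[of "D.block_of x'" "D.block_of y'"] C.block_of(1) D.block_of(1) by auto
qed

end


section \<open>The two orders\<close>

lemma ex_irrational: "\<exists>x :: real. x \<notin> \<rat>"
proof -
  have "countable (\<rat> :: real set)"
    unfolding Rats_def by (rule countable_image) simp
  then show ?thesis using uncountable_UNIV_real by (metis UNIV_I subsetI countable_subset)
qed

type_synonym index = "omega1 \<times> real \<times> omega1"

abbreviation summand :: "index \<Rightarrow> omega1" where "summand i \<equiv> fst i"

abbreviation position :: "index \<Rightarrow> real" where "position i \<equiv> fst (snd i)"

abbreviation label_of :: "index \<Rightarrow> omega1" where "label_of i \<equiv> snd (snd i)"

text \<open>Blocks are indexed by the \<open>\<beta>\<close> of the summand \<open>Q\<^sub>\<beta>\<close> they belong to, a position within that summand,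
  and their label \<open>\<gamma>\<close>. Summands are arranged in decreasing order, and a block consists of the multisets
  \<open>w \<le> {#\<gamma>#}\<close>, which form a copy of \<open>\<omega>\<^bsup>\<gamma>\<^esup> + 1\<close>.\<close>

definition index_less :: "index \<Rightarrow> index \<Rightarrow> bool" where
  "index_less i j \<longleftrightarrow> summand j < summand i \<or> summand i = summand j \<and> position i < position j"

abbreviation index_le :: "index rel" where
  "index_le \<equiv> {(i, j). index_less i j \<or> i = j}"

type_synonym elem = "index \<times> omega1 multiset"

definition blocks :: "index set \<Rightarrow> elem set" where
  "blocks I = (SIGMA i:I. {..{#label_of i#}})"

definition blocks_le :: "index set \<Rightarrow> elem rel" where
  "blocks_le I = {(a, b). a \<in> blocks I \<and> b \<in> blocks I \<and>
     (index_less (fst a) (fst b) \<or> fst a = fst b \<and> snd a \<le> snd b)}"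

lemma mem_blocks [simp]: "(i, w) \<in> blocks I \<longleftrightarrow> i \<in> I \<and> w \<le> {#label_of i#}"
  by (simp add: blocks_def)

lemma index_less_irrefl [simp]: "\<not> index_less i i"
  by (simp add: index_less_def)

lemma index_less_trans: "index_less i j \<Longrightarrow> index_less j k \<Longrightarrow> index_less i k"
  by (auto simp: index_less_def)

lemma index_less_asym: "index_less i j \<Longrightarrow> \<not> index_less j i"
  by (auto simp: index_less_def)

lemma less_in_index_le: "less_in index_le i j \<longleftrightarrow> index_less i j"
  by auto

lemma mem_blocks_le: "((i, v), (j, w)) \<in> blocks_le I \<longleftrightarrow>
    (i, v) \<in> blocks I \<and> (j, w) \<in> blocks I \<and> (index_less i j \<or> i = j \<and> v \<le> w)"
  by (simp add: blocks_le_def)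

lemma less_in_blocks_le: "less_in (blocks_le I) (i, v) (j, w) \<longleftrightarrow>
    (i, v) \<in> blocks I \<and> (j, w) \<in> blocks I \<and> (index_less i j \<or> i = j \<and> v < w)"
  by (auto simp: blocks_le_def order_less_le)

locale limit_orders =
  fixes l :: omega1 and \<theta> :: real
  assumes limit: "limit_ord l" and irrational: "\<theta> \<notin> \<rat>"
begin

definition positions :: "omega1 \<Rightarrow> real set" where
  "positions \<gamma> = range (\<lambda>q :: rat. of_rat q + \<theta> * of_nat (to_nat_on {..<l} \<gamma>))"

lemma ex_position_between:
  assumes "a < b"
  shows "\<exists>x\<in>positions \<gamma>. a < x \<and> x < b"
proof -
  let ?c = "\<theta> * of_nat (to_nat_on {..<l} \<gamma>)"
  obtain q :: rat where "a - ?c < of_rat q" "of_rat q < b - ?c"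
    using of_rat_dense[of "a - ?c" "b - ?c"] assms by auto
  then show ?thesis unfolding positions_def by (intro bexI[of _ "of_rat q + ?c"]) auto
qed

lemma positions_disjoint:
  assumes "x \<in> positions \<gamma>" "x \<in> positions \<gamma>'" "\<gamma> < l" "\<gamma>' < l"
  shows "\<gamma> = \<gamma>'"
proof -
  let ?n = "\<lambda>\<gamma>. of_nat (to_nat_on {..<l} \<gamma>) :: real"
  obtain q q' :: rat where "x = of_rat q + \<theta> * ?n \<gamma>" "x = of_rat q' + \<theta> * ?n \<gamma>'"
    using assms(1,2) unfolding positions_def by blast
  then have eq: "\<theta> * (?n \<gamma> - ?n \<gamma>') = of_rat (q' - q)"
    by (simp add: algebra_simps of_rat_diff)
  have "?n \<gamma> = ?n \<gamma>'"
  proof (rule ccontr)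
    assume "?n \<gamma> \<noteq> ?n \<gamma>'"
    then have "\<theta> = of_rat (q' - q) / (?n \<gamma> - ?n \<gamma>')"
      using eq by (simp add: eq_divide_eq)
    also have "\<dots> \<in> \<rat>" by simp
    finally show False using irrational by blast
  qed
  then show ?thesis
    using inj_onD[OF inj_on_to_nat_on[OF countable_below]] assms(3,4) by simp
qed

lemma positions_shift:
  assumes "x \<in> positions \<gamma>"
  shows "x + of_int k \<in> positions \<gamma>"
proof -
  obtain q :: rat where "x = of_rat q + \<theta> * of_nat (to_nat_on {..<l} \<gamma>)"
    using assms unfolding positions_def by blast
  then have "x + of_int k = of_rat (q + of_int k) + \<theta> * of_nat (to_nat_on {..<l} \<gamma>)"
    by (simp add: of_rat_add)
  then show ?thesis unfolding positions_def by blast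
qed

definition indices :: "index set" where
  "indices = {i. summand i \<le> l \<and> label_of i < l \<and> label_of i \<le> summand i \<and> position i \<in> positions (label_of i)}"

definition cut :: index where
  "cut = (l, \<theta> * of_nat (to_nat_on {..<l} 0), 0)"

definition cut_indices :: "index set" where
  "cut_indices = {i \<in> indices. summand i = l \<longrightarrow> position i \<le> position cut}"

lemma summand_cut [simp]: "summand cut = l"
  by (simp add: cut_def)

lemma label_of_cut [simp]: "label_of cut = 0"
  by (simp add: cut_def)

lemma cut_mem: "cut \<in> indices" "cut \<in> cut_indices"
proof -
  have "position cut \<in> positions 0" unfolding positions_def cut_def by (rule range_eqI[of _ _ 0]) simp
  then show "cut \<in> indices" using limit_ord_pos[OF limit] by (simp add: indices_def cut_def)
  then show "cut \<in> cut_indices" by (simp add: cut_indices_def)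
qed

lemma cut_indices_subset: "cut_indices \<subseteq> indices"
  by (auto simp: cut_indices_def)

lemma ex_index_between:
  assumes "\<beta> \<le> l" "\<gamma> < l" "\<gamma> \<le> \<beta>" "a < b"
  obtains x where "a < x" "x < b" "(\<beta>, x, \<gamma>) \<in> indices"
  using ex_position_between[OF assms(4), of \<gamma>] assms(1-3) by (auto simp: indices_def)

lemma index_less_total: "i \<in> indices \<Longrightarrow> j \<in> indices \<Longrightarrow> i = j \<or> index_less i j \<or> index_less j i"
  using positions_disjoint[of "position i" "label_of i" "label_of j"]
  by (cases i, cases j) (auto simp: indices_def index_less_def)

lemma linearly_ordered_indices:
  assumes "I \<subseteq> indices"
  shows "linearly_ordered I index_le"
  unfolding linearly_ordered_iff
proof (intro ballI conjI impI)
  fix i j k assume ijk: "i \<in> I" "j \<in> I" "k \<in> I"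
  show "(i, i) \<in> index_le" by simp
  show "i = j" if "(i, j) \<in> index_le \<and> (j, i) \<in> index_le" using that index_less_asym[of i j] by auto
  show "(i, k) \<in> index_le" if "(i, j) \<in> index_le \<and> (j, k) \<in> index_le"
    using that index_less_trans[of i j k] by auto
  show "(i, j) \<in> index_le \<or> (j, i) \<in> index_le" using ijk assms index_less_total[of i j] by auto
qed

lemma countable_indices: "countable indices"
proof (rule countable_subset)
  show "indices \<subseteq> {..l} \<times> (\<Union>\<gamma>\<in>{..<l}. positions \<gamma>) \<times> {..<l}"
    by (force simp: indices_def)
  show "countable ({..l} \<times> (\<Union>\<gamma>\<in>{..<l}. positions \<gamma>) \<times> {..<l})"
    by (intro countable_SIGMA countable_UN countable_atMost_omega1 countable_below) (simp add: positions_def)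
qed

lemma countable_blocks:
  assumes "I \<subseteq> indices"
  shows "countable (blocks I)"
  unfolding blocks_def
proof (rule countable_SIGMA[OF countable_subset[OF assms countable_indices]])
  have "{..{#\<gamma>#}} = insert {#\<gamma>#} {..<{#\<gamma>#}}" for \<gamma> :: omega1 by auto
  then show "countable {..{#label_of i#}}" for i
    by (simp add: countable_less_singleton_mset)
qed

lemma linear_order_on_blocks:
  assumes "I \<subseteq> indices"
  shows "linear_order_on (blocks I) (blocks_le I)"
proof -
  have "blocks_le I \<subseteq> blocks I \<times> blocks I"
    by (auto simp: blocks_le_def)
  moreover have "refl_on (blocks I) (blocks_le I)"
    by (auto simp: refl_on_def blocks_le_def)
  moreover have "trans (blocks_le I)"
    by (auto simp: trans_def blocks_le_def intro: index_less_trans)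
  moreover have "antisym (blocks_le I)"
    by (auto simp: antisym_def blocks_le_def dest: index_less_asym)
  moreover have "total_on (blocks I) (blocks_le I)"
    using index_less_total assms by (fastforce simp: total_on_def blocks_le_def)
  ultimately show ?thesis by (simp add: order_on_defs)
qed

lemma linearly_ordered_blocks: "I \<subseteq> indices \<Longrightarrow> linearly_ordered (blocks I) (blocks_le I)"
  by (rule linear_order_on_imp_linearly_ordered[OF linear_order_on_blocks])

subsection \<open>Blocks of the orders\<close>

definition left_closed :: "index set \<Rightarrow> bool" where
  "left_closed I \<longleftrightarrow> I \<subseteq> indices \<and>
     (\<forall>i\<in>I. \<forall>j\<in>indices. summand j = summand i \<and> position j < position i \<longrightarrow> j \<in> I)"

lemma left_closed_indices: "left_closed indices"
  by (simp add: left_closed_def)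

lemma left_closed_cut_indices: "left_closed cut_indices"
  by (auto simp: left_closed_def cut_indices_def)

lemma left_closed_dense:
  assumes I: "left_closed I" and ij: "i \<in> I" "j \<in> I" "index_less i j"
  shows "\<exists>k\<in>I. index_less i k \<and> index_less k j"
proof -
  let ?a = "if summand i = summand j then position i else position j - 1"
  have "summand j \<le> l" using I ij(2) by (auto simp: left_closed_def indices_def)
  moreover have "?a < position j" using ij(3) by (auto simp: index_less_def)
  ultimately obtain x where x: "?a < x" "x < position j" "(summand j, x, 0) \<in> indices"
    using ex_index_between[of "summand j" 0] limit_ord_pos[OF limit] by auto
  then have "(summand j, x, 0) \<in> I" using I ij(2) by (auto simp: left_closed_def)
  then show ?thesis
    by (rule bexI[rotated]) (use x ij(3) in \<open>auto simp: index_less_def split: if_splits\<close>)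
qed

lemma no_successor_blocks_iff:
  assumes I: "left_closed I" and mem: "(i, w) \<in> blocks I"
  shows "no_successor (blocks I) (blocks_le I) (i, w) \<longleftrightarrow> w = {#label_of i#}"
proof
  assume w: "w = {#label_of i#}"
  have "\<exists>z\<in>blocks I. less_in (blocks_le I) (i, w) z \<and> less_in (blocks_le I) z y"
    if y: "y \<in> blocks I" "less_in (blocks_le I) (i, w) y" for y
  proof -
    obtain j v where jv: "y = (j, v)" by (cases y)
    then have "i \<in> I" "j \<in> I" "index_less i j" using y w unfolding jv less_in_blocks_le by auto
    then obtain k where "k \<in> I" "index_less i k" "index_less k j" using left_closed_dense[OF I] by blast
    then show ?thesis
      using y mem unfolding jv by (intro bexI[of _ "(k, {#})"]) (unfold less_in_blocks_le, auto)
  qed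
  then show "no_successor (blocks I) (blocks_le I) (i, w)" unfolding no_successor_def by blast
next
  assume no_successor: "no_successor (blocks I) (blocks_le I) (i, w)"
  show "w = {#label_of i#}"
  proof (rule ccontr)
    assume "w \<noteq> {#label_of i#}"
    moreover obtain r where r: "{#label_of i#} = w \<oplus> r" using mem by (auto elim: le_imp_osum)
    ultimately have "r \<noteq> {#}" by auto
    have least: "v = {#}" if "v < {#0 :: omega1#}" for v
      using that by (auto simp: mset_lt_single_right_iff)
    then have "{#0#} \<le> r" using \<open>r \<noteq> {#}\<close> by (meson not_le)
    then have succ: "(i, w \<oplus> {#0#}) \<in> blocks I" "less_in (blocks_le I) (i, w) (i, w \<oplus> {#0#})"
      using mem r unfolding less_in_blocks_le by auto
    then obtain j v where jv: "less_in (blocks_le I) (i, w) (j, v)" "less_in (blocks_le I) (j, v) (i, w \<oplus> {#0#})"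
      using no_successor unfolding no_successor_def by (metis surj_pair)
    then have "w < v" "v < w \<oplus> {#0#}" using index_less_asym[of i j] unfolding less_in_blocks_le by auto
    moreover obtain u where "v = w \<oplus> u" using \<open>w < v\<close> by (metis le_imp_osum less_imp_le)
    ultimately show False using least[of u] by simp
  qed
qed

lemma block_start_blocks_iff:
  assumes I: "left_closed I" and mem: "(i, w) \<in> blocks I"
  shows "block_start (blocks I) (blocks_le I) (i, w) \<longleftrightarrow> w = {#}"
proof
  assume w: "w = {#}"
  have "\<exists>n\<in>blocks I. no_successor (blocks I) (blocks_le I) n \<and> (z, n) \<in> blocks_le I \<and> less_in (blocks_le I) n (i, w)"
    if z: "z \<in> blocks I" "less_in (blocks_le I) z (i, w)" for z
  proof -
    obtain j v where jv: "z = (j, v)" by (cases z)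
    have j: "index_less j i" "(j, v) \<in> blocks I" "(j, {#label_of j#}) \<in> blocks I"
      using z w unfolding jv less_in_blocks_le by auto
    then show ?thesis
      using mem no_successor_blocks_iff[OF I j(3)] unfolding jv
      by (intro bexI[of _ "(j, {#label_of j#})"]) (unfold less_in_blocks_le mem_blocks_le, auto)
  qed
  then show "block_start (blocks I) (blocks_le I) (i, w)" unfolding block_start_def by blast
next
  assume start: "block_start (blocks I) (blocks_le I) (i, w)"
  show "w = {#}"
  proof (rule ccontr)
    assume "w \<noteq> {#}"
    then have "less_in (blocks_le I) (i, {#}) (i, w)" "(i, {#}) \<in> blocks I"
      using mem unfolding less_in_blocks_le by auto
    then obtain j v where jv: "(j, v) \<in> blocks I" "no_successor (blocks I) (blocks_le I) (j, v)"
      "((i, {#}), (j, v)) \<in> blocks_le I" "less_in (blocks_le I) (j, v) (i, w)"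
      using start unfolding block_start_def by (metis surj_pair)
    then have "j = i" "v < w" using index_less_asym[of i j] unfolding less_in_blocks_le mem_blocks_le by auto
    moreover have "v = {#label_of j#}" using no_successor_blocks_iff[OF I] jv(1,2) by blast
    ultimately show False using mem by auto
  qed
qed

lemma at_distance_blocks:
  assumes "i \<in> I"
  shows "at_distance (blocks I) (blocks_le I) {#label_of i#} (i, {#}) (i, {#label_of i#})"
proof -
  have "interval (blocks I) (blocks_le I) (i, {#}) (i, {#label_of i#}) = Pair i ` {..<{#label_of i#}}"
    using assms index_less_asym by (fastforce simp: interval_def blocks_def blocks_le_def order_less_le)
  moreover have "rel_iso (Pair i) {..<{#label_of i#}} le_rel (Pair i ` {..<{#label_of i#}}) (blocks_le I)"
    using assms by (auto simp: rel_iso_def bij_betw_def inj_on_def mem_blocks_le)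
  ultimately show ?thesis
    using assms by (simp add: at_distance_def interval_type_def isomorphic_sym isomorphicI mem_blocks_le)
qed

lemma is_block_blocks:
  assumes I: "left_closed I" "i \<in> I"
  shows "is_block (label_of i) (blocks I) (blocks_le I) (i, {#}) (i, {#label_of i#})"
  unfolding is_block_def
proof (intro conjI ballI impI at_distance_blocks I(2))
  have mem: "(i, {#}) \<in> blocks I" "(i, {#label_of i#}) \<in> blocks I" using I by auto
  show "block_start (blocks I) (blocks_le I) (i, {#})" using block_start_blocks_iff[OF I(1) mem(1)] by simp
  show "no_successor (blocks I) (blocks_le I) (i, {#label_of i#})"
    using no_successor_blocks_iff[OF I(1) mem(2)] by simp
  fix n assume n: "n \<in> blocks I" "((i, {#}), n) \<in> blocks_le I \<and> less_in (blocks_le I) n (i, {#label_of i#})"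
  obtain j v where jv: "n = (j, v)" by (cases n)
  have "j = i" "v < {#label_of i#}"
    using n(2) index_less_asym[of i j] unfolding jv less_in_blocks_le mem_blocks_le by auto
  then show "\<not> no_successor (blocks I) (blocks_le I) n"
    using no_successor_blocks_iff[OF I(1)] n(1) jv by auto
qed

lemma starts_block_blocks_iff:
  assumes I: "left_closed I" and s: "s \<in> blocks I"
  shows "starts_block \<gamma> (blocks I) (blocks_le I) s \<longleftrightarrow> (\<exists>i\<in>I. s = (i, {#}) \<and> \<gamma> = label_of i)"
proof -
  interpret linearly_ordered "blocks I" "blocks_le I"
    using I by (auto simp: left_closed_def intro: linearly_ordered_blocks)
  have label: "starts_block (label_of i) (blocks I) (blocks_le I) (i, {#})" if "i \<in> I" for i
    unfolding starts_block_def using is_block_blocks[OF I that] that by force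
  show ?thesis
  proof
    assume starts: "starts_block \<gamma> (blocks I) (blocks_le I) s"
    obtain i w where iw: "s = (i, w)" by (cases s)
    then have "i \<in> I" "w = {#}"
      using s starts_block_imp_block_start[OF starts] block_start_blocks_iff[OF I] by auto
    with iw show "\<exists>i\<in>I. s = (i, {#}) \<and> \<gamma> = label_of i"
      using starts_block_unique[OF starts _ s] label by blast
  qed (use label in blast)
qed

subsection \<open>The cut order is canonical\<close>

lemma ex_index_below_in_open:
  assumes "open V" "x \<in> V" "a < x" "\<beta> \<le> l" "\<gamma> < l" "\<gamma> \<le> \<beta>"
  obtains y where "y \<in> V" "a < y" "y < x" "(\<beta>, y, \<gamma>) \<in> indices"
proof -
  obtain b where b: "b < x" "{b<..x} \<subseteq> V" using open_left[OF assms(1-3)] by blast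
  obtain y where "max a b < y" "y < x" "(\<beta>, y, \<gamma>) \<in> indices"
    by (rule ex_index_between[OF assms(4-6), of "max a b" x]) (use assms(3) b(1) in auto)
  then show ?thesis using b(2) by (intro that[of y]) auto
qed

lemma ex_index_above_in_open:
  assumes "open V" "x \<in> V" "\<beta> \<le> l" "\<gamma> < l" "\<gamma> \<le> \<beta>"
  obtains y where "y \<in> V" "x < y" "(\<beta>, y, \<gamma>) \<in> indices"
proof -
  obtain b where b: "x < b" "{x..<b} \<subseteq> V" using open_right[OF assms(1,2), of "x + 1"] by auto
  obtain y where "x < y" "y < b" "(\<beta>, y, \<gamma>) \<in> indices"
    by (rule ex_index_between[OF assms(3-5) b(1)])
  then show ?thesis using b(2) by (intro that[of y]) auto
qed

lemma dense_unbounded_indices: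
  assumes T: "T \<noteq> {}" "T \<subseteq> {..l}" and \<gamma>: "\<gamma> < l" "\<And>\<beta>. \<beta> \<in> T \<Longrightarrow> \<gamma> \<le> \<beta>"
    and U: "\<And>\<beta>. open (U \<beta>)" "\<And>\<beta>. U \<beta> \<noteq> {}"
    and U_convex: "\<And>\<beta> x y z. x \<in> U \<beta> \<Longrightarrow> z \<in> U \<beta> \<Longrightarrow> x < y \<Longrightarrow> y < z \<Longrightarrow> y \<in> U \<beta>"
  shows "dense_unbounded (\<lambda>i. label_of i = \<gamma>) {i \<in> indices. summand i \<in> T \<and> position i \<in> U (summand i)} index_le"
proof -
  let ?M = "{i \<in> indices. summand i \<in> T \<and> position i \<in> U (summand i)}"
  have below: "\<exists>y<x. (\<beta>, y, \<gamma>) \<in> ?M" if x: "\<beta> \<in> T" "x \<in> U \<beta>" for \<beta> x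
    by (rule ex_index_below_in_open[OF U(1) x(2), of "x - 1" \<beta> \<gamma>]) (use x T(2) \<gamma> in auto)
  have above: "\<exists>y>x. (\<beta>, y, \<gamma>) \<in> ?M" if x: "\<beta> \<in> T" "x \<in> U \<beta>" for \<beta> x
    by (rule ex_index_above_in_open[OF U(1) x(2), of \<beta> \<gamma>]) (use x T(2) \<gamma> in auto)
  show ?thesis
  proof (rule dense_unboundedI, unfold less_in_index_le)
    obtain \<beta> x where "\<beta> \<in> T" "x \<in> U \<beta>" using T(1) U(2) by blast
    then show "\<exists>k\<in>?M. label_of k = \<gamma>" using above by fastforce
    fix i assume i: "i \<in> ?M"
    obtain y where "y < position i" "(summand i, y, \<gamma>) \<in> ?M"
      using below[of "summand i" "position i"] i by auto
    then show "\<exists>k\<in>?M. label_of k = \<gamma> \<and> index_less k i"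
      by (intro bexI[of _ "(summand i, y, \<gamma>)"]) (auto simp: index_less_def)
    obtain z where "position i < z" "(summand i, z, \<gamma>) \<in> ?M"
      using above[of "summand i" "position i"] i by auto
    then show "\<exists>k\<in>?M. label_of k = \<gamma> \<and> index_less i k"
      by (intro bexI[of _ "(summand i, z, \<gamma>)"]) (auto simp: index_less_def)
    fix j assume j: "j \<in> ?M" and ij: "index_less i j"
    show "\<exists>k\<in>?M. label_of k = \<gamma> \<and> index_less i k \<and> index_less k j"
    proof (cases "summand i = summand j")
      case True
      then have "position i < position j" using ij by (simp add: index_less_def)
      then obtain y where "position i < y" "y < position j" "(summand j, y, \<gamma>) \<in> indices"
        using j T(2) \<gamma> by (auto intro: ex_index_between)
      then show ?thesis
        using i j True U_convex[of "position i" "summand j" "position j" y]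
        by (intro bexI[of _ "(summand j, y, \<gamma>)"]) (auto simp: index_less_def)
    next
      case False
      then have "summand j < summand i" using ij by (simp add: index_less_def)
      moreover obtain y where "y < position j" "(summand j, y, \<gamma>) \<in> ?M"
        using below[of "summand j" "position j"] j by auto
      ultimately show ?thesis
        by (intro bexI[of _ "(summand j, y, \<gamma>)"]) (auto simp: index_less_def)
    qed
  qed
qed

lemma dense_unbounded_block_starts:
  assumes I: "left_closed I" "M \<subseteq> I" and dense: "dense_unbounded (\<lambda>i. label_of i = \<gamma>) M index_le"
  shows "dense_unbounded (starts_block \<gamma> (blocks I) (blocks_le I)) ((\<lambda>i. (i, {#})) ` M) (blocks_le I)"
proof (rule dense_unbounded_image[OF dense])
  fix i assume i: "i \<in> M"
  show "starts_block \<gamma> (blocks I) (blocks_le I) (i, {#})" if "label_of i = \<gamma>"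
    using starts_block_blocks_iff[OF I(1), of "(i, {#})"] i I(2) that by auto
  show "less_in (blocks_le I) (i, {#}) (j, {#}) \<longleftrightarrow> less_in index_le i j" if "j \<in> M" for j
    using i that I(2) by (auto simp: mem_blocks_le)
qed

abbreviation cut_order :: "elem set" where "cut_order \<equiv> blocks cut_indices"

abbreviation cut_le :: "elem rel" where "cut_le \<equiv> blocks_le cut_indices"

lemma after_cut: "i \<in> cut_indices \<Longrightarrow> index_less cut i \<longleftrightarrow> summand i < l"
  by (auto simp: cut_indices_def indices_def index_less_def)

lemma in_summand_cut_order:
  assumes i: "i \<in> cut_indices" "summand i < l"
  shows "in_summand (summand i) cut_order cut_le (cut, {#}) (i, {#})"
  unfolding in_summand_def
proof (intro conjI[OF _ conjI[OF _ conjI]] ballI impI)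
  note starts_iff = starts_block_blocks_iff[OF left_closed_cut_indices]
    and start_iff = block_start_blocks_iff[OF left_closed_cut_indices]
  show "less_in cut_le (cut, {#}) (i, {#})"
    using i cut_mem after_cut[OF i(1)] unfolding less_in_blocks_le by simp
  show "block_start cut_order cut_le (i, {#})" using start_iff i(1) by simp
  obtain x where "position i < x" "(summand i, x, summand i) \<in> indices"
    by (rule ex_index_between[of "summand i" "summand i" "position i" "position i + 1"]) (use i(2) in auto)
  then have "(summand i, x, summand i) \<in> cut_indices" "index_less i (summand i, x, summand i)"
    using i(2) by (auto simp: cut_indices_def index_less_def)
  then show "\<exists>t\<in>cut_order. ((i, {#}), t) \<in> cut_le \<and> starts_block (summand i) cut_order cut_le t"
    using starts_iff i(1) by (intro bexI[of _ "((summand i, x, summand i), {#})"]) (auto simp: mem_blocks_le)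
  fix t assume t: "t \<in> cut_order" "((i, {#}), t) \<in> cut_le \<and> block_start cut_order cut_le t"
  obtain j v where jv: "t = (j, v)" by (cases t)
  then have j: "j \<in> cut_indices" "v = {#}" using start_iff t by auto
  have "label_of j \<le> summand j" using j(1) by (simp add: cut_indices_def indices_def)
  also have "\<dots> \<le> summand i" using t(2) jv by (auto simp: mem_blocks_le index_less_def)
  finally show "\<exists>\<gamma>\<in>{..summand i}. starts_block \<gamma> cut_order cut_le t"
    using starts_iff[OF t(1)] jv j by auto
qed

lemma in_summand_cut_order_iff:
  assumes s: "s \<in> cut_order"
  shows "in_summand \<beta> cut_order cut_le (cut, {#}) s \<longleftrightarrow> (\<exists>i\<in>cut_indices. s = (i, {#}) \<and> summand i = \<beta> \<and> \<beta> < l)"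
proof -
  interpret linearly_ordered cut_order cut_le by (rule linearly_ordered_blocks[OF cut_indices_subset])
  show ?thesis
  proof
    assume \<beta>: "in_summand \<beta> cut_order cut_le (cut, {#}) s"
    obtain i w where iw: "s = (i, w)" by (cases s)
    then have i: "i \<in> cut_indices" "w = {#}"
      using s \<beta> block_start_blocks_iff[OF left_closed_cut_indices] by (auto simp: in_summand_def)
    have "less_in cut_le (cut, {#}) s" using \<beta> by (simp add: in_summand_def)
    then have "summand i < l" using after_cut[OF i(1)] i unfolding iw less_in_blocks_le by auto
    moreover from this have "\<beta> = summand i"
      using in_summand_unique[OF \<beta> _ s] in_summand_cut_order[OF i(1)] iw i(2) by blast
    ultimately show "\<exists>i\<in>cut_indices. s = (i, {#}) \<and> summand i = \<beta> \<and> \<beta> < l" using iw i by blast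
  qed (use in_summand_cut_order in blast)
qed

lemma dense_before_cut:
  assumes "\<gamma> < l"
  shows "dense_unbounded (starts_block \<gamma> cut_order cut_le)
    {s \<in> cut_order. block_start cut_order cut_le s \<and> less_in cut_le s (cut, {#})} cut_le"
proof -
  let ?M = "{i \<in> indices. summand i \<in> {l} \<and> position i \<in> {..<position cut}}"
  have "?M \<subseteq> cut_indices" by (auto simp: cut_indices_def)
  moreover have "dense_unbounded (\<lambda>i. label_of i = \<gamma>) ?M index_le"
    by (rule dense_unbounded_indices) (use assms in auto)
  ultimately have "dense_unbounded (starts_block \<gamma> cut_order cut_le) ((\<lambda>i. (i, {#})) ` ?M) cut_le"
    by (rule dense_unbounded_block_starts[OF left_closed_cut_indices])
  moreover have "{i \<in> cut_indices. less_in cut_le (i, {#}) (cut, {#})} = ?M"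
    unfolding less_in_blocks_le using cut_mem by (auto simp: cut_indices_def indices_def index_less_def)
  moreover have "{s \<in> cut_order. block_start cut_order cut_le s \<and> less_in cut_le s (cut, {#})} =
      (\<lambda>i. (i, {#})) ` {i \<in> cut_indices. less_in cut_le (i, {#}) (cut, {#})}"
    using block_start_blocks_iff[OF left_closed_cut_indices] by auto
  ultimately show ?thesis by simp
qed

lemma dense_in_summand_cut_order:
  assumes "\<beta> < l" "\<gamma> \<le> \<beta>"
  shows "dense_unbounded (starts_block \<gamma> cut_order cut_le)
    {s \<in> cut_order. in_summand \<beta> cut_order cut_le (cut, {#}) s} cut_le"
proof -
  let ?M = "{i \<in> indices. summand i \<in> {\<beta>} \<and> position i \<in> UNIV}"
  have "?M \<subseteq> cut_indices" using assms(1) by (auto simp: cut_indices_def)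
  moreover have "dense_unbounded (\<lambda>i. label_of i = \<gamma>) ?M index_le"
    by (rule dense_unbounded_indices) (use assms in auto)
  ultimately have "dense_unbounded (starts_block \<gamma> cut_order cut_le) ((\<lambda>i. (i, {#})) ` ?M) cut_le"
    by (rule dense_unbounded_block_starts[OF left_closed_cut_indices])
  moreover have "{s \<in> cut_order. in_summand \<beta> cut_order cut_le (cut, {#}) s} = (\<lambda>i. (i, {#})) ` ?M"
    using in_summand_cut_order_iff assms(1) \<open>?M \<subseteq> cut_indices\<close> cut_indices_subset by auto
  ultimately show ?thesis by simp
qed

lemma canonical_cut_order: "canonical l cut_order cut_le (cut, {#})"
  unfolding canonical_def
proof (intro conjI[OF _ conjI[OF _ conjI[OF _ conjI]]] ballI)
  show "starts_block 0 cut_order cut_le (cut, {#})"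
    using starts_block_blocks_iff[OF left_closed_cut_indices, of "(cut, {#})"] cut_mem by auto
  show "\<exists>\<gamma>\<in>{..<l}. in_block \<gamma> cut_order cut_le x" if x: "x \<in> cut_order" for x
  proof -
    obtain i w where iw: "x = (i, w)" by (cases x)
    then have i: "i \<in> cut_indices" "label_of i < l" using x by (auto simp: cut_indices_def indices_def)
    then have "in_block (label_of i) cut_order cut_le x"
      unfolding in_block_def using is_block_blocks[OF left_closed_cut_indices] x iw
      by (intro bexI[of _ "(i, {#})"] bexI[of _ "(i, {#label_of i#})"]) (auto simp: mem_blocks_le)
    with i(2) show ?thesis by blast
  qed
  show "\<exists>\<beta>\<in>{..<l}. less_in cut_le (cut, {#}) s \<and> block_start cut_order cut_le s \<longrightarrow>
      in_summand \<beta> cut_order cut_le (cut, {#}) s" if s: "s \<in> cut_order" for s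
  proof (cases "less_in cut_le (cut, {#}) s \<and> block_start cut_order cut_le s")
    case True
    obtain i w where iw: "s = (i, w)" by (cases s)
    then have i: "i \<in> cut_indices" "w = {#}"
      using s True block_start_blocks_iff[OF left_closed_cut_indices] by auto
    then have "summand i < l" using True after_cut[OF i(1)] unfolding iw less_in_blocks_le by auto
    then show ?thesis using in_summand_cut_order[OF i(1)] iw i(2) by blast
  next
    case False
    then show ?thesis using limit_ord_pos[OF limit] by blast
  qed
qed (use dense_before_cut dense_in_summand_cut_order in auto)

lemma canonical_order_cut_order: "canonical_order cut_order cut_le l (cut, {#})"
proof -
  interpret linearly_ordered cut_order cut_le by (rule linearly_ordered_blocks[OF cut_indices_subset])
  show ?thesis
    by unfold_locales (use countable_blocks[OF cut_indices_subset] cut_mem canonical_cut_order in auto)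
qed

subsection \<open>The full order is not canonical\<close>

abbreviation full_order :: "elem set" where "full_order \<equiv> blocks indices"

abbreviation full_le :: "elem rel" where "full_le \<equiv> blocks_le indices"

lemma not_canonical_in_top_summand:
  assumes i: "i \<in> indices" "summand i = l"
  shows "\<not> canonical l full_order full_le (i, {#})"
proof
  assume canonical: "canonical l full_order full_le (i, {#})"
  note start_iff = block_start_blocks_iff[OF left_closed_indices]
  obtain x where x: "position i < x" "(l, x, 0) \<in> indices"
    by (rule ex_index_between[of l 0 "position i" "position i + 1"]) (use limit_ord_pos[OF limit] in auto)
  then have "less_in full_le (i, {#}) ((l, x, 0), {#})"
    using i unfolding less_in_blocks_le by (auto simp: index_less_def)
  then obtain \<beta> where \<beta>: "\<beta> < l" "in_summand \<beta> full_order full_le (i, {#}) ((l, x, 0), {#})"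
    using canonicalD(3)[OF canonical, of "((l, x, 0), {#})"] start_iff[of "(l, x, 0)"] x(2) by auto
  obtain y where y: "x < y" "(l, y, succ_ord \<beta>) \<in> indices"
    by (rule ex_index_between[of l "succ_ord \<beta>" x "x + 1"]) (use limit_ord_succ[OF limit \<beta>(1)] in auto)
  let ?t = "((l, y, succ_ord \<beta>), {#})"
  have t_mem: "?t \<in> full_order" using y(2) by simp
  moreover have "block_start full_order full_le ?t"
    using start_iff t_mem by simp
  moreover have "(((l, x, 0), {#}), ?t) \<in> full_le"
    using x y by (simp add: mem_blocks_le index_less_def)
  ultimately have "\<exists>\<gamma>\<in>{..\<beta>}. starts_block \<gamma> full_order full_le ?t"
    using \<beta>(2) unfolding in_summand_def by blast
  then show False
    using starts_block_blocks_iff[OF left_closed_indices t_mem] by (auto simp: succ_ord_le_iff)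
qed

lemma not_canonical_in_lower_summand:
  assumes i: "i \<in> indices" "summand i < l"
  shows "\<not> canonical l full_order full_le (i, {#})"
proof
  let ?\<gamma> = "succ_ord (summand i)"
  assume canonical: "canonical l full_order full_le (i, {#})"
  obtain x where x: "x < position i" "(summand i, x, 0) \<in> indices"
    by (rule ex_index_between[of "summand i" 0 "position i - 1" "position i"])
      (use i(2) limit_ord_pos[OF limit] in auto)
  let ?s = "((summand i, x, 0), {#})"
  have s_mem: "?s \<in> {s \<in> full_order. block_start full_order full_le s \<and>
      less_in full_le s (i, {#})}"
    using i x block_start_blocks_iff[OF left_closed_indices, of "(summand i, x, 0)"]
    unfolding mem_Collect_eq less_in_blocks_le by (auto simp: index_less_def)
  obtain u where u: "u \<in> full_order" "starts_block ?\<gamma> full_order full_le u"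
    "less_in full_le ?s u" "less_in full_le u (i, {#})"
    using dense_unboundedD(3)[OF canonicalD(4)[OF canonical limit_ord_succ[OF limit i(2)]] s_mem] by blast
  then obtain k where k: "k \<in> indices" "u = (k, {#})" "?\<gamma> = label_of k"
    using starts_block_blocks_iff[OF left_closed_indices u(1)] by blast
  have "summand k = summand i" using u(3,4) unfolding k(2) less_in_blocks_le by (auto simp: index_less_def)
  moreover have "label_of k \<le> summand k" using k(1) by (simp add: indices_def)
  ultimately show False using k(3)[symmetric] by (simp add: succ_ord_le_iff)
qed

lemma not_canonical_full_order: "p \<in> full_order \<Longrightarrow> \<not> canonical l full_order full_le p"
proof
  assume p: "p \<in> full_order" and canonical: "canonical l full_order full_le p"
  obtain i where i: "i \<in> indices" "p = (i, {#})"
    using starts_block_blocks_iff[OF left_closed_indices p] canonicalD(1)[OF canonical] by blast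
  then have "summand i < l \<or> summand i = l" by (auto simp: indices_def)
  then show False
    using canonical not_canonical_in_top_summand[OF i(1)] not_canonical_in_lower_summand[OF i(1)] i(2) by blast
qed

end


section \<open>Back-and-forth between ordinals\<close>

definition equiv_gap ::
  "omega1 \<Rightarrow> omega1 multiset \<times> omega1 multiset \<Rightarrow> omega1 multiset \<times> omega1 multiset \<Rightarrow> bool" where
  "equiv_gap \<delta> p q \<longleftrightarrow> (\<exists>d d'. fst q = fst p \<oplus> d \<and> snd q = snd p \<oplus> d' \<and> tail_equiv \<delta> d d')"

definition gap_preserving :: "omega1 \<Rightarrow> (omega1 multiset \<times> omega1 multiset) set \<Rightarrow> bool" where
  "gap_preserving \<delta> Q \<longleftrightarrow> (\<forall>p\<in>Q. \<forall>q\<in>Q. fst p \<le> fst q \<longrightarrow> equiv_gap \<delta> p q)"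

lemma equiv_gap_refl [simp]: "equiv_gap \<delta> p p"
  unfolding equiv_gap_def by (intro exI[of _ "{#}"]) simp

lemma equiv_gap_trans:
  assumes "equiv_gap \<delta> p q" "equiv_gap \<delta> q r"
  shows "equiv_gap \<delta> p r"
proof -
  obtain d d' where d: "fst q = fst p \<oplus> d" "snd q = snd p \<oplus> d'" "tail_equiv \<delta> d d'"
    using assms(1) unfolding equiv_gap_def by blast
  obtain e e' where e: "fst r = fst q \<oplus> e" "snd r = snd q \<oplus> e'" "tail_equiv \<delta> e e'"
    using assms(2) unfolding equiv_gap_def by blast
  have "fst r = fst p \<oplus> (d \<oplus> e)" "snd r = snd p \<oplus> (d' \<oplus> e')"
    using d e by (simp_all add: osum_assoc)
  then show ?thesis using tail_equiv_osum[OF d(3) e(3)] unfolding equiv_gap_def by blast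
qed

lemma equiv_gap_mono: "equiv_gap \<delta> p q \<Longrightarrow> \<delta>' \<le> \<delta> \<Longrightarrow> equiv_gap \<delta>' p q"
  unfolding equiv_gap_def using tail_equiv_mono by blast

lemma equiv_gap_less_iff:
  assumes "equiv_gap \<delta> p q"
  shows "snd p \<le> snd q" "fst p < fst q \<longleftrightarrow> snd p < snd q"
proof -
  obtain d d' where d: "fst q = fst p \<oplus> d" "snd q = snd p \<oplus> d'" "tail_equiv \<delta> d d'"
    using assms unfolding equiv_gap_def by blast
  show "snd p \<le> snd q" "fst p < fst q \<longleftrightarrow> snd p < snd q"
    using tail_equiv_empty_iff[OF d(3)] unfolding d(1,2) by simp_all
qed

lemma equiv_gap_eq: "equiv_gap \<delta> p q \<Longrightarrow> fst p = fst q \<Longrightarrow> p = q"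
  using equiv_gap_less_iff[of \<delta> p q] by (simp add: prod_eq_iff)

lemma equiv_gap_split:
  assumes "equiv_gap \<delta> p q" "\<delta>' < \<delta>" "fst p \<le> x" "x \<le> fst q"
  obtains x' where "equiv_gap \<delta>' p (x, x')" "equiv_gap \<delta> (x, x') q"
proof -
  obtain d d' where d: "fst q = fst p \<oplus> d" "snd q = snd p \<oplus> d'" "tail_equiv \<delta> d d'"
    using assms(1) unfolding equiv_gap_def by blast
  obtain e where e: "x = fst p \<oplus> e" by (rule le_imp_osum[OF assms(3)])
  obtain r where r: "fst q = x \<oplus> r" by (rule le_imp_osum[OF assms(4)])
  have "d = e \<oplus> r" using d(1) e r by (simp add: osum_assoc)
  with d(3) have "tail_equiv \<delta> (e \<oplus> r) d'" by simp
  then obtain e' r' where "d' = e' \<oplus> r'" "tail_equiv \<delta>' e e'" "tail_equiv \<delta> r r'"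
    using assms(2) by (rule tail_equiv_osum_split)
  then show ?thesis
    using that[of "snd p \<oplus> e'"] d(2) e r unfolding equiv_gap_def by (auto simp: osum_assoc)
qed

lemma gap_preservingD: "gap_preserving \<delta> Q \<Longrightarrow> p \<in> Q \<Longrightarrow> q \<in> Q \<Longrightarrow> fst p \<le> fst q \<Longrightarrow> equiv_gap \<delta> p q"
  unfolding gap_preserving_def by blast

lemma gap_preserving_mono: "gap_preserving \<delta> Q \<Longrightarrow> \<delta>' \<le> \<delta> \<Longrightarrow> Q' \<subseteq> Q \<Longrightarrow> gap_preserving \<delta>' Q'"
  unfolding gap_preserving_def using equiv_gap_mono by blast

lemma gap_preserving_le_iff:
  assumes "gap_preserving \<delta> Q" "p \<in> Q" "q \<in> Q"
  shows "fst p \<le> fst q \<longleftrightarrow> snd p \<le> snd q"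
proof (cases "fst p \<le> fst q")
  case True
  then show ?thesis using equiv_gap_less_iff(1)[OF gap_preservingD[OF assms True]] by simp
next
  case False
  then have "equiv_gap \<delta> q p" using gap_preservingD[OF assms(1,3,2)] by simp
  then have "snd q < snd p" using False equiv_gap_less_iff(2)[of \<delta> q p] by auto
  then show ?thesis using False by auto
qed

lemma gap_preserving_eq_iff: "gap_preserving \<delta> Q \<Longrightarrow> p \<in> Q \<Longrightarrow> q \<in> Q \<Longrightarrow> fst p = fst q \<longleftrightarrow> snd p = snd q"
  using gap_preserving_le_iff[of \<delta> Q p q] gap_preserving_le_iff[of \<delta> Q q p] by (auto simp: order.eq_iff)

lemma gap_preserving_converse:
  assumes "gap_preserving \<delta> Q"
  shows "gap_preserving \<delta> (Q\<inverse>)"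
  unfolding gap_preserving_def
proof (intro ballI impI)
  fix p q assume pq: "p \<in> Q\<inverse>" "q \<in> Q\<inverse>" "fst p \<le> fst q"
  then have "prod.swap p \<in> Q" "prod.swap q \<in> Q" by auto
  then have "equiv_gap \<delta> (prod.swap p) (prod.swap q)"
    using assms pq(3) gap_preserving_le_iff[OF assms, of "prod.swap p" "prod.swap q"] gap_preservingD by auto
  then show "equiv_gap \<delta> p q" unfolding equiv_gap_def using tail_equiv_sym by auto
qed

lemma gap_preserving_diagonal:
  assumes "\<And>p. p \<in> Q \<Longrightarrow> fst p = snd p"
  shows "gap_preserving \<delta> Q"
  unfolding gap_preserving_def
proof (intro ballI impI)
  fix p q assume pq: "p \<in> Q" "q \<in> Q" "fst p \<le> fst q"
  obtain d where "fst q = fst p \<oplus> d" by (rule le_imp_osum[OF pq(3)])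
  then show "equiv_gap \<delta> p q" using assms pq(1,2) unfolding equiv_gap_def by (auto intro: exI[of _ d])
qed

lemma gap_preserving_insert:
  assumes Q: "gap_preserving \<delta> Q"
    and below: "\<And>r. r \<in> Q \<Longrightarrow> fst r \<le> fst x \<Longrightarrow> \<exists>p\<in>Q. fst r \<le> fst p \<and> equiv_gap \<delta> p x"
    and above: "\<And>r. r \<in> Q \<Longrightarrow> fst x \<le> fst r \<Longrightarrow> \<exists>q\<in>Q. fst q \<le> fst r \<and> equiv_gap \<delta> x q"
  shows "gap_preserving \<delta> (insert x Q)"
proof -
  have "equiv_gap \<delta> r x" if "r \<in> Q" "fst r \<le> fst x" for r
    using below[OF that] equiv_gap_trans[of \<delta> r _ x] gap_preservingD[OF Q that(1)] by blast
  moreover have "equiv_gap \<delta> x r" if "r \<in> Q" "fst x \<le> fst r" for r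
    using above[OF that] equiv_gap_trans[of \<delta> x _ r] gap_preservingD[OF Q _ that(1)] by blast
  ultimately show ?thesis using Q unfolding gap_preserving_def by auto
qed

lemma greatest_value_below:
  fixes f :: "'a \<Rightarrow> 'b :: linorder"
  assumes "finite Q" "m \<in> f ` Q" "m \<le> x"
  obtains p where "p \<in> Q" "f p \<le> x" "\<And>r. r \<in> Q \<Longrightarrow> f r \<le> x \<Longrightarrow> f r \<le> f p"
proof -
  let ?below = "{p \<in> Q. f p \<le> x}"
  have "Max (f ` ?below) \<in> f ` ?below" using assms by (intro Max_in) auto
  then obtain p where "p \<in> ?below" "f p = Max (f ` ?below)" by auto
  with that[of p] assms(1) show ?thesis by simp
qed

lemma least_value_above:
  fixes f :: "'a \<Rightarrow> 'b :: linorder"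
  assumes "finite Q" "t \<in> f ` Q" "x \<le> t"
  obtains q where "q \<in> Q" "x \<le> f q" "\<And>r. r \<in> Q \<Longrightarrow> x \<le> f r \<Longrightarrow> f q \<le> f r"
proof -
  let ?above = "{q \<in> Q. x \<le> f q}"
  have "Min (f ` ?above) \<in> f ` ?above" using assms by (intro Min_in) auto
  then obtain q where "q \<in> ?above" "f q = Min (f ` ?above)" by auto
  with that[of q] assms(1) show ?thesis by simp
qed

lemma gap_preserving_insert_point:
  assumes Q: "finite Q" "gap_preserving \<delta>' Q" "\<delta>' < \<delta>"
    and upper: "gap_preserving \<delta> {p \<in> Q. m \<le> fst p}"
    and m: "m \<in> fst ` Q" "m \<le> x" and t: "t \<in> fst ` Q" "x \<le> t"
  obtains x' where "gap_preserving \<delta>' (insert (x, x') Q)" "gap_preserving \<delta> {p \<in> insert (x, x') Q. x \<le> fst p}"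
proof -
  obtain p where p: "p \<in> Q" "fst p \<le> x" and p_greatest: "\<And>r. r \<in> Q \<Longrightarrow> fst r \<le> x \<Longrightarrow> fst r \<le> fst p"
    by (rule greatest_value_below[OF Q(1) m]) (rule that)
  obtain q where q: "q \<in> Q" "x \<le> fst q" and q_least: "\<And>r. r \<in> Q \<Longrightarrow> x \<le> fst r \<Longrightarrow> fst q \<le> fst r"
    by (rule least_value_above[OF Q(1) t]) (rule that)
  have "m \<le> fst p" using p_greatest m by auto
  moreover have "fst p \<le> fst q" using p(2) q(2) by (rule order.trans)
  ultimately have "equiv_gap \<delta> p q"
    using upper p(1) q(1) by (intro gap_preservingD[OF upper]) auto
  then obtain x' where x': "equiv_gap \<delta>' p (x, x')" "equiv_gap \<delta> (x, x') q"
    using Q(3) p(2) q(2) by (rule equiv_gap_split)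
  have "gap_preserving \<delta>' (insert (x, x') Q)"
  proof (rule gap_preserving_insert[OF Q(2)])
    show "\<exists>p\<in>Q. fst r \<le> fst p \<and> equiv_gap \<delta>' p (x, x')" if "r \<in> Q" "fst r \<le> fst (x, x')" for r
      using p(1) p_greatest[OF that(1)] x'(1) that(2) by (intro bexI[of _ p]) auto
    show "\<exists>q\<in>Q. fst q \<le> fst r \<and> equiv_gap \<delta>' (x, x') q" if "r \<in> Q" "fst (x, x') \<le> fst r" for r
      using q(1) q_least[OF that(1)] equiv_gap_mono[OF x'(2) less_imp_le[OF Q(3)]] that(2)
      by (intro bexI[of _ q]) auto
  qed
  moreover have "gap_preserving \<delta> (insert (x, x') {r \<in> Q. x \<le> fst r})"
  proof (rule gap_preserving_insert)
    show "gap_preserving \<delta> {r \<in> Q. x \<le> fst r}"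
      using m(2) by (intro gap_preserving_mono[OF upper order.refl]) auto
    show "\<exists>q\<in>{r \<in> Q. x \<le> fst r}. fst q \<le> fst r \<and> equiv_gap \<delta> (x, x') q"
      if "r \<in> {r \<in> Q. x \<le> fst r}" "fst (x, x') \<le> fst r" for r
      using q q_least[of r] x'(2) that by (intro bexI[of _ q]) auto
    show "\<exists>p\<in>{r \<in> Q. x \<le> fst r}. fst r \<le> fst p \<and> equiv_gap \<delta> p (x, x')"
      if r: "r \<in> {r \<in> Q. x \<le> fst r}" "fst r \<le> fst (x, x')" for r
    proof -
      have "fst q = x" using q(2) q_least[of r] r by auto
      then have "q = (x, x')" using equiv_gap_eq[OF x'(2)] by simp
      then show ?thesis using q(1) r by (intro bexI[of _ q]) auto
    qed
  qed
  moreover have "{p \<in> insert (x, x') Q. x \<le> fst p} = insert (x, x') {r \<in> Q. x \<le> fst r}" by auto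
  ultimately show ?thesis using that by simp
qed

text \<open>Points are inserted from left to right: everything from the last inserted point \<open>m\<close> on still matches
  at the finer level \<open>\<delta>\<close>, which is what allows the next insertion.\<close>

lemma gap_preserving_insert_list:
  assumes "finite Q" "gap_preserving \<delta>' Q" "\<delta>' < \<delta>" "gap_preserving \<delta> {p \<in> Q. m \<le> fst p}"
    and "m \<in> fst ` Q" "t \<in> fst ` Q" "sorted (m # xs)" "\<forall>x\<in>set xs. x \<le> t"
  shows "\<exists>Q'. Q \<subseteq> Q' \<and> finite Q' \<and> gap_preserving \<delta>' Q' \<and> set xs \<subseteq> fst ` Q' \<and> fst ` Q' \<subseteq> fst ` Q \<union> set xs"
  using assms
proof (induction xs arbitrary: Q m)
  case Nil
  then show ?case by auto
next
  case (Cons x xs)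
  obtain x' where x': "gap_preserving \<delta>' (insert (x, x') Q)" "gap_preserving \<delta> {p \<in> insert (x, x') Q. x \<le> fst p}"
    by (rule gap_preserving_insert_point[OF Cons.prems(1-5) _ Cons.prems(6)]) (use Cons.prems(7,8) in auto)
  obtain Q' where Q': "insert (x, x') Q \<subseteq> Q'" "finite Q'" "gap_preserving \<delta>' Q'" "set xs \<subseteq> fst ` Q'"
    "fst ` Q' \<subseteq> fst ` insert (x, x') Q \<union> set xs"
    using Cons.IH[OF _ x'(1) Cons.prems(3) x'(2)] Cons.prems by auto
  moreover have "x \<in> fst ` Q'" using Q'(1) by force
  ultimately show ?case by (intro exI[of _ Q']) auto
qed

definition endpoints :: "omega1 \<Rightarrow> omega1 \<Rightarrow> (omega1 multiset \<times> omega1 multiset) set" where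
  "endpoints \<gamma> \<gamma>' = {({#}, {#}), ({#\<gamma>#}, {#\<gamma>'#})}"

definition block_partial_iso :: "omega1 \<Rightarrow> omega1 \<Rightarrow> omega1 \<Rightarrow> (omega1 multiset \<times> omega1 multiset) set \<Rightarrow> bool" where
  "block_partial_iso \<delta> \<gamma> \<gamma>' q \<longleftrightarrow>
     finite q \<and> q \<subseteq> {..{#\<gamma>#}} \<times> {..{#\<gamma>'#}} \<and> gap_preserving \<delta> (endpoints \<gamma> \<gamma>' \<union> q)"

lemma block_partial_iso_mono: "block_partial_iso \<delta> \<gamma> \<gamma>' q \<Longrightarrow> \<delta>' \<le> \<delta> \<Longrightarrow> block_partial_iso \<delta>' \<gamma> \<gamma>' q"
  unfolding block_partial_iso_def using gap_preserving_mono[OF _ _ order.refl] by blast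

lemma block_partial_iso_converse:
  assumes "block_partial_iso \<delta> \<gamma> \<gamma>' q"
  shows "block_partial_iso \<delta> \<gamma>' \<gamma> (q\<inverse>)"
proof -
  have "(endpoints \<gamma> \<gamma>' \<union> q)\<inverse> = endpoints \<gamma>' \<gamma> \<union> q\<inverse>" by (auto simp: endpoints_def)
  then show ?thesis
    using gap_preserving_converse[of \<delta> "endpoints \<gamma> \<gamma>' \<union> q"] assms unfolding block_partial_iso_def by auto
qed

lemma block_partial_iso_empty:
  assumes "min \<gamma> \<delta> = min \<gamma>' \<delta>"
  shows "block_partial_iso \<delta> \<gamma> \<gamma>' {}"
proof -
  have "\<gamma> = \<gamma>' \<or> \<delta> \<le> \<gamma> \<and> \<delta> \<le> \<gamma>'"
    using assms by (auto simp: min_def split: if_splits)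
  then have "equiv_gap \<delta> ({#}, {#}) ({#\<gamma>#}, {#\<gamma>'#})"
    unfolding equiv_gap_def using tail_equiv_singleton[of \<gamma> \<gamma>' \<delta>] by auto
  then show ?thesis
    unfolding block_partial_iso_def gap_preserving_def endpoints_def by auto
qed

lemma block_partial_iso_diagonal:
  assumes "finite F" "F \<subseteq> {..{#\<gamma>#}}"
  shows "block_partial_iso \<delta> \<gamma> \<gamma> ((\<lambda>w. (w, w)) ` F)"
proof -
  have "gap_preserving \<delta> (endpoints \<gamma> \<gamma> \<union> (\<lambda>w. (w, w)) ` F)"
    by (rule gap_preserving_diagonal) (auto simp: endpoints_def)
  then show ?thesis unfolding block_partial_iso_def using assms by auto
qed

lemma block_partial_iso_extend:
  assumes q: "block_partial_iso \<delta> \<gamma> \<gamma>' q" and less: "\<delta>' < \<delta>" and F: "finite F" "F \<subseteq> {..{#\<gamma>#}}"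
  obtains q' where "q \<subseteq> q'" "block_partial_iso \<delta>' \<gamma> \<gamma>' q'" "F \<subseteq> fst ` q'"
proof -
  let ?Q = "endpoints \<gamma> \<gamma>' \<union> q" and ?xs = "sorted_list_of_set F"
  have finite: "finite ?Q" and gaps: "gap_preserving \<delta> ?Q"
    using q by (auto simp: block_partial_iso_def endpoints_def)
  have "\<exists>Q'. ?Q \<subseteq> Q' \<and> finite Q' \<and> gap_preserving \<delta>' Q' \<and> set ?xs \<subseteq> fst ` Q' \<and> fst ` Q' \<subseteq> fst ` ?Q \<union> set ?xs"
  proof (rule gap_preserving_insert_list[OF finite _ less])
    show "gap_preserving \<delta>' ?Q" using gaps less by (auto intro: gap_preserving_mono)
    show "gap_preserving \<delta> {p \<in> ?Q. {#} \<le> fst p}" using gaps by (auto intro: gap_preserving_mono)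
    show "{#} \<in> fst ` ?Q" "{#\<gamma>#} \<in> fst ` ?Q" by (auto simp: endpoints_def)
    show "sorted ({#} # ?xs)" "\<forall>x\<in>set ?xs. x \<le> {#\<gamma>#}" using F by auto
  qed
  then obtain Q' where Q': "?Q \<subseteq> Q'" "finite Q'" "gap_preserving \<delta>' Q'" "F \<subseteq> fst ` Q'" "fst ` Q' \<subseteq> fst ` ?Q \<union> F"
    using F(1) by auto
  have ends: "({#\<gamma>#}, {#\<gamma>'#}) \<in> Q'" using Q'(1) by (auto simp: endpoints_def)
  have "fst ` ?Q \<subseteq> {..{#\<gamma>#}}" using q by (auto simp: block_partial_iso_def endpoints_def)
  then have fst_le: "fst p \<le> {#\<gamma>#}" if "p \<in> Q'" for p using that Q'(5) F(2) by blast
  moreover have "snd p \<le> {#\<gamma>'#}" if "p \<in> Q'" for p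
    using gap_preserving_le_iff[OF Q'(3) that ends] fst_le[OF that] by simp
  ultimately have "Q' \<subseteq> {..{#\<gamma>#}} \<times> {..{#\<gamma>'#}}" by auto
  moreover have "endpoints \<gamma> \<gamma>' \<union> Q' = Q'" using Q'(1) by blast
  ultimately have "block_partial_iso \<delta>' \<gamma> \<gamma>' Q'" unfolding block_partial_iso_def using Q'(2,3) by simp
  then show ?thesis using that Q'(1,4) by blast
qed


section \<open>Back-and-forth between sums\<close>

definition label_iso :: "omega1 \<Rightarrow> index set \<Rightarrow> index set \<Rightarrow> (index \<Rightarrow> index) \<Rightarrow> bool" where
  "label_iso \<delta> I I' f \<longleftrightarrow>
     rel_iso f I index_le I' index_le \<and> (\<forall>i\<in>I. min (label_of i) \<delta> = min (label_of (f i)) \<delta>)"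

lemma label_iso_mono:
  assumes "label_iso \<delta> I I' f" "\<delta>' \<le> \<delta>"
  shows "label_iso \<delta>' I I' f"
proof -
  have "min \<gamma> \<delta>' = min (min \<gamma> \<delta>) \<delta>'" for \<gamma> using assms(2) by (simp add: min.assoc min.absorb2)
  then show ?thesis using assms(1) unfolding label_iso_def by metis
qed

lemma label_iso_inv_into:
  assumes f: "label_iso \<delta> I I' f"
  shows "label_iso \<delta> I' I (inv_into I f)"
  unfolding label_iso_def
proof (intro conjI ballI)
  have iso: "rel_iso f I index_le I' index_le" using f by (simp add: label_iso_def)
  show "rel_iso (inv_into I f) I' index_le I index_le" by (rule rel_iso_inv_into[OF iso])
  fix j assume "j \<in> I'"
  then have "inv_into I f j \<in> I" "f (inv_into I f j) = j"
    unfolding rel_iso_image[OF iso, symmetric] by (simp_all add: inv_into_into f_inv_into_f)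
  then show "min (label_of j) \<delta> = min (label_of (inv_into I f j)) \<delta>"
    using f unfolding label_iso_def by force
qed

lemma label_iso_less_iff:
  assumes "label_iso \<delta> I I' f" "i \<in> I" "j \<in> I"
  shows "index_less (f i) (f j) \<longleftrightarrow> index_less i j"
proof -
  have iso: "rel_iso f I index_le I' index_le" using assms(1) by (simp add: label_iso_def)
  show ?thesis
    using rel_iso_le_iff[OF iso assms(2,3)] rel_iso_eq_iff[OF iso assms(2,3)] by auto
qed

definition sum_map ::
  "index set \<Rightarrow> (index \<Rightarrow> index) \<Rightarrow> (index \<Rightarrow> (omega1 multiset \<times> omega1 multiset) set) \<Rightarrow> (elem \<times> elem) set" where
  "sum_map I f Q = {((i, w), (f i, v)) | i w v. i \<in> I \<and> (w, v) \<in> Q i}"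

definition sum_partial_iso :: "index set \<Rightarrow> index set \<Rightarrow> omega1 \<Rightarrow> (elem \<times> elem) set \<Rightarrow> bool" where
  "sum_partial_iso I I' \<delta> p \<longleftrightarrow> (\<exists>f Q. label_iso \<delta> I I' f \<and>
     (\<forall>i\<in>I. block_partial_iso \<delta> (label_of i) (label_of (f i)) (Q i)) \<and> p = sum_map I f Q)"

lemma mem_sum_map [simp]: "((i, w), (j, v)) \<in> sum_map I f Q \<longleftrightarrow> i \<in> I \<and> j = f i \<and> (w, v) \<in> Q i"
  unfolding sum_map_def by blast

lemma sum_partial_isoE:
  assumes "sum_partial_iso I I' \<delta> p"
  obtains f Q where "label_iso \<delta> I I' f" "\<And>i. i \<in> I \<Longrightarrow> block_partial_iso \<delta> (label_of i) (label_of (f i)) (Q i)"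
    "p = sum_map I f Q"
  using assms unfolding sum_partial_iso_def by (elim exE conjE) (rule that, blast+)

lemma sum_partial_iso_mono:
  assumes "sum_partial_iso I I' \<delta> p" "\<delta>' \<le> \<delta>"
  shows "sum_partial_iso I I' \<delta>' p"
proof -
  obtain f Q where f: "label_iso \<delta> I I' f" and
    Q: "\<And>i. i \<in> I \<Longrightarrow> block_partial_iso \<delta> (label_of i) (label_of (f i)) (Q i)" and p: "p = sum_map I f Q"
    using assms(1) by (rule sum_partial_isoE) (rule that)
  show ?thesis
    using label_iso_mono[OF f assms(2)] block_partial_iso_mono[OF Q assms(2)] p unfolding sum_partial_iso_def
    by blast
qed

lemma sum_partial_iso_subset:
  assumes "sum_partial_iso I I' \<delta> p"
  shows "p \<subseteq> blocks I \<times> blocks I'"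
proof -
  obtain f Q where f: "label_iso \<delta> I I' f" and
    Q: "\<And>i. i \<in> I \<Longrightarrow> block_partial_iso \<delta> (label_of i) (label_of (f i)) (Q i)" and p: "p = sum_map I f Q"
    using assms by (rule sum_partial_isoE) (rule that)
  have "f i \<in> I'" if "i \<in> I" for i using f that by (auto simp: label_iso_def rel_iso_mem)
  then show ?thesis using Q unfolding p by (force simp: sum_map_def block_partial_iso_def)
qed

lemma sum_partial_iso_converse:
  assumes "sum_partial_iso I I' \<delta> p"
  shows "sum_partial_iso I' I \<delta> (p\<inverse>)"
proof -
  obtain f Q where f: "label_iso \<delta> I I' f" and
    Q: "\<And>i. i \<in> I \<Longrightarrow> block_partial_iso \<delta> (label_of i) (label_of (f i)) (Q i)" and p: "p = sum_map I f Q"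
    using assms by (rule sum_partial_isoE) (rule that)
  let ?g = "inv_into I f"
  have bij: "bij_betw f I I'" using f by (simp add: label_iso_def rel_iso_def)
  have g: "?g j \<in> I" "f (?g j) = j" if "j \<in> I'" for j
    using bij that by (auto simp: bij_betw_def inv_into_into f_inv_into_f)
  have "block_partial_iso \<delta> (label_of j) (label_of (?g j)) ((Q (?g j))\<inverse>)" if "j \<in> I'" for j
    using block_partial_iso_converse[OF Q[OF g(1)[OF that]]] g(2)[OF that] by simp
  moreover have "p\<inverse> = sum_map I' ?g (\<lambda>j. (Q (?g j))\<inverse>)"
  proof -
    have graph: "i \<in> I \<and> j = f i \<longleftrightarrow> j \<in> I' \<and> i = ?g j" for i j
      using g bij by (auto simp: bij_betw_def inv_into_f_f)
    have "((j, v), (i, w)) \<in> p\<inverse> \<longleftrightarrow> ((j, v), (i, w)) \<in> sum_map I' ?g (\<lambda>j. (Q (?g j))\<inverse>)" for i j v w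
      unfolding p converse_iff mem_sum_map using graph[of i j] by auto
    then show ?thesis by (intro set_eqI) (metis surj_pair)
  qed
  ultimately show ?thesis
    unfolding sum_partial_iso_def using label_iso_inv_into[OF f]
    by (intro exI[of _ ?g] exI[of _ "\<lambda>j. (Q (?g j))\<inverse>"]) blast
qed

lemma sum_partial_iso_forth:
  assumes "sum_partial_iso I I' \<delta> p" "\<delta>' < \<delta>" "finite F" "F \<subseteq> blocks I"
  shows "\<exists>q. p \<subseteq> q \<and> sum_partial_iso I I' \<delta>' q \<and> F \<subseteq> Domain q"
proof -
  obtain f Q where f: "label_iso \<delta> I I' f" and
    Q: "\<And>i. i \<in> I \<Longrightarrow> block_partial_iso \<delta> (label_of i) (label_of (f i)) (Q i)" and p: "p = sum_map I f Q"
    using assms(1) by (rule sum_partial_isoE) (rule that)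
  let ?fibre = "\<lambda>i. {w. (i, w) \<in> F}"
  have extend: "\<exists>q. Q i \<subseteq> q \<and> block_partial_iso \<delta>' (label_of i) (label_of (f i)) q \<and> ?fibre i \<subseteq> fst ` q"
    if i: "i \<in> I" for i
  proof -
    have "?fibre i \<subseteq> snd ` F" by force
    then have "finite (?fibre i)" using assms(3) by (simp add: finite_subset)
    moreover have "?fibre i \<subseteq> {..{#label_of i#}}" using assms(4) by auto
    ultimately show ?thesis using block_partial_iso_extend[OF Q[OF i] assms(2)] by metis
  qed
  then obtain Q' where Q': "\<forall>i\<in>I. Q i \<subseteq> Q' i \<and>
      block_partial_iso \<delta>' (label_of i) (label_of (f i)) (Q' i) \<and> ?fibre i \<subseteq> fst ` Q' i"
    using bchoice[of I "\<lambda>i q. Q i \<subseteq> q \<and> block_partial_iso \<delta>' (label_of i) (label_of (f i)) q \<and> ?fibre i \<subseteq> fst ` q"]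
    by blast
  have "F \<subseteq> Domain (sum_map I f Q')"
  proof
    fix a assume a: "a \<in> F"
    obtain i w where iw: "a = (i, w)" by (cases a)
    then have "i \<in> I" using a assms(4) by auto
    then obtain v where "(w, v) \<in> Q' i" using Q' a iw by force
    then have "(a, (f i, v)) \<in> sum_map I f Q'" using \<open>i \<in> I\<close> iw by simp
    then show "a \<in> Domain (sum_map I f Q')" by blast
  qed
  moreover have "p \<subseteq> sum_map I f Q'" using Q' unfolding p sum_map_def by blast
  moreover have "sum_partial_iso I I' \<delta>' (sum_map I f Q')"
    unfolding sum_partial_iso_def using label_iso_mono[OF f less_imp_le[OF assms(2)]] Q' by blast
  ultimately show ?thesis by blast
qed

lemma sum_partial_iso_back:
  assumes "sum_partial_iso I I' \<delta> p" "\<delta>' < \<delta>" "finite F" "F \<subseteq> blocks I'"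
  shows "\<exists>q. p \<subseteq> q \<and> sum_partial_iso I I' \<delta>' q \<and> F \<subseteq> Range q"
proof -
  obtain q where "p\<inverse> \<subseteq> q" "sum_partial_iso I' I \<delta>' q" "F \<subseteq> Domain q"
    using sum_partial_iso_forth[OF sum_partial_iso_converse[OF assms(1)] assms(2-4)] by blast
  then show ?thesis by (intro exI[of _ "q\<inverse>"]) (auto intro: sum_partial_iso_converse)
qed

lemma sum_partial_iso_partial_rel_iso:
  assumes p: "sum_partial_iso I I' \<delta> p"
  shows "partial_rel_iso (blocks_le I) (blocks_le I') p"
proof -
  obtain f Q where f: "label_iso \<delta> I I' f" and
    Q: "\<And>i. i \<in> I \<Longrightarrow> block_partial_iso \<delta> (label_of i) (label_of (f i)) (Q i)" and p_eq: "p = sum_map I f Q"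
    using p by (rule sum_partial_isoE) (rule that)
  have inj: "f i = f j \<longleftrightarrow> i = j" if "i \<in> I" "j \<in> I" for i j
    using f that rel_iso_eq_iff[of f I index_le I' index_le i j] unfolding label_iso_def by blast
  have fibre: "(w \<le> w' \<longleftrightarrow> v \<le> v') \<and> (w = w' \<longleftrightarrow> v = v')" if "i \<in> I" "(w, v) \<in> Q i" "(w', v') \<in> Q i" for i w v w' v'
  proof -
    have "gap_preserving \<delta> (endpoints (label_of i) (label_of (f i)) \<union> Q i)"
      using Q[OF that(1)] by (simp add: block_partial_iso_def)
    then show ?thesis
      using that gap_preserving_le_iff[of \<delta> _ "(w, v)" "(w', v')"]
        gap_preserving_eq_iff[of \<delta> _ "(w, v)" "(w', v')"] by simp
  qed
  show ?thesis
    unfolding partial_rel_iso_def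
  proof (intro allI impI)
    fix a b a' b' assume ab: "(a, b) \<in> p" "(a', b') \<in> p"
    then have blocks: "a \<in> blocks I" "b \<in> blocks I'" "a' \<in> blocks I" "b' \<in> blocks I'"
      using sum_partial_iso_subset[OF p] by blast+
    obtain i w v where iw: "a = (i, w)" "b = (f i, v)" "i \<in> I" "(w, v) \<in> Q i"
      using ab(1) by (auto simp: p_eq sum_map_def)
    obtain i' w' v' where iw': "a' = (i', w')" "b' = (f i', v')" "i' \<in> I" "(w', v') \<in> Q i'"
      using ab(2) by (auto simp: p_eq sum_map_def)
    show "(a = a' \<longleftrightarrow> b = b') \<and> ((a, a') \<in> blocks_le I \<longleftrightarrow> (b, b') \<in> blocks_le I')"
      using blocks inj[OF iw(3) iw'(3)] label_iso_less_iff[OF f iw(3) iw'(3)] fibre[OF iw(3,4)] iw'(4)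
      unfolding iw(1,2) iw'(1,2) mem_blocks_le by auto
  qed
qed

context limit_orders
begin

definition shift :: "int \<Rightarrow> index \<Rightarrow> index" where
  "shift k i = (if summand i = l then (l, position i + of_int k, label_of i) else i)"

definition translate :: "int \<Rightarrow> elem \<Rightarrow> elem" where
  "translate k a = (shift k (fst a), snd a)"

lemma shift_simps [simp]: "summand (shift k i) = summand i" "label_of (shift k i) = label_of i"
  by (auto simp: shift_def)

lemma shift_less_iff [simp]: "index_less (shift k i) (shift k j) \<longleftrightarrow> index_less i j"
  by (auto simp: shift_def index_less_def)

lemma shift_shift: "shift k (shift (- k) i) = i" "shift (- k) (shift k i) = i"
  by (cases i, auto simp: shift_def)+

lemma shift_mem_indices [simp]: "shift k i \<in> indices \<longleftrightarrow> i \<in> indices"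
proof -
  have closed: "shift k i \<in> indices" if "i \<in> indices" for k i
    using that positions_shift by (auto simp: indices_def shift_def)
  show ?thesis using closed[of i k] closed[of "shift k i" "- k"] shift_shift(2) by metis
qed

lemma shift_rel_iso: "rel_iso (shift k) indices index_le indices index_le"
proof (rule rel_isoI)
  show "bij_betw (shift k) indices indices"
    by (rule bij_betw_byWitness[where f' = "shift (- k)"]) (auto simp: shift_shift)
  fix i j
  have "shift k i = shift k j \<longleftrightarrow> i = j" using shift_shift(2) by metis
  then show "(i, j) \<in> index_le \<longleftrightarrow> (shift k i, shift k j) \<in> index_le" by simp
qed

text \<open>The part of \<open>Q\<^sub>l\<close> beyond the cut at \<open>c\<close> belongs to zone 1, where Cantor's back-and-forth
  argument absorbs it; zones 0 and 2 are merely shifted.\<close>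

definition zone :: "omega1 \<Rightarrow> real \<Rightarrow> index \<Rightarrow> nat" where
  "zone \<beta> c i = (if summand i = l \<and> position i \<le> c then 0 else if \<beta> \<le> summand i then 1 else 2)"

lemma index_le_iff_zone_less:
  assumes "\<beta> < l" "i \<in> indices" "j \<in> indices" "zone \<beta> c i \<noteq> zone \<beta> c j"
  shows "(i, j) \<in> index_le \<longleftrightarrow> zone \<beta> c i < zone \<beta> c j"
proof -
  have less: "index_less i j" if "i \<in> indices" "j \<in> indices" "zone \<beta> c i < zone \<beta> c j" for i j
    using assms(1) that by (auto simp: zone_def index_less_def indices_def split: if_splits)
  show ?thesis
  proof (cases "zone \<beta> c i < zone \<beta> c j")
    case True
    then show ?thesis using less[OF assms(2,3)] by simp
  next
    case False
    then have "index_less j i" using assms(4) by (intro less[OF assms(3,2)]) simp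
    then show ?thesis using False index_less_asym[of j i] by auto
  qed
qed

lemma labelled_dense_indices:
  assumes T: "T \<noteq> {}" "T \<subseteq> {\<delta>..l}" "\<delta> < l" and U: "\<And>\<beta>. open (U \<beta>)" "\<And>\<beta>. U \<beta> \<noteq> {}"
    and U_convex: "\<And>\<beta> x y z. x \<in> U \<beta> \<Longrightarrow> z \<in> U \<beta> \<Longrightarrow> x < y \<Longrightarrow> y < z \<Longrightarrow> y \<in> U \<beta>"
  shows "labelled_dense {i \<in> indices. summand i \<in> T \<and> position i \<in> U (summand i)} index_le
    (\<lambda>i. min (label_of i) \<delta>) {..\<delta>}" (is "labelled_dense ?M _ _ _")
proof -
  have "dense_unbounded (\<lambda>i. min (label_of i) \<delta> = \<gamma>) ?M index_le" if \<gamma>: "\<gamma> \<le> \<delta>" for \<gamma>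
  proof (rule dense_unbounded_mono)
    show "dense_unbounded (\<lambda>i. label_of i = \<gamma>) ?M index_le"
    proof (rule dense_unbounded_indices[OF T(1) _ _ _ U U_convex])
      show "T \<subseteq> {..l}" using T(2) by auto
      show "\<gamma> < l" using \<gamma> T(3) by (rule order.strict_trans1)
      show "\<gamma> \<le> \<beta>" if "\<beta> \<in> T" for \<beta> using \<gamma> T(2) that by (meson atLeastAtMost_iff order.trans subsetD)
    qed
  qed (use \<gamma> in auto)
  then show ?thesis unfolding labelled_dense_def by auto
qed

lemma middle_zone_iso:
  assumes "\<delta> \<le> \<beta>" "\<beta> < l"
  obtains h where
    "rel_iso h {i \<in> cut_indices. zone \<beta> (position cut) i = 1} index_le {i \<in> indices. zone \<beta> c i = 1} index_le"
    "\<And>i. i \<in> cut_indices \<Longrightarrow> zone \<beta> (position cut) i = 1 \<Longrightarrow> min (label_of (h i)) \<delta> = min (label_of i) \<delta>"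
proof -
  define U where "U \<alpha> = (if \<alpha> = l then {c<..} else UNIV)" for \<alpha>
  let ?M = "{i \<in> indices. summand i \<in> {\<beta>..<l} \<and> position i \<in> UNIV}"
  let ?M' = "{i \<in> indices. summand i \<in> {\<beta>..l} \<and> position i \<in> U (summand i)}"
  have M: "labelled_dense ?M index_le (\<lambda>i. min (label_of i) \<delta>) {..\<delta>}"
    by (rule labelled_dense_indices) (use assms in auto)
  have M': "labelled_dense ?M' index_le (\<lambda>i. min (label_of i) \<delta>) {..\<delta>}"
    by (rule labelled_dense_indices) (use assms gt_ex[of c] in \<open>auto simp: U_def\<close>)
  have sub: "?M \<subseteq> indices" "?M' \<subseteq> indices" by auto
  have zones: "{i \<in> cut_indices. zone \<beta> (position cut) i = 1} = ?M" "{i \<in> indices. zone \<beta> c i = 1} = ?M'"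
    using assms(2) by (auto simp: zone_def cut_indices_def indices_def U_def)
  obtain h where h: "rel_iso h ?M index_le ?M' index_le"
    "\<And>i. i \<in> ?M \<Longrightarrow> min (label_of (h i)) \<delta> = min (label_of i) \<delta>"
    by (rule labelled_cantor[OF linearly_ordered_indices[OF sub(1)] countable_subset[OF sub(1) countable_indices] M
          linearly_ordered_indices[OF sub(2)] countable_subset[OF sub(2) countable_indices] M']) (rule that)
  show ?thesis
  proof (rule that[of h])
    show "rel_iso h {i \<in> cut_indices. zone \<beta> (position cut) i = 1} index_le {i \<in> indices. zone \<beta> c i = 1} index_le"
      unfolding zones by (rule h(1))
    show "min (label_of (h i)) \<delta> = min (label_of i) \<delta>"
      if "i \<in> cut_indices" "zone \<beta> (position cut) i = 1" for i
      using that zones(1) by (intro h(2)) blast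
  qed
qed

lemma outer_zone_iso:
  assumes "\<beta> < l" and z: "z \<in> {0, 2}"
  shows "rel_iso (shift k) {i \<in> cut_indices. zone \<beta> (position cut) i = z} index_le
    {i \<in> indices. zone \<beta> (position cut + of_int k) i = z} index_le"
proof -
  have "{i \<in> cut_indices. zone \<beta> (position cut) i = z} = {i \<in> indices. zone \<beta> (position cut) i = z}"
    using assms by (auto simp: cut_indices_def zone_def)
  moreover have "zone \<beta> (position cut + of_int k) (shift k i) = z \<longleftrightarrow> zone \<beta> (position cut) i = z" for i
    by (auto simp: zone_def shift_def)
  ultimately show ?thesis
    using rel_iso_Collect[OF shift_rel_iso, where P = "\<lambda>i. zone \<beta> (position cut) i = z"
        and Q = "\<lambda>i. zone \<beta> (position cut + of_int k) i = z"] by simp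
qed

lemma zones_glue:
  assumes "\<beta> < l" and c': "c' = position cut + of_int k"
    and h: "rel_iso h {i \<in> cut_indices. zone \<beta> (position cut) i = 1} index_le
      {i \<in> indices. zone \<beta> c' i = 1} index_le"
  shows "rel_iso (\<lambda>i. (if zone \<beta> (position cut) i = 1 then h else shift k) i) cut_indices index_le indices index_le"
proof (rule rel_iso_glue[where g = "\<lambda>z. if z = 1 then h else shift k"])
  let ?zone = "zone \<beta> (position cut)" and ?zone' = "zone \<beta> c'"
  show "?zone ` cut_indices \<subseteq> {0, 1, 2}" "?zone' ` indices \<subseteq> {0, 1, 2}" by (auto simp: zone_def)
  show "rel_iso (if z = 1 then h else shift k) {i \<in> cut_indices. ?zone i = z} index_le
      {i \<in> indices. ?zone' i = z} index_le"
    if "z \<in> {0, 1, 2}" for z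
    using h outer_zone_iso[OF assms(1), of z k] that by (auto simp: c')
  fix i j i' j' assume ij: "i \<in> cut_indices" "j \<in> cut_indices" "i' \<in> indices" "j' \<in> indices"
    "?zone' i' = ?zone i" "?zone' j' = ?zone j" "?zone i \<noteq> ?zone j"
  have "(i, j) \<in> index_le \<longleftrightarrow> ?zone i < ?zone j"
    using ij(1,2,7) cut_indices_subset by (intro index_le_iff_zone_less[OF assms(1)]) auto
  moreover have "(i', j') \<in> index_le \<longleftrightarrow> ?zone' i' < ?zone' j'"
    using ij(5-7) by (intro index_le_iff_zone_less[OF assms(1) ij(3,4)]) argo
  ultimately show "(i, j) \<in> index_le \<longleftrightarrow> (i', j') \<in> index_le"
    unfolding ij(5,6) by (rule trans[OF _ sym])
qed

lemma ex_label_iso_extending_shift: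
  assumes "\<delta> < l" and G: "finite G" "G \<subseteq> cut_indices"
  obtains f where "label_iso \<delta> cut_indices indices f" "\<And>i. i \<in> G \<Longrightarrow> f i = shift k i"
proof -
  let ?X = "insert \<delta> (summand ` {i \<in> G. summand i < l})" and ?c = "position cut"
  obtain \<beta> where \<beta>: "\<beta> < l" "\<forall>x\<in>?X. x < \<beta>"
    using limit_ord_finite_bound[OF limit, of ?X] G(1) assms(1) by auto
  then have "\<delta> \<le> \<beta>" by (simp add: less_imp_le)
  then obtain h where h: "rel_iso h {i \<in> cut_indices. zone \<beta> ?c i = 1} index_le
      {i \<in> indices. zone \<beta> (?c + of_int k) i = 1} index_le"
    "\<And>i. i \<in> cut_indices \<Longrightarrow> zone \<beta> ?c i = 1 \<Longrightarrow> min (label_of (h i)) \<delta> = min (label_of i) \<delta>"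
    using \<beta>(1) by (rule middle_zone_iso) (rule that)
  define f where "f i = (if zone \<beta> ?c i = 1 then h else shift k) i" for i
  have "rel_iso f cut_indices index_le indices index_le"
    unfolding f_def by (rule zones_glue[OF \<beta>(1) refl h(1)])
  moreover have "min (label_of i) \<delta> = min (label_of (f i)) \<delta>" if "i \<in> cut_indices" for i
    using h(2)[OF that] by (simp add: f_def)
  moreover have "f i = shift k i" if "i \<in> G" for i
  proof -
    have i: "i \<in> cut_indices" using that G(2) by blast
    have "zone \<beta> ?c i \<noteq> 1"
    proof (cases "summand i = l")
      case True
      then show ?thesis using i by (simp add: zone_def cut_indices_def)
    next
      case False
      then have "summand i \<in> ?X" using i that by (auto simp: cut_indices_def indices_def order_le_less)
      with \<beta>(2) have "summand i < \<beta>" by (rule bspec)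
      then show ?thesis by (auto simp: zone_def)
    qed
    then show ?thesis by (simp add: f_def)
  qed
  ultimately show ?thesis using that[of f] unfolding label_iso_def by blast
qed

lemma sum_partial_iso_translate:
  assumes "\<delta> < l" and F: "finite F" "F \<subseteq> cut_order"
  shows "sum_partial_iso cut_indices indices \<delta> ((\<lambda>a. (a, translate k a)) ` F)"
proof -
  have "finite (fst ` F)" "fst ` F \<subseteq> cut_indices" using F by (auto simp: blocks_def)
  then obtain f where f: "label_iso \<delta> cut_indices indices f" "\<And>i. i \<in> fst ` F \<Longrightarrow> f i = shift k i"
    by (rule ex_label_iso_extending_shift[OF assms(1)]) (rule that)
  define Q where "Q i = (\<lambda>w. (w, w)) ` {w. (i, w) \<in> F}" for i
  have "block_partial_iso \<delta> (label_of i) (label_of (f i)) (Q i)" if i: "i \<in> cut_indices" for i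
  proof (cases "i \<in> fst ` F")
    case True
    have "{w. (i, w) \<in> F} \<subseteq> snd ` F" by force
    then have "finite {w. (i, w) \<in> F}" using F(1) by (simp add: finite_subset)
    moreover have "{w. (i, w) \<in> F} \<subseteq> {..{#label_of i#}}" using F(2) by auto
    ultimately show ?thesis using block_partial_iso_diagonal f(2)[OF True] by (simp add: Q_def)
  next
    case False
    then have "{w. (i, w) \<in> F} = {}" by force
    then show ?thesis using block_partial_iso_empty f(1) i by (simp add: Q_def label_iso_def)
  qed
  moreover have "(\<lambda>a. (a, translate k a)) ` F = sum_map cut_indices f Q"
  proof (intro equalityI subsetI)
    fix x assume "x \<in> (\<lambda>a. (a, translate k a)) ` F"
    then obtain i w where iw: "x = ((i, w), (shift k i, w))" "(i, w) \<in> F" by (auto simp: translate_def)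
    then have "i \<in> fst ` F" "i \<in> cut_indices" using F(2) by force+
    then show "x \<in> sum_map cut_indices f Q" using f(2)[of i] iw by (simp add: Q_def)
  next
    fix x assume "x \<in> sum_map cut_indices f Q"
    then obtain i w where iw: "x = ((i, w), (f i, w))" "(i, w) \<in> F" unfolding sum_map_def Q_def by blast
    then have "i \<in> fst ` F" by force
    then have "x = ((i, w), translate k (i, w))" using f(2)[of i] iw(1) by (simp add: translate_def)
    with iw(2) show "x \<in> (\<lambda>a. (a, translate k a)) ` F" by blast
  qed
  ultimately show ?thesis unfolding sum_partial_iso_def using f(1) by blast
qed

lemma translate_covers_finite:
  assumes "finite F" "F \<subseteq> full_order"
  shows "\<exists>k. F \<subseteq> translate k ` cut_order"
proof -
  have "finite ((\<lambda>a. position (fst a)) ` F)" using assms(1) by simp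
  then obtain M where M: "\<And>a. a \<in> F \<Longrightarrow> position (fst a) \<le> M"
    by (metis (no_types, lifting) Max_ge image_eqI)
  define k where "k = \<lceil>M - position cut\<rceil>"
  have k: "M - of_int k \<le> position cut" unfolding k_def by linarith
  have "a \<in> translate k ` cut_order" if a: "a \<in> F" for a
  proof (rule image_eqI)
    show "a = translate k (shift (- k) (fst a), snd a)" by (simp add: translate_def shift_shift(1))
    have "fst a \<in> indices" "snd a \<le> {#label_of (fst a)#}" using a assms(2) by (auto simp: blocks_def)
    moreover have "position (shift (- k) (fst a)) \<le> position cut" if "summand (fst a) = l"
      using M[OF a] k that by (simp add: shift_def)
    ultimately show "(shift (- k) (fst a), snd a) \<in> cut_order" by (simp add: cut_indices_def)
  qed
  then show ?thesis by blast
qed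

text \<open>A partial isomorphism of level \<open>l\<close> itself would make the two orders isomorphic; having all levels \<open>\<delta> < l\<close>
  suffices at the limit.\<close>

definition limit_partial_iso :: "omega1 \<Rightarrow> (elem \<times> elem) set \<Rightarrow> bool" where
  "limit_partial_iso \<alpha> p \<longleftrightarrow> \<alpha> \<le> l \<and> (\<forall>\<delta><l. \<delta> \<le> \<alpha> \<longrightarrow> sum_partial_iso cut_indices indices \<delta> p)"

lemma limit_partial_iso_imp_zero: "limit_partial_iso \<alpha> p \<Longrightarrow> sum_partial_iso cut_indices indices 0 p"
  using limit_ord_pos[OF limit] by (simp add: limit_partial_iso_def omega1_zero_le)

lemma limit_partial_iso_imp_succ:
  assumes "limit_partial_iso \<alpha> p" "\<beta> < \<alpha>"
  shows "sum_partial_iso cut_indices indices (succ_ord \<beta>) p"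
proof -
  have "\<beta> < l" using assms by (auto simp: limit_partial_iso_def)
  then show ?thesis
    using assms limit_ord_succ[OF limit] by (simp add: limit_partial_iso_def succ_ord_le_iff)
qed

lemma limit_partial_isoI:
  assumes "sum_partial_iso cut_indices indices \<beta> p" "\<beta> \<le> l"
  shows "limit_partial_iso \<beta> p"
  unfolding limit_partial_iso_def using assms sum_partial_iso_mono[OF assms(1)] by blast

lemma back_forth_system_limit_partial_iso:
  "back_forth_system cut_order cut_le full_order full_le limit_partial_iso"
proof
  fix \<alpha> p assume p: "limit_partial_iso \<alpha> p"
  show "p \<subseteq> cut_order \<times> full_order"
    by (rule sum_partial_iso_subset[OF limit_partial_iso_imp_zero[OF p]])
  show "partial_rel_iso cut_le full_le p"
    by (rule sum_partial_iso_partial_rel_iso[OF limit_partial_iso_imp_zero[OF p]])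
  fix \<beta> and F :: "elem set"
  assume "\<beta> < \<alpha>" "finite F"
  then have step: "sum_partial_iso cut_indices indices (succ_ord \<beta>) p" "\<beta> \<le> l"
    using p by (auto simp: limit_partial_iso_def intro: limit_partial_iso_imp_succ)
  show "\<exists>q. p \<subseteq> q \<and> limit_partial_iso \<beta> q \<and> F \<subseteq> Domain q" if "F \<subseteq> cut_order"
    using sum_partial_iso_forth[OF step(1) less_succ_ord \<open>finite F\<close> that] limit_partial_isoI[OF _ step(2)] by blast
  show "\<exists>q. p \<subseteq> q \<and> limit_partial_iso \<beta> q \<and> G \<subseteq> Range q" if "finite G" "G \<subseteq> full_order" for G
    using sum_partial_iso_back[OF step(1) less_succ_ord that] limit_partial_isoI[OF _ step(2)] by blast
qed

theorem models_Pi_cut_imp_full: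
  assumes "Pi_in (succ_ord (succ_ord l)) \<phi>" "sentence \<phi>" "models cut_order cut_le \<phi>"
  shows "models full_order full_le \<phi>"
proof -
  interpret back_forth_system cut_order cut_le full_order full_le limit_partial_iso
    by (rule back_forth_system_limit_partial_iso)
  interpret covering_maps cut_order cut_le full_order full_le "range translate" l
  proof
    show "\<exists>h\<in>range translate. F \<subseteq> h ` cut_order" if "finite F" "F \<subseteq> full_order" for F
      using translate_covers_finite[OF that] by blast
    show "h a \<in> full_order" if "h \<in> range translate" "a \<in> cut_order" for h a
      using that cut_indices_subset by (auto simp: translate_def blocks_def)
    fix h \<gamma> \<psi> and e :: "nat \<Rightarrow> elem"
    assume "h \<in> range translate" and \<psi>: "Pi_in \<gamma> \<psi>" "\<gamma> \<le> l" "finite (fv \<psi>)"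
      and e: "range e \<subseteq> cut_order" "sat cut_order cut_le \<psi> e"
    then obtain k where k: "h = translate k" by blast
    let ?p = "(\<lambda>a. (a, translate k a)) ` e ` fv \<psi>"
    have "limit_partial_iso \<gamma> ?p"
      unfolding limit_partial_iso_def using \<psi>(2,3) e(1) by (auto intro!: sum_partial_iso_translate)
    then show "sat full_order full_le \<psi> (h \<circ> e)"
      using sat_Pi_agree[OF \<psi>(1), of ?p e "h \<circ> e"] e(2) k by auto
  qed
  show ?thesis using assms by (rule models_Pi_transfer)
qed

end


section \<open>Scott sentences\<close>

lemma rel_iso_dir_image:
  assumes "inj_on h A"
  shows "rel_iso h A R (h ` A) (dir_image (Restr R A) h)"
proof (rule rel_isoI)
  show "bij_betw h A (h ` A)" using assms by (rule inj_on_imp_bij_betw)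
  show "(x, y) \<in> R \<longleftrightarrow> (h x, h y) \<in> dir_image (Restr R A) h" if "x \<in> A" "y \<in> A" for x y
    using inj_onD[OF assms] that unfolding dir_image_def by blast
qed

lemma ex_countable_linear_order_copy:
  assumes "countable A" "linear_order_on A R"
  obtains A' :: "nat set" and R' where "isomorphic A R A' R'" "linear_order_on A' R'"
proof -
  let ?h = "to_nat_on A"
  have inj: "inj_on ?h A" using assms(1) by (rule inj_on_to_nat_on)
  have R: "R \<subseteq> A \<times> A" "Field R = A"
    using assms(2) by (auto simp: order_on_defs refl_on_def Field_def)
  then have "Restr R A = R" by blast
  then have "isomorphic A R (?h ` A) (dir_image R ?h)"
    using isomorphicI[OF rel_iso_dir_image[OF inj, of R]] by simp
  moreover have "linear_order_on (?h ` A) (dir_image R ?h)"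
    using Linear_order_dir_image[of R ?h] assms(2) inj R(2) by (simp add: dir_image_Field)
  ultimately show ?thesis by (rule that)
qed

lemma scott_sentence_models_iff:
  assumes \<phi>: "scott_sentence A R \<phi>" and B: "countable B" "B \<noteq> {}"
  shows "models B S \<phi> \<longleftrightarrow> isomorphic A R B S"
proof -
  let ?h = "to_nat_on B"
  let ?B = "?h ` B" and ?S = "dir_image (Restr S B) ?h"
  have copy: "isomorphic B S ?B ?S"
    by (rule isomorphicI[OF rel_iso_dir_image[OF inj_on_to_nat_on[OF B(1)]]])
  have "models B S \<phi> \<longleftrightarrow> models ?B ?S \<phi>"
    using models_isomorphic[OF copy] models_isomorphic[OF isomorphic_sym[OF copy]] by blast
  also have "\<dots> \<longleftrightarrow> isomorphic A R ?B ?S"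
    using \<phi> B(2) by (simp add: scott_sentence_def)
  also have "\<dots> \<longleftrightarrow> isomorphic A R B S"
    using isomorphic_trans[OF _ copy] isomorphic_trans[OF _ isomorphic_sym[OF copy]] by blast
  finally show ?thesis .
qed

lemma scott_sentence_complexity_isomorphic:
  assumes "isomorphic A R B S" "scott_sentence_complexity A R \<Gamma>"
  shows "scott_sentence_complexity B S \<Gamma>"
proof -
  have "isomorphic A R C T \<longleftrightarrow> isomorphic B S C T" for C :: "nat set" and T
    using assms(1) isomorphic_trans isomorphic_sym by metis
  then have "scott_sentence A R \<phi> \<longleftrightarrow> scott_sentence B S \<phi>" for \<phi>
    by (simp add: scott_sentence_def)
  then show ?thesis
    using assms(2) by (simp add: scott_sentence_complexity_def has_scott_sentence_in_def)
qed

lemma equivalentI: "(\<And>B S e. sat B S \<phi> (e :: nat \<Rightarrow> nat) \<longleftrightarrow> sat B S \<psi> e) \<Longrightarrow> equivalent \<phi> \<psi>"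
  by (simp add: equivalent_def models_def)

lemma class_le_Sigma_Sigma: "0 < \<alpha> \<Longrightarrow> \<alpha> \<le> \<beta> \<Longrightarrow> class_le (SigmaC \<alpha>) (SigmaC \<beta>)"
  unfolding class_le_def using Sigma_in_mono by (auto simp: equivalent_def)

lemma class_le_Sigma_Pi:
  assumes "\<alpha> < \<beta>"
  shows "class_le (SigmaC \<alpha>) (PiC \<beta>)"
  unfolding class_le_def
proof (intro allI impI)
  fix \<phi> assume "sentence \<phi> \<and> in_class (SigmaC \<alpha>) \<phi>"
  then show "\<exists>\<psi>. sentence \<psi> \<and> in_class (PiC \<beta>) \<psi> \<and> equivalent \<phi> \<psi>"
    using Pi_in_trivial_conj[OF _ assms]
    by (intro exI[of _ "trivial_conj \<phi>"]) (auto simp: sentence_def intro: equivalentI)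
qed

lemma class_le_Sigma_dSigma:
  assumes "0 < \<alpha>" "\<alpha> \<le> \<beta>"
  shows "class_le (SigmaC \<alpha>) (dSigmaC \<beta>)"
  unfolding class_le_def
proof (intro allI impI)
  fix \<phi> assume \<phi>: "sentence \<phi> \<and> in_class (SigmaC \<alpha>) \<phi>"
  let ?true = "trivial_conj (Neg Bot)"
  have "0 < \<beta>" using assms by (rule order.strict_trans2)
  then have "Pi_in \<beta> ?true" by (intro Pi_in_trivial_conj[OF Sigma_zero]) simp_all
  then have "dSigma_in \<beta> (And \<phi> ?true)"
    unfolding dSigma_in_def using Sigma_in_mono[OF _ assms] \<phi> by auto
  then show "\<exists>\<psi>. sentence \<psi> \<and> in_class (dSigmaC \<beta>) \<psi> \<and> equivalent \<phi> \<psi>"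
    using \<phi> by (intro exI[of _ "And \<phi> ?true"]) (auto simp: sentence_def intro: equivalentI)
qed

lemma ex_equivalent_Pi:
  assumes \<Delta>: "\<not> class_le (SigmaC \<alpha>) \<Delta>" "0 < complexity_index \<Delta>" "0 < \<alpha>"
    and \<phi>: "in_class \<Delta> \<phi>" "sentence \<phi>"
  shows "\<exists>\<psi>. Pi_in \<alpha> \<psi> \<and> sentence \<psi> \<and> equivalent \<phi> \<psi>"
proof (cases \<Delta>)
  case (SigmaC \<beta>)
  then have "\<beta> < \<alpha>" using \<Delta>(1) class_le_Sigma_Sigma[OF \<Delta>(3)] not_less by blast
  then have "class_le (SigmaC \<beta>) (PiC \<alpha>)" by (rule class_le_Sigma_Pi)
  then show ?thesis using \<phi> SigmaC by (auto simp: class_le_def)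
next
  case (PiC \<beta>)
  then have "\<beta> \<le> \<alpha>" using \<Delta>(1) class_le_Sigma_Pi[of \<alpha> \<beta>] by (meson not_le)
  then have "Pi_in \<alpha> \<phi>" using Pi_in_mono \<phi>(1) \<Delta>(2) PiC by simp
  then show ?thesis using \<phi>(2) by (auto simp: equivalent_def)
next
  case (dSigmaC \<beta>)
  then have less: "\<beta> < \<alpha>" using \<Delta>(1) class_le_Sigma_dSigma[OF \<Delta>(3)] not_less by blast
  obtain \<phi>\<^sub>1 \<phi>\<^sub>2 where \<phi>_eq: "\<phi> = And \<phi>\<^sub>1 \<phi>\<^sub>2" and "Sigma_in \<beta> \<phi>\<^sub>1" "Pi_in \<beta> \<phi>\<^sub>2"
    using \<phi>(1) dSigmaC by (auto simp: dSigma_in_def)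
  then have "Pi_in \<alpha> (trivial_conj \<phi>\<^sub>1)" "Pi_in \<alpha> \<phi>\<^sub>2"
    using Pi_in_trivial_conj[OF _ less] Pi_in_mono[of \<beta> \<phi>\<^sub>2 \<alpha>] \<Delta>(2) dSigmaC less by simp_all
  then obtain \<psi> where "Pi_in \<alpha> \<psi>" "fv \<psi> = fv (trivial_conj \<phi>\<^sub>1) \<union> fv \<phi>\<^sub>2"
    "\<And>(B :: nat set) S e. sat B S \<psi> e \<longleftrightarrow> sat B S (trivial_conj \<phi>\<^sub>1) e \<and> sat B S \<phi>\<^sub>2 e"
    using \<Delta>(3) by (rule Pi_in_conj) (rule that)
  then show ?thesis
    using \<phi>(2) by (intro exI[of _ \<psi>]) (auto simp: \<phi>_eq sentence_def intro: equivalentI)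
qed

lemma scott_sentence_complexity_SigmaI:
  assumes "0 < \<alpha>" "Sigma_in \<alpha> \<phi>" "scott_sentence A R \<phi>"
    and no_Pi: "\<And>\<psi>. Pi_in \<alpha> \<psi> \<Longrightarrow> \<not> scott_sentence A R \<psi>"
  shows "scott_sentence_complexity A R (SigmaC \<alpha>)"
proof -
  have "class_le (SigmaC \<alpha>) \<Delta>"
    if \<Delta>: "0 < complexity_index \<Delta>" "in_class \<Delta> \<chi>" "scott_sentence A R \<chi>" for \<Delta> \<chi>
  proof (rule ccontr)
    assume "\<not> class_le (SigmaC \<alpha>) \<Delta>"
    moreover have "sentence \<chi>" using \<Delta>(3) by (simp add: scott_sentence_def)
    ultimately obtain \<psi> where "Pi_in \<alpha> \<psi>" "sentence \<psi>" "equivalent \<chi> \<psi>"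
      using ex_equivalent_Pi[OF _ \<Delta>(1) assms(1) \<Delta>(2)] by blast
    moreover from this have "scott_sentence A R \<psi>"
      using \<Delta>(3) unfolding scott_sentence_def equivalent_def by blast
    ultimately show False using no_Pi by blast
  qed
  then show ?thesis
    unfolding scott_sentence_complexity_def has_scott_sentence_in_def using assms(1-3) by auto
qed

definition linear_order_sentence :: form where
  "linear_order_sentence = Conj (\<lambda>_. Alls [0, 1, 2] (And (Le 0 0)
     (And (Or (Neg (And (Le 0 1) (Le 1 0))) (Eq 0 1))
       (And (Or (Neg (And (Le 0 1) (Le 1 2))) (Le 0 2)) (Or (Le 0 1) (Le 1 0))))))"

lemma sat_linear_order_sentence [simp]: "sat B S linear_order_sentence e \<longleftrightarrow> linearly_ordered B S"
  by (auto simp: linear_order_sentence_def linearly_ordered_iff Alls_def)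

lemma fv_linear_order_sentence [simp]: "fv linear_order_sentence = {}"
  by (auto simp: linear_order_sentence_def)

lemma Pi_in_linear_order_sentence: "0 < \<alpha> \<Longrightarrow> Pi_in \<alpha> linear_order_sentence"
  unfolding linear_order_sentence_def by (rule Pi_pos[where \<beta> = "\<lambda>_. 0"]) (auto intro!: Sigma_zero)

lemma ex_Sigma_sentence_ex_point:
  fixes P :: "'a set \<Rightarrow> 'a rel \<Rightarrow> 'a \<Rightarrow> bool"
  assumes P: "Pi_definable \<alpha> {0} (\<lambda>B S e. P B S (e 0))" and "0 < \<alpha>"
  obtains \<phi> where "Sigma_in (succ_ord \<alpha>) \<phi>" "sentence \<phi>"
    "\<And>B S. B \<noteq> {} \<Longrightarrow> models B S \<phi> \<longleftrightarrow> linearly_ordered B S \<and> (\<exists>p\<in>B. P B S p)"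
proof -
  obtain \<psi> where \<psi>: "Pi_in \<alpha> \<psi>" "fv \<psi> \<subseteq> {0}"
    "\<And>B S (e :: nat \<Rightarrow> 'a). linearly_ordered B S \<Longrightarrow> range e \<subseteq> B \<Longrightarrow> sat B S \<psi> e \<longleftrightarrow> P B S (e 0)"
    by (rule Pi_definableE[OF P]) (rule that)
  obtain \<chi> where \<chi>: "Pi_in \<alpha> \<chi>" "fv \<chi> = fv linear_order_sentence \<union> fv \<psi>"
    "\<And>B S (e :: nat \<Rightarrow> 'a). sat B S \<chi> e \<longleftrightarrow> sat B S linear_order_sentence e \<and> sat B S \<psi> e"
    by (rule Pi_in_conj[OF Pi_in_linear_order_sentence[OF assms(2)] \<psi>(1) assms(2)]) (rule that)
  let ?\<phi> = "Disj (\<lambda>_. Exs [0] \<chi>)"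
  have sat_iff: "sat B S ?\<phi> e \<longleftrightarrow> linearly_ordered B S \<and> (\<exists>p\<in>B. P B S p)"
    if e: "range e \<subseteq> B" for B S and e :: "nat \<Rightarrow> 'a"
  proof -
    have "range (e(0 := p)) \<subseteq> B" if "p \<in> B" for p using e that by auto
    then show ?thesis using \<psi>(3)[of B S "e(0 := _)"] by (auto simp: Exs_def \<chi>(3))
  qed
  have "models B S ?\<phi> \<longleftrightarrow> linearly_ordered B S \<and> (\<exists>p\<in>B. P B S p)" if nonempty: "B \<noteq> {}" for B S
  proof -
    obtain b where "b \<in> B" using nonempty by blast
    then have "range (\<lambda>_ :: nat. b) \<subseteq> B" by auto
    with sat_iff show ?thesis unfolding models_def by blast
  qed
  moreover have "Sigma_in (succ_ord \<alpha>) ?\<phi>"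
    by (rule Sigma_pos[where \<beta> = "\<lambda>_. \<alpha>"]) (simp add: \<chi>(1))
  moreover have "sentence ?\<phi>" using \<chi>(2) \<psi>(2) by (auto simp: sentence_def)
  ultimately show ?thesis using that by blast
qed

context limit_orders
begin

lemma orders_nonempty: "cut_order \<noteq> {}" "full_order \<noteq> {}"
proof -
  have "(cut, {#}) \<in> cut_order" "(cut, {#}) \<in> full_order" using cut_mem by auto
  then show "cut_order \<noteq> {}" "full_order \<noteq> {}" by blast+
qed

lemma canonical_sentence:
  obtains \<phi> where "Sigma_in (succ_ord (succ_ord l)) \<phi>" "sentence \<phi>"
    "\<And>(B :: elem set) S. B \<noteq> {} \<Longrightarrow> models B S \<phi> \<longleftrightarrow> linearly_ordered B S \<and> (\<exists>p\<in>B. canonical l B S p)"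
  by (rule ex_Sigma_sentence_ex_point[OF Pi_definable_canonical[OF limit] succ_ord_pos]) (rule that)

lemma models_cut_order:
  assumes "\<And>(B :: elem set) S. B \<noteq> {} \<Longrightarrow> models B S \<phi> \<longleftrightarrow> linearly_ordered B S \<and> (\<exists>p\<in>B. canonical l B S p)"
  shows "models cut_order cut_le \<phi>"
proof -
  interpret canonical_order cut_order cut_le l "(cut, {#})" by (rule canonical_order_cut_order)
  show ?thesis using assms[OF orders_nonempty(1)] linearly_ordered_axioms p_mem canonical by blast
qed

lemma cut_order_not_isomorphic_full_order: "\<not> isomorphic cut_order cut_le full_order full_le"
proof
  assume iso: "isomorphic cut_order cut_le full_order full_le"
  obtain \<phi> where \<phi>: "\<And>(B :: elem set) S. B \<noteq> {} \<Longrightarrow>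
      models B S \<phi> \<longleftrightarrow> linearly_ordered B S \<and> (\<exists>p\<in>B. canonical l B S p)"
    by (rule canonical_sentence) (rule that)
  have "models full_order full_le \<phi>" by (rule models_isomorphic[OF iso models_cut_order[OF \<phi>]])
  then show False using \<phi>[OF orders_nonempty(2)] not_canonical_full_order by blast
qed

lemma no_Pi_scott_sentence:
  assumes "Pi_in (succ_ord (succ_ord l)) \<chi>"
  shows "\<not> scott_sentence cut_order cut_le \<chi>"
proof
  assume \<chi>: "scott_sentence cut_order cut_le \<chi>"
  then have "models cut_order cut_le \<chi>"
    using scott_sentence_models_iff[OF \<chi> countable_blocks[OF cut_indices_subset] orders_nonempty(1)] by simp
  then have "models full_order full_le \<chi>"
    using models_Pi_cut_imp_full[OF assms] \<chi> by (simp add: scott_sentence_def)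
  then show False
    using scott_sentence_models_iff[OF \<chi> countable_blocks[OF order.refl] orders_nonempty(2)]
      cut_order_not_isomorphic_full_order by simp
qed

text \<open>The canonical sentence describes structures on \<^typ>\<open>elem\<close>; structures on natural numbers are copied
  into this type.\<close>

lemma ex_Sigma_scott_sentence:
  "\<exists>\<phi>. Sigma_in (succ_ord (succ_ord l)) \<phi> \<and> scott_sentence cut_order cut_le \<phi>"
proof -
  obtain \<phi> where \<phi>: "Sigma_in (succ_ord (succ_ord l)) \<phi>" "sentence \<phi>"
    "\<And>(B :: elem set) S. B \<noteq> {} \<Longrightarrow> models B S \<phi> \<longleftrightarrow> linearly_ordered B S \<and> (\<exists>p\<in>B. canonical l B S p)"
    by (rule canonical_sentence) (rule that)
  have "isomorphic cut_order cut_le B S" if B: "B \<noteq> {}" "models B S \<phi>" for B :: "nat set" and S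
  proof -
    define h :: "nat \<Rightarrow> elem" where "h n = ((0, real n, 0), {#})" for n
    let ?B = "h ` B" and ?S = "dir_image (Restr S B) h"
    have copy: "isomorphic B S ?B ?S"
      by (rule isomorphicI[OF rel_iso_dir_image]) (auto simp: h_def inj_on_def)
    have "?B \<noteq> {}" using B(1) by simp
    then obtain p where p: "linearly_ordered ?B ?S" "p \<in> ?B" "canonical l ?B ?S p"
      using \<phi>(3)[of ?B ?S] models_isomorphic[OF copy B(2)] by blast
    have "canonical_order ?B ?S l p"
      by (intro canonical_order.intro canonical_order_axioms.intro countable_image p) simp
    then have "isomorphic cut_order cut_le ?B ?S"
      using canonical_order_cut_order by (intro two_canonical_orders.isomorphic two_canonical_orders.intro)
    then show ?thesis using isomorphic_sym[OF copy] by (rule isomorphic_trans)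
  qed
  moreover have "models B S \<phi>" if "isomorphic cut_order cut_le B S" for B :: "nat set" and S
    using that models_cut_order[OF \<phi>(3)] by (rule models_isomorphic)
  ultimately show ?thesis using \<phi>(1,2) unfolding scott_sentence_def by blast
qed

theorem scott_sentence_complexity_cut_order:
  "scott_sentence_complexity cut_order cut_le (SigmaC (succ_ord (succ_ord l)))"
  using ex_Sigma_scott_sentence scott_sentence_complexity_SigmaI[OF succ_ord_pos] no_Pi_scott_sentence by blast

end

theorem mainTheorem5:
  fixes l :: omega1
  assumes "limit_ord l"
  shows "\<exists>(A :: nat set) R. A \<noteq> {} \<and> linear_order_on A R \<and>
           scott_sentence_complexity A R (SigmaC (succ_ord (succ_ord l)))"
proof -
  obtain \<theta> :: real where "\<theta> \<notin> \<rat>" using ex_irrational by blast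
  with assms interpret limit_orders l \<theta> by unfold_locales
  obtain A :: "nat set" and R where copy: "isomorphic cut_order cut_le A R" "linear_order_on A R"
    by (rule ex_countable_linear_order_copy[OF countable_blocks linear_order_on_blocks])
      (rule cut_indices_subset, rule cut_indices_subset, rule that)
  then show ?thesis
    using isomorphic_nonempty[OF copy(1) orders_nonempty(1)]
      scott_sentence_complexity_isomorphic[OF copy(1) scott_sentence_complexity_cut_order] by blast
qed

end
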